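(* Let $P,Q\in\mathcal{P}^\omega$. Then $E(\Sigma_P)\leq_B E(\Sigma_Q)$ if and only if $Q\preceq P$, if and only if there is a nonzero (i.e. non-trivial) continuous homomorphism $f:\Sigma_P\to\Sigma_Q$.
   Context: $\mathcal{P}$ is the set of all prime numbers and $\mathbb{T}$ the multiplicative group of complex numbers of modulus $1$. For $P\in\mathcal{P}^\omega$, the $P$-adic solenoid is the compact group $\Sigma_P=\{g\in\mathbb{T}^\omega:\forall l\,(g(l)=g(l+1)^{P(l)})\}$ (subgroup of $\mathbb{T}^\omega$ with the product topology). For $P,Q\in\mathcal{P}^\omega$, $Q\preceq P$ means there is an injection $f:\omega\to\omega$ such that $Q(n)=P(f(n))$ for all sufficiently large $n$. For a Polish group $G$, $E(G)$ is the equivalence relation on $G^\omega$ given by $x\,E(G)\,y$ iff $(x(n)y(n)^{-1})_n$ converges in $G$. $E\leq_B F$ means there is a Borel map $\theta$ with $x E y\iff \theta(x) F \theta(y)$.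
   Formalization: In Q ⪯ P, f need only be injective on a cofinite set of n on which Q(n)=P(f(n)), not on all of ω; with a total injection the claim fails for P=(2,3,5,7,…), Q=(2,2,2,3,5,7,…), whose solenoids are isomorphic. *)

theory Defs
  imports "HOL-Analysis.Analysis" "HOL-Algebra.Group" "HOL-Computational_Algebra.Primes"
begin

text \<open>
  The type \<^typ>\<open>nat \<Rightarrow> 'a\<close> carries the product topology, so the solenoid, as a subset of
  \<^typ>\<open>nat \<Rightarrow> complex\<close>, has the subspace topology inherited from the countable power of the
  circle group.
\<close>

definition solenoid :: "(nat \<Rightarrow> nat) \<Rightarrow> (nat \<Rightarrow> complex) monoid" where
  "solenoid P =
    \<lparr>carrier = {g. (\<forall>l. g l \<in> sphere 0 1) \<and> (\<forall>l. g l = g (Suc l) ^ P l)},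
     mult = (\<lambda>g h l. g l * h l),
     one = (\<lambda>l. 1)\<rparr>"

lemma mem_solenoid_iff:
  "g \<in> carrier (solenoid P) \<longleftrightarrow> (\<forall>l. norm (g l) = 1) \<and> (\<forall>l. g (Suc l) ^ P l = g l)"
proof -
  have "(\<forall>l. g l = g (Suc l) ^ P l) \<longleftrightarrow> (\<forall>l. g (Suc l) ^ P l = g l)"
    by (metis (no_types))
  then show ?thesis
    unfolding solenoid_def partial_object.simps mem_Collect_eq mem_sphere_0 by argo
qed

lemma mult_solenoid: "g \<otimes>\<^bsub>solenoid P\<^esub> h = (\<lambda>l. g l * h l)"
  by (simp add: solenoid_def)

lemma one_solenoid: "\<one>\<^bsub>solenoid P\<^esub> = (\<lambda>l. 1)"
  by (simp add: solenoid_def)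

lemma comm_group_solenoid: "comm_group (solenoid P)"
proof (rule comm_groupI)
  fix g assume g: "g \<in> carrier (solenoid P)"
  have "(\<lambda>l. inverse (g l)) \<in> carrier (solenoid P)"
    using g by (simp add: mem_solenoid_iff norm_inverse power_inverse)
  moreover have "(\<lambda>l. inverse (g l)) \<otimes>\<^bsub>solenoid P\<^esub> g = \<one>\<^bsub>solenoid P\<^esub>"
  proof -
    have "g l \<noteq> 0" for l
      using g by (metis mem_solenoid_iff norm_zero zero_neq_one)
    then show ?thesis by (simp add: mult_solenoid one_solenoid)
  qed
  ultimately show "\<exists>h\<in>carrier (solenoid P). h \<otimes>\<^bsub>solenoid P\<^esub> g = \<one>\<^bsub>solenoid P\<^esub>"
    by blast
qed (simp_all add: mem_solenoid_iff mult_solenoid one_solenoid norm_mult power_mult_distrib mult_ac)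

text \<open>
  The matching \<open>f\<close> is an injection on the cofinite set where \<open>Q n = P (f n)\<close> is required; it
  need not extend to an injection on all of \<open>\<nat>\<close>. For \<open>P = (2,3,5,7,\<dots>)\<close> and
  \<open>Q = (2,2,2,3,5,7,\<dots>)\<close> no such extension exists, although dropping two coordinates is an
  isomorphism from the solenoid of \<open>Q\<close> onto that of \<open>P\<close>.
\<close>

definition prime_seq_le :: "(nat \<Rightarrow> nat) \<Rightarrow> (nat \<Rightarrow> nat) \<Rightarrow> bool" (infix "\<preceq>" 50) where
  "Q \<preceq> P \<longleftrightarrow> (\<exists>A f. finite (- A) \<and> inj_on f A \<and> (\<forall>n\<in>A. Q n = P (f n)))"

definition seqs :: "('a, 'b) monoid_scheme \<Rightarrow> (nat \<Rightarrow> 'a) set" where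
  "seqs G = {x. \<forall>n. x n \<in> carrier G}"

definition coset_rel ::
  "('a :: topological_space, 'b) monoid_scheme \<Rightarrow> ((nat \<Rightarrow> 'a) \<times> (nat \<Rightarrow> 'a)) set" where
  "coset_rel G = {(x, y). x \<in> seqs G \<and> y \<in> seqs G \<and>
     (\<exists>l\<in>carrier G. (\<lambda>n. x n \<otimes>\<^bsub>G\<^esub> inv\<^bsub>G\<^esub> y n) \<longlonglongrightarrow> l)}"

definition borel_reducible ::
  "'a :: topological_space set \<Rightarrow> ('a \<times> 'a) set \<Rightarrow> 'b :: topological_space set \<Rightarrow> ('b \<times> 'b) set \<Rightarrow> bool"
  where
  "borel_reducible X E Y F \<longleftrightarrow>
     (\<exists>\<theta> \<in> restrict_space borel X \<rightarrow>\<^sub>M restrict_space borel Y.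
        \<forall>x\<in>X. \<forall>y\<in>X. (x, y) \<in> E \<longleftrightarrow> (\<theta> x, \<theta> y) \<in> F)"

end

theory Submission
  imports Defs "HOL-Library.Function_Algebras" "HOL-Library.Omega_Words_Fun"
begin

text \<open>
  Let \<open>one_param P\<close> be the dense one-parameter subgroup of the solenoid of \<open>P\<close>. All three conditions
  are equivalent to the existence of \<open>c > 0\<close> such that every finite product \<open>Q 0 \<cdots> Q (j - 1)\<close> divides
  some \<open>c P 0 \<cdots> P (k - 1)\<close>. For \<open>Q \<preceq> P\<close> this is a count of prime factors. For homomorphisms, observe
  that on the rational points of \<open>one_param P\<close> each coordinate of a continuous homomorphism is a
  character \<open>cis (2 \<pi> a t)\<close>, and that continuity for the solenoid topology forces it to have some
  period \<open>P 0 \<cdots> P (k - 1)\<close>.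

  Such a homomorphism yields a reduction: a sequence in the solenoid of \<open>P\<close> converges iff its
  image converges and consecutive quotients tend to the identity, because the kernel is totally
  disconnected; the second condition is coded by small real numbers on the one-parameter
  subgroup of the target.

  Conversely, a Borel reduction is continuous on a comeagre set. Feeding it rational increments from
  finite sets, separated by suitable fixed words, makes it nearly additive: an increment \<open>g\<close> at place
  \<open>n\<close> contributes \<open>contribution n g\<close> to the limit. Moving a small increment to the next place does not
  change the equivalence class, which forces \<open>contribution n\<close> to become additive as \<open>n\<close> grows; a limit
  point of \<open>contribution\<close> is a continuous homomorphism. If it were trivial, the harmonic increments
  \<open>1 / (k + 1)\<close>, placed sparsely, would be equivalent to the zero sequence although their sums do not
  converge on the circle.
\<close>

subsection \<open>Sequences\<close>

lemma tendsto_fun_iff: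
  fixes f :: "'b \<Rightarrow> 'i \<Rightarrow> 'a::topological_space"
  shows "(f \<longlongrightarrow> L) F \<longleftrightarrow> (\<forall>i. ((\<lambda>n. f n i) \<longlongrightarrow> L i) F)"
  using limitin_componentwise[of "\<lambda>_. euclidean" UNIV f L F]
  by (simp add: euclidean_product_topology)

lemma convergent_fun_iff:
  fixes f :: "nat \<Rightarrow> 'i \<Rightarrow> 'a::topological_space"
  shows "convergent f \<longleftrightarrow> (\<forall>i. convergent (\<lambda>n. f n i))"
  unfolding convergent_def tendsto_fun_iff by metis

lemma compact_UNIV_fun:
  assumes "compact (UNIV :: 'a::topological_space set)"
  shows "compact (UNIV :: ('i \<Rightarrow> 'a) set)"
  using assms compact_space_product_topology[of "\<lambda>_ :: 'i. euclidean :: 'a topology" UNIV]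
  by (simp add: compact_space_def euclidean_product_topology)

lemma frequently_imp_subseq_limit:
  fixes z :: "nat \<Rightarrow> 'a::first_countable_topology"
  assumes "compact K" "\<And>n. z n \<in> K" and "\<exists>\<^sub>F n in sequentially. S n"
  obtains r L where "strict_mono r" "\<And>n. S (r n)" "(\<lambda>n. z (r n)) \<longlonglongrightarrow> L" "L \<in> K"
proof -
  have "infinite {n. S n}"
    using assms(3) by (simp add: cofinite_eq_sequentially[symmetric] frequently_cofinite)
  then obtain f :: "nat \<Rightarrow> nat" where f: "strict_mono f" "\<And>n. S (f n)"
    using infinite_enumerate[of "{n. S n}"] by auto
  have "seq_compact K"
    using assms(1) by (rule compact_imp_seq_compact)
  then obtain L g where "L \<in> K" "strict_mono g" "((z \<circ> f) \<circ> g) \<longlonglongrightarrow> L"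
    by (rule seq_compactE[of _ "z \<circ> f"]) (use assms(2) in auto)
  then show ?thesis
    using that[of "f \<circ> g" L] f strict_mono_o by (auto simp: o_def)
qed

lemma eventually_near_limit_points:
  fixes z :: "nat \<Rightarrow> 'a::metric_space"
  assumes "compact K" "\<And>n. z n \<in> K"
    and limits: "\<And>r L. strict_mono r \<Longrightarrow> (\<lambda>n. z (r n)) \<longlonglongrightarrow> L \<Longrightarrow> L \<in> R" and "e > 0"
  shows "\<forall>\<^sub>F n in sequentially. \<exists>L\<in>R. dist (z n) L < e"
proof (rule ccontr)
  assume "\<not> ?thesis"
  then have "\<exists>\<^sub>F n in sequentially. \<forall>L\<in>R. e \<le> dist (z n) L"
    by (simp add: not_eventually not_less)
  then obtain r L where r: "strict_mono r" "\<And>n. \<forall>L\<in>R. e \<le> dist (z (r n)) L" "(\<lambda>n. z (r n)) \<longlonglongrightarrow> L"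
    by (rule frequently_imp_subseq_limit[of K z, OF assms(1,2)]) blast
  have "\<forall>\<^sub>F n in sequentially. dist (z (r n)) L < e"
    using r(3) \<open>e > 0\<close> by (rule tendstoD)
  then show False
    using r(2) limits[OF r(1,3)] by (auto simp: eventually_sequentially not_less[symmetric])
qed

lemma slowly_varying_near_one_point:
  fixes z :: "nat \<Rightarrow> 'a::metric_space"
  assumes separated: "\<And>L M. L \<in> R \<Longrightarrow> M \<in> R \<Longrightarrow> dist L M < d \<Longrightarrow> L = M"
    and near: "\<forall>\<^sub>F n in sequentially. \<exists>L\<in>R. dist (z n) L < d / 4"
    and slow: "\<forall>\<^sub>F n in sequentially. dist (z (Suc n)) (z n) < d / 4"
  obtains L where "L \<in> R" "\<forall>\<^sub>F n in sequentially. dist (z n) L < d / 4"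
proof -
  obtain N where N: "\<And>n. n \<ge> N \<Longrightarrow> (\<exists>L\<in>R. dist (z n) L < d / 4) \<and> dist (z (Suc n)) (z n) < d / 4"
    using eventually_conj[OF near slow] unfolding eventually_sequentially by blast
  then obtain L where L: "L \<in> R" "dist (z N) L < d / 4"
    by blast
  have "dist (z n) L < d / 4" if "n \<ge> N" for n
    using that
  proof (induction n rule: dec_induct)
    case (step n)
    obtain M where M: "M \<in> R" "dist (z (Suc n)) M < d / 4"
      using N[of "Suc n"] step by auto
    moreover have "dist (z (Suc n)) L < d / 2"
      using N[OF \<open>N \<le> n\<close>] step.IH dist_triangle[of "z (Suc n)" L "z n"] by simp
    ultimately show ?case
      using separated[of L M] L(1) dist_triangle3[of L M "z (Suc n)"] zero_le_dist[of "z (Suc n)" M] by simp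
  qed (use L in simp)
  then show ?thesis
    using that[OF L(1)] unfolding eventually_sequentially by blast
qed

lemma convergent_if_slowly_varying:
  fixes z :: "nat \<Rightarrow> 'a::metric_space"
  assumes K: "compact K" "\<And>n. z n \<in> K" and R: "uniform_discrete R"
    and limits: "\<And>r L. strict_mono r \<Longrightarrow> (\<lambda>n. z (r n)) \<longlonglongrightarrow> L \<Longrightarrow> L \<in> R"
    and slow: "(\<lambda>n. dist (z (Suc n)) (z n)) \<longlonglongrightarrow> 0"
  shows "convergent z"
proof -
  obtain d where "d > 0" and d: "\<And>L M. L \<in> R \<Longrightarrow> M \<in> R \<Longrightarrow> dist L M < d \<Longrightarrow> L = M"
    using R unfolding uniform_discrete_def by blast
  have near: "\<forall>\<^sub>F n in sequentially. \<exists>L\<in>R. dist (z n) L < e" if "e > 0" for e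
    using K limits that by (rule eventually_near_limit_points)
  have "\<forall>\<^sub>F n in sequentially. dist (z (Suc n)) (z n) < d / 4"
    using slow \<open>d > 0\<close> by (intro order_tendstoD) auto
  then obtain L where L: "L \<in> R" "\<forall>\<^sub>F n in sequentially. dist (z n) L < d / 4"
    using slowly_varying_near_one_point[of R d z, OF d near] \<open>d > 0\<close> by auto
  have "z \<longlonglongrightarrow> L"
  proof (rule tendstoI)
    fix e :: real assume "e > 0"
    then have "\<forall>\<^sub>F n in sequentially. \<exists>M\<in>R. dist (z n) M < min e (d / 4)"
      using \<open>d > 0\<close> by (intro near) simp
    with L(2) show "\<forall>\<^sub>F n in sequentially. dist (z n) L < e"
    proof eventually_elim
      case (elim n)
      then obtain M where M: "M \<in> R" "dist (z n) M < e" "dist (z n) M < d / 4"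
        by auto
      then show ?case
        using d[OF L(1) M(1)] elim(1) dist_triangle3[of L M "z n"] \<open>d > 0\<close> by simp
    qed
  qed
  then show ?thesis
    by (rule convergentI)
qed

lemma tendsto_mod_div_iff:
  fixes f :: "nat \<Rightarrow> nat \<Rightarrow> 'a::topological_space"
  assumes "k > 0"
  shows "(\<lambda>n. f (n mod k) (n div k)) \<longlonglongrightarrow> L \<longleftrightarrow> (\<forall>i<k. f i \<longlonglongrightarrow> L)"
proof (intro iffI allI impI)
  fix i assume lim: "(\<lambda>n. f (n mod k) (n div k)) \<longlonglongrightarrow> L" and "i < k"
  have "filterlim (\<lambda>n. k * n + i) sequentially sequentially"
    using assms by (intro filterlim_subseq) (simp add: strict_mono_def)
  from filterlim_compose[OF lim this] show "f i \<longlonglongrightarrow> L"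
    using \<open>i < k\<close> by simp
next
  assume lim: "\<forall>i<k. f i \<longlonglongrightarrow> L"
  show "(\<lambda>n. f (n mod k) (n div k)) \<longlonglongrightarrow> L"
  proof (rule topological_tendstoI)
    fix U assume "open U" "L \<in> U"
    then have "\<forall>\<^sub>F m in sequentially. \<forall>i\<in>{..<k}. f i m \<in> U"
      using lim by (intro eventually_ball_finite) (auto dest: topological_tendstoD)
    moreover have "filterlim (\<lambda>n. n div k) sequentially sequentially"
      using filterlim_at_top_div_const_nat[OF assms] .
    ultimately have "\<forall>\<^sub>F n in sequentially. \<forall>i\<in>{..<k}. f i (n div k) \<in> U"
      by (rule eventually_compose_filterlim)
    then show "\<forall>\<^sub>F n in sequentially. f (n mod k) (n div k) \<in> U"
      by eventually_elim (use assms in simp)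
  qed
qed

lemma tendsto_prod_decode_iff:
  fixes a :: "nat \<Rightarrow> nat \<Rightarrow> 'a::real_normed_vector"
  assumes bound: "\<And>n q. norm (a n q) \<le> b q" and b: "b \<longlonglongrightarrow> 0"
  shows "(\<lambda>m. case prod_decode m of (n, q) \<Rightarrow> a n q) \<longlonglongrightarrow> 0 \<longleftrightarrow> (\<forall>q. (\<lambda>n. a n q) \<longlonglongrightarrow> 0)"
proof (intro iffI allI)
  fix q assume lim: "(\<lambda>m. case prod_decode m of (n, q) \<Rightarrow> a n q) \<longlonglongrightarrow> 0"
  have "filterlim (\<lambda>n. prod_encode (n, q)) sequentially sequentially"
    by (rule filterlim_at_top_mono[OF filterlim_ident]) (simp add: le_prod_encode_1)
  from filterlim_compose[OF lim this] show "(\<lambda>n. a n q) \<longlonglongrightarrow> 0"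
    by simp
next
  assume lim: "\<forall>q. (\<lambda>n. a n q) \<longlonglongrightarrow> 0"
  have "finite {m. \<not> norm (case prod_decode m of (n, q) \<Rightarrow> a n q) < e}" if "e > 0" for e
  proof -
    obtain q\<^sub>0 where q\<^sub>0: "\<And>q. q \<ge> q\<^sub>0 \<Longrightarrow> norm (b q) < e"
      using tendstoD[OF b \<open>e > 0\<close>] unfolding eventually_sequentially by auto
    have "norm (a n q) < e" if "q \<ge> q\<^sub>0" for n q
      using bound[of n q] q\<^sub>0[OF that] by simp
    then have "{(n, q). \<not> norm (a n q) < e} \<subseteq> (\<Union>q<q\<^sub>0. {n. \<not> norm (a n q) < e} \<times> {q})"
      by (auto simp: not_le[symmetric])
    moreover have "finite {n. \<not> norm (a n q) < e}" for q
      using tendstoD[OF lim[rule_format, of q] \<open>e > 0\<close>]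
      by (simp add: eventually_cofinite cofinite_eq_sequentially[symmetric])
    ultimately have "finite {(n, q). \<not> norm (a n q) < e}"
      by (elim finite_subset) simp
    from finite_vimageI[OF this inj_prod_decode] show ?thesis
      by (simp add: vimage_def case_prod_unfold)
  qed
  then show "(\<lambda>m. case prod_decode m of (n, q) \<Rightarrow> a n q) \<longlonglongrightarrow> 0"
    by (simp add: tendsto_iff eventually_cofinite cofinite_eq_sequentially[symmetric])
qed

lemma sparse_selection:
  fixes R :: "nat \<Rightarrow> nat \<Rightarrow> bool"
  assumes "\<And>k N. \<exists>n\<ge>N. R k n"
  obtains r where "strict_mono r" "\<And>k. R k (r k)"
proof -
  have "\<exists>r. \<forall>k. R k (r k) \<and> r k < r (Suc k)"
    using assms Suc_le_eq by (intro dependent_nat_choice) metis+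
  then show ?thesis
    using that by (auto simp: strict_mono_Suc_iff)
qed

lemma block_selection:
  fixes R :: "nat \<Rightarrow> nat \<Rightarrow> nat \<Rightarrow> bool"
  assumes "\<And>k N. \<exists>N'>N. R k N N'"
  obtains b where "strict_mono b" "\<And>k. R k (b k) (b (Suc k))"
proof -
  have "\<exists>b. \<forall>k. True \<and> (b k < b (Suc k) \<and> R k (b k) (b (Suc k)))"
    using assms by (intro dependent_nat_choice) auto
  then show ?thesis
    using that by (auto simp: strict_mono_Suc_iff)
qed

lemma convergent_sparse_sums_iff:
  fixes f :: "nat \<Rightarrow> 'a::comm_monoid_add" and g :: "'a \<Rightarrow> 'b::topological_space"
  assumes p: "strict_mono p" and zero: "\<And>i. i \<notin> range p \<Longrightarrow> f i = 0"
  shows "convergent (\<lambda>k. g (\<Sum>i<k. f i)) \<longleftrightarrow> convergent (\<lambda>n. g (\<Sum>m<n. f (p m)))"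
proof -
  define N where "N k = (LEAST n. k \<le> p n)" for k
  have le_p_iff: "k \<le> p n \<longleftrightarrow> N k \<le> n" for k n
  proof -
    have "k \<le> p (N k)"
      unfolding N_def by (rule LeastI[of _ k]) (rule strict_mono_imp_increasing[OF p])
    then show ?thesis
      unfolding N_def using strict_mono_less_eq[OF p] by (meson Least_le order_trans)
  qed
  have sum: "(\<Sum>i<k. f i) = (\<Sum>m<N k. f (p m))" for k
  proof -
    have "p ` {..<N k} = {..<k} \<inter> range p"
      using le_p_iff by (auto simp: not_le[symmetric])
    then have "(\<Sum>i<k. f i) = (\<Sum>i\<in>p ` {..<N k}. f i)"
      using zero by (intro sum.mono_neutral_right) auto
    also have "\<dots> = (\<Sum>m<N k. f (p m))"
      using strict_mono_imp_inj_on[OF p] by (subst sum.reindex) (auto intro: inj_on_subset)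
    finally show ?thesis .
  qed
  have N_p: "N (p n) = n" for n
    using le_p_iff[of "p n"] strict_mono_less_eq[OF p] by (metis order_refl antisym)
  have N_lim: "filterlim N sequentially sequentially"
    unfolding filterlim_at_top eventually_sequentially using le_p_iff
    by (metis linorder_le_cases not_less_eq_eq)
  show ?thesis
  proof
    assume "convergent (\<lambda>k. g (\<Sum>i<k. f i))"
    from convergent_subseq_convergent[OF this p] show "convergent (\<lambda>n. g (\<Sum>m<n. f (p m)))"
      by (simp add: sum o_def N_p)
  next
    assume "convergent (\<lambda>n. g (\<Sum>m<n. f (p m)))"
    then show "convergent (\<lambda>k. g (\<Sum>i<k. f i))"
      unfolding sum convergent_def using filterlim_compose[OF _ N_lim] by blast
  qed
qed

subsection \<open>Groups with an invariant metric\<close>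

class invariant_metric_group = ab_group_add + metric_space +
  assumes dist_add_right [simp]: "dist (a + c) (b + c) = dist a b"

definition gnorm :: "'a::invariant_metric_group \<Rightarrow> real" where
  "gnorm a = dist a 0"

lemma dist_eq_gnorm: "dist a b = gnorm (a - b)" for a b :: "'a::invariant_metric_group"
  using dist_add_right[of "a - b" b 0] by (simp add: gnorm_def)

lemma gnorm_0 [simp]: "gnorm (0 :: 'a::invariant_metric_group) = 0"
  by (simp add: gnorm_def)

lemma gnorm_nonneg [simp]: "0 \<le> gnorm a"
  by (simp add: gnorm_def)

lemma gnorm_minus_commute: "gnorm (a - b) = gnorm (b - a)"
  by (simp add: dist_commute flip: dist_eq_gnorm)

lemma gnorm_triangle_ineq: "gnorm (a + b) \<le> gnorm a + gnorm b"
  using dist_triangle[of "a + b" 0 b] by (simp add: dist_eq_gnorm)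

lemma gnorm_triangle_ineq4: "gnorm (a - b) \<le> gnorm a + gnorm b"
  using dist_triangle2[of a b 0] by (simp add: dist_eq_gnorm)

lemma dist_minus [simp]: "dist (- a) (- b) = dist a b" for a b :: "'a::invariant_metric_group"
  using gnorm_minus_commute[of a b] by (simp add: dist_eq_gnorm)

lemma dist_diff_le: "dist (a - b) (c - d) \<le> dist a c + dist b d"
  for a b c d :: "'a::invariant_metric_group"
proof -
  have "dist (a - b) (c - d) = gnorm ((a - c) - (b - d))"
    by (simp add: dist_eq_gnorm algebra_simps)
  also have "\<dots> \<le> dist a c + dist b d"
    unfolding dist_eq_gnorm by (rule gnorm_triangle_ineq4)
  finally show ?thesis .
qed

lemma dist_add_le: "dist (a + b) (c + d) \<le> dist a c + dist b d"
  for a b c d :: "'a::invariant_metric_group"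
  using dist_diff_le[of a "- b" c "- d"] by simp

lemma gnorm_sum: "gnorm (sum f A) \<le> (\<Sum>x\<in>A. gnorm (f x))"
  by (induction A rule: infinite_finite_induct) (auto intro: order_trans[OF gnorm_triangle_ineq])

lemma tendsto_0_iff_gnorm: "(f \<longlongrightarrow> 0) F \<longleftrightarrow> ((\<lambda>x. gnorm (f x)) \<longlongrightarrow> 0) F"
  unfolding gnorm_def by (rule tendsto_dist_iff)

instance invariant_metric_group \<subseteq> topological_ab_group_add
proof
  fix a b :: 'a
  have "((\<lambda>x. dist (fst x) a + dist (snd x) b) \<longlongrightarrow> 0 + 0) (nhds a \<times>\<^sub>F nhds b)"
    by (intro tendsto_add iffD1[OF tendsto_dist_iff] filterlim_fst filterlim_snd)
  then have bound: "((\<lambda>x. dist (fst x) a + dist (snd x) b) \<longlongrightarrow> 0) (nhds a \<times>\<^sub>F nhds b)"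
    by simp
  show "((\<lambda>x. fst x + snd x) \<longlongrightarrow> a + b) (nhds a \<times>\<^sub>F nhds b)"
    by (subst tendsto_dist_iff, rule Lim_null_comparison[OF always_eventually bound])
      (simp add: dist_add_le)
  show "(uminus \<longlongrightarrow> - a) (nhds a)"
    by (subst tendsto_dist_iff) (simp flip: tendsto_dist_iff add: filterlim_ident)
qed

lemma Cauchy_iff_gnorm:
  "Cauchy (f :: nat \<Rightarrow> 'a::invariant_metric_group) \<longleftrightarrow> (\<forall>e>0. \<exists>N. \<forall>m\<ge>N. \<forall>n\<ge>m. gnorm (f n - f m) < e)"
  unfolding Cauchy_altdef by (metis dist_commute dist_eq_gnorm dist_self le_less)

lemma sum_atLeastLessThan_eq_diff:
  fixes f :: "nat \<Rightarrow> 'a::ab_group_add"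
  assumes "m \<le> n"
  shows "(\<Sum>k=m..<n. f k) = (\<Sum>k<n. f k) - (\<Sum>k<m. f k)"
  using sum_diff_nat_ivl[of 0 m n f] assms by (simp add: atLeast0LessThan)

lemma convergent_sum_iff:
  fixes f :: "nat \<Rightarrow> 'a::{invariant_metric_group, complete_space}"
  shows "convergent (\<lambda>n. \<Sum>k<n. f k) \<longleftrightarrow> (\<forall>e>0. \<exists>N. \<forall>m\<ge>N. \<forall>n\<ge>m. gnorm (\<Sum>k=m..<n. f k) < e)"
  by (simp add: Cauchy_convergent_iff[symmetric] Cauchy_iff_gnorm sum_atLeastLessThan_eq_diff)

lemma convergent_sum_if_summable_gnorm:
  fixes f :: "nat \<Rightarrow> 'a::{invariant_metric_group, complete_space}"
  assumes "summable (\<lambda>k. gnorm (f k))"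
  shows "convergent (\<lambda>n. \<Sum>k<n. f k)"
  unfolding convergent_sum_iff
proof (intro allI impI)
  fix e :: real assume "e > 0"
  then obtain N where N: "\<And>m n. m \<ge> N \<Longrightarrow> norm (\<Sum>k=m..<n. gnorm (f k)) < e"
    using assms unfolding summable_Cauchy by blast
  have "gnorm (\<Sum>k=m..<n. f k) < e" if "m \<ge> N" for m n
    using N[OF that, of n] gnorm_sum[of f "{m..<n}"] by simp
  then show "\<exists>N. \<forall>m\<ge>N. \<forall>n\<ge>m. gnorm (\<Sum>k=m..<n. f k) < e"
    by blast
qed

instance "fun" :: (countable, invariant_metric_group) invariant_metric_group
  by standard (simp add: dist_fun_def)

lemma sum_fun_apply: "sum f A x = (\<Sum>a\<in>A. f a x)" for f :: "'a \<Rightarrow> 'b \<Rightarrow> 'c::comm_monoid_add"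
  by (induction A rule: infinite_finite_induct) simp_all

subsection \<open>The circle group\<close>

typedef circle = "sphere (0 :: complex) 1"
  morphisms of_circle Abs_circle
  by (intro exI[of _ 1]) simp

lemma norm_of_circle [simp]: "norm (of_circle a) = 1"
  using of_circle[of a] by simp

lemma of_circle_nonzero [simp]: "of_circle a \<noteq> 0"
  using norm_of_circle[of a] by (metis norm_zero zero_neq_one)

lemma of_circle_Abs_circle: "norm z = 1 \<Longrightarrow> of_circle (Abs_circle z) = z"
  by (simp add: Abs_circle_inverse)

instantiation circle :: ab_group_add
begin

definition "0 = Abs_circle 1"
definition "a + b = Abs_circle (of_circle a * of_circle b)"
definition "a - b = Abs_circle (of_circle a / of_circle b)"
definition "- a = Abs_circle (inverse (of_circle a))"

lemma of_circle_arith [simp]: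
  "of_circle 0 = 1" "of_circle (a + b) = of_circle a * of_circle b"
  "of_circle (a - b) = of_circle a / of_circle b" "of_circle (- a) = inverse (of_circle a)"
  by (simp_all add: zero_circle_def plus_circle_def minus_circle_def uminus_circle_def of_circle_Abs_circle
      norm_mult norm_divide norm_inverse)

instance
  by standard (simp_all add: of_circle_inject[symmetric] divide_inverse)

end

instantiation circle :: invariant_metric_group
begin

definition "dist a b = dist (of_circle a) (of_circle b)"
definition "uniformity = (INF e\<in>{0<..}. principal {(x :: circle, y). dist x y < e})"
definition "open U = (\<forall>x\<in>U. eventually (\<lambda>(x', y). x' = x \<longrightarrow> y \<in> U) (uniformity :: (circle \<times> circle) filter))"

instance
proof
  fix a b c :: circle
  show "dist a b = 0 \<longleftrightarrow> a = b"
    by (simp add: dist_circle_def of_circle_inject)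
  show "dist a b \<le> dist a c + dist b c"
    unfolding dist_circle_def by (rule dist_triangle2)
  show "dist (a + c) (b + c) = dist a b"
    by (simp add: dist_circle_def dist_norm norm_mult flip: left_diff_distrib)
qed (simp_all only: uniformity_circle_def open_circle_def)

end

lemma gnorm_circle: "gnorm a = norm (of_circle a - 1)"
  by (simp add: gnorm_def dist_circle_def dist_norm)

lemma of_circle_sum: "of_circle (sum f A) = (\<Prod>x\<in>A. of_circle (f x))"
  by (induction A rule: infinite_finite_induct) simp_all

lemma tendsto_circle_iff: "(f \<longlongrightarrow> a) F \<longleftrightarrow> ((\<lambda>x. of_circle (f x)) \<longlongrightarrow> of_circle a) F"
  by (simp add: tendsto_dist_iff[of f] dist_circle_def flip: tendsto_dist_iff)

lemma compact_UNIV_circle: "compact (UNIV :: circle set)"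
proof -
  have "continuous_on (sphere 0 1) Abs_circle"
    unfolding continuous_on_def tendsto_circle_iff
    by (auto simp: of_circle_Abs_circle eventually_at_filter
        intro!: Lim_transform_eventually[OF tendsto_ident_at])
  then have "compact (Abs_circle ` sphere 0 1)"
    by (rule compact_continuous_image) simp
  also have "Abs_circle ` sphere 0 1 = UNIV"
    using type_definition.Abs_image[OF type_definition_circle] .
  finally show ?thesis .
qed

instance circle :: complete_space
proof
  fix X :: "nat \<Rightarrow> circle" assume "Cauchy X"
  then show "convergent X"
    using compact_imp_complete[OF compact_UNIV_circle] unfolding complete_def convergent_def by blast
qed

lemma convergent_circle_iff: "convergent f \<longleftrightarrow> convergent (\<lambda>n. of_circle (f n))" for f :: "nat \<Rightarrow> circle"
  by (simp add: Cauchy_convergent_iff[symmetric] Cauchy_def dist_circle_def)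

subsection \<open>Small subgroups of the circle\<close>

lemma cos_pos_imp_abs_less: "cos t > 0 \<Longrightarrow> \<bar>t\<bar> < pi \<Longrightarrow> \<bar>t\<bar> < pi / 2"
  using cos_monotone_0_pi_le[of "pi / 2" "\<bar>t\<bar>"] by (cases "\<bar>t\<bar> < pi / 2") auto

lemma cos_multiples_pos_imp:
  assumes "\<And>j. 1 \<le> j \<Longrightarrow> j \<le> n \<Longrightarrow> cos (real j * b) > 0" and "\<bar>b\<bar> < pi"
  shows "\<bar>real n * b\<bar> < pi / 2"
  using assms(1)
proof (induction n)
  case (Suc n)
  have "cos b > 0"
    using Suc.prems[of 1] by simp
  then have "\<bar>b\<bar> < pi / 2"
    using assms(2) by (rule cos_pos_imp_abs_less)
  moreover have "\<bar>real n * b\<bar> < pi / 2"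
    using Suc by simp
  ultimately have "\<bar>real (Suc n) * b\<bar> < pi"
    by (simp add: algebra_simps)
  then show ?case
    using Suc.prems[of "Suc n"] by (intro cos_pos_imp_abs_less) auto
qed simp

lemma unit_circle_small_powers:
  fixes z :: complex
  assumes "norm z = 1" and "\<And>j. 1 \<le> j \<Longrightarrow> j \<le> n \<Longrightarrow> norm (z ^ j - 1) < 1" and "n \<ge> 1"
  obtains b where "z = cis b" "\<bar>real n * b\<bar> < pi / 2"
proof -
  obtain b where z: "z = cis b" and b: "- pi < b" "b \<le> pi"
    using assms(1) Arg_bounded[of z] rcis_cmod_Arg[of z] by (metis rcis_def mult_1 of_real_1)
  have pos: "cos (real j * b) > 0" if "1 \<le> j" "j \<le> n" for j
  proof -
    have "\<bar>Re (z ^ j - 1)\<bar> < 1"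
      using assms(2)[OF that] abs_Re_le_cmod by (rule le_less_trans[rotated])
    then show ?thesis
      by (simp add: z Complex.DeMoivre)
  qed
  have "b \<noteq> pi"
    using pos[of 1] assms(3) by auto
  then show ?thesis
    using that[OF z] cos_multiples_pos_imp[of n b] pos b by auto
qed

lemma unit_circle_no_small_subgroups:
  fixes z :: complex
  assumes "norm z = 1" and "\<And>j. norm (z ^ j - 1) < 1"
  shows "z = 1"
proof -
  have "\<exists>b. z = cis b \<and> \<bar>b\<bar> < 2 / real (Suc n)" for n
  proof -
    obtain b where "z = cis b" "\<bar>real (Suc n) * b\<bar> < pi / 2"
      by (rule unit_circle_small_powers[of z "Suc n"]) (use assms in auto)
    moreover from this have "\<bar>b\<bar> * real (Suc n) < 2"
      using pi_less_4 by (simp only: abs_mult abs_of_nat mult.commute)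
    ultimately show ?thesis
      by (auto simp: pos_less_divide_eq simp del: of_nat_Suc)
  qed
  then obtain b where b: "\<And>n. z = cis (b n)" "\<And>n. \<bar>b n\<bar> < 2 / real (Suc n)"
    by metis
  have "(\<lambda>n. 2 / real (Suc n)) \<longlonglongrightarrow> 0"
    using tendsto_mult_right_zero[OF LIMSEQ_inverse_real_of_nat, of 2] by (simp add: divide_inverse)
  then have "b \<longlonglongrightarrow> 0"
    by (rule Lim_null_comparison[rotated]) (use b(2) in \<open>simp add: less_imp_le\<close>)
  then have "(\<lambda>n. cis (b n)) \<longlonglongrightarrow> cis 0"
    by (rule tendsto_cis)
  then show ?thesis
    by (simp add: b(1)[symmetric] LIMSEQ_const_iff)
qed

lemma circle_no_small_subgroups:
  fixes a :: circle
  assumes "\<And>n :: nat. gnorm (\<Sum>i<n. a) < 1"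
  shows "a = 0"
proof -
  have "norm (of_circle a ^ n - 1) < 1" for n
    using assms[of n] by (simp add: gnorm_circle of_circle_sum)
  then have "of_circle a = of_circle 0"
    using unit_circle_no_small_subgroups[of "of_circle a"] by simp
  then show ?thesis
    by (simp only: of_circle_inject)
qed

text \<open>
  Along a subsequence \<open>e m\<close> tends to some \<open>z \<noteq> 0\<close>, so sums of \<open>n\<close> of its terms approximate the
  \<open>n\<close>-fold sum of \<open>z\<close>, and these cannot all be small.
\<close>

lemma circle_large_sums:
  fixes e :: "nat \<Rightarrow> circle"
  assumes "\<not> e \<longlonglongrightarrow> 0"
  obtains A where "finite A" "A \<subseteq> {M..}" "\<And>m. m \<in> A \<Longrightarrow> Suc m \<notin> A" "gnorm (\<Sum>m\<in>A. e m) \<ge> 1 / 2"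
proof -
  obtain d where d: "d > 0" "\<exists>\<^sub>F m in sequentially. d \<le> gnorm (e m)"
    using assms by (auto simp: tendsto_iff gnorm_def not_eventually not_less)
  obtain r z where r: "strict_mono r" "\<And>n. d \<le> gnorm (e (r n))" "(\<lambda>n. e (r n)) \<longlonglongrightarrow> z"
    by (rule frequently_imp_subseq_limit[of UNIV e, OF compact_UNIV_circle UNIV_I d(2)]) (rule that)
  have "(\<lambda>n. gnorm (e (r n))) \<longlonglongrightarrow> gnorm z"
    unfolding gnorm_def by (intro tendsto_intros r(3))
  then have "z \<noteq> 0"
    using r(2) d(1) by (intro notI) (auto dest!: LIMSEQ_le_const)
  then obtain n :: nat where n: "gnorm (\<Sum>i<n. z) \<ge> 1"
    using circle_no_small_subgroups[of z] not_le by blast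
  define s where "s i q = r (M + 2 * (i + q))" for i q
  have "(\<lambda>i. e (s i q)) \<longlonglongrightarrow> z" for q
    unfolding s_def using r(3)
    by (rule filterlim_compose) (auto intro!: filterlim_subseq strict_monoI)
  then have "(\<lambda>i. gnorm (\<Sum>q<n. e (s i q))) \<longlonglongrightarrow> gnorm (\<Sum>q<n. z)"
    unfolding gnorm_def by (intro tendsto_intros)
  from order_tendstoD(1)[OF this, of "1 / 2"] n
  obtain i where i: "gnorm (\<Sum>q<n. e (s i q)) > 1 / 2"
    by (auto simp: eventually_sequentially)
  have s_less: "Suc (s i q) < s i q'" if "q < q'" for q q'
  proof -
    have "r (M + 2 * (i + q)) < r (M + 2 * (i + q) + 1)" "r (M + 2 * (i + q) + 1) < r (M + 2 * (i + q'))"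
      using r(1) that by (simp_all add: strict_mono_less)
    then show ?thesis
      unfolding s_def by simp
  qed
  have inj: "inj_on (s i) {..<n}"
    by (rule inj_onI) (metis s_less Suc_lessD less_irrefl nat_neq_iff)
  show thesis
  proof (rule that[of "s i ` {..<n}"])
    show "s i ` {..<n} \<subseteq> {M..}"
      unfolding s_def using order_trans[OF le_add1 strict_mono_imp_increasing[OF r(1)]] by auto
    show "Suc m \<notin> s i ` {..<n}" if m: "m \<in> s i ` {..<n}" for m
      using m s_less by (auto simp: image_iff) (metis less_irrefl nat_neq_iff not_less_eq Suc_lessD)
    show "gnorm (\<Sum>m\<in>s i ` {..<n}. e m) \<ge> 1 / 2"
      using i by (simp add: sum.reindex[OF inj])
  qed simp
qed

subsection \<open>Generic sequences\<close>

lemma prefix_add_conc: "prefix (length w + n) (w \<frown> z) = w @ prefix n z"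
  by simp

lemma chain_limit:
  fixes w :: "nat \<Rightarrow> 'a list"
  assumes chain: "\<And>k. \<exists>t. w (Suc k) = w k @ t" and len: "\<And>k. length (w k) \<ge> k"
  obtains x where "\<And>k. prefix (length (w k)) x = w k"
proof -
  have stable: "i < length (w (k + n)) \<and> w (k + n) ! i = w k ! i" if "i < length (w k)" for k n i
  proof (induction n)
    case (Suc n)
    then show ?case
      using chain[of "k + n"] by (auto simp: nth_append)
  qed (use that in simp)
  define x where "x i = w (Suc i) ! i" for i
  have "prefix (length (w k)) x = w k" for k
  proof (rule nth_equalityI)
    fix i assume "i < length (prefix (length (w k)) x)"
    then have "i < length (w k)" "i < length (w (Suc i))"
      using len[of "Suc i"] by simp_all
    then show "prefix (length (w k)) x ! i = w k ! i"
      using stable[of i k "Suc i"] stable[of i "Suc i" k] by (simp add: x_def add.commute)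
  qed simp
  then show ?thesis
    using that by blast
qed

text \<open>
  A dense open set of sequences is coded by the words whose cylinders it contains; thus the sequences
  that are generic for a countable family form a comeagre set.
\<close>

definition dense_open :: "'a list set \<Rightarrow> bool" where
  "dense_open E \<longleftrightarrow> (\<forall>s. \<exists>t. s @ t \<in> E) \<and> (\<forall>s t. s \<in> E \<longrightarrow> s @ t \<in> E)"

definition dense_open_family :: "'a list set set \<Rightarrow> bool" where
  "dense_open_family \<D> \<longleftrightarrow> countable \<D> \<and> (\<forall>E\<in>\<D>. dense_open E)"

definition generic :: "'a list set set \<Rightarrow> 'a word \<Rightarrow> bool" where
  "generic \<D> x \<longleftrightarrow> (\<forall>E\<in>\<D>. \<exists>n. prefix n x \<in> E)"

definition forces :: "'a list set set \<Rightarrow> 'a list \<Rightarrow> 'a word set \<Rightarrow> bool" where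
  "forces \<D> s B \<longleftrightarrow> (\<forall>z. generic \<D> (s \<frown> z) \<longrightarrow> s \<frown> z \<in> B)"

lemma dense_open_denseD: "dense_open E \<Longrightarrow> \<exists>t. s @ t \<in> E"
  by (simp add: dense_open_def)

lemma dense_open_appendD: "dense_open E \<Longrightarrow> s \<in> E \<Longrightarrow> s @ t \<in> E"
  by (simp add: dense_open_def)

lemma dense_open_Int:
  assumes "dense_open E" "dense_open E'"
  shows "dense_open (E \<inter> E')"
  unfolding dense_open_def
proof safe
  fix s
  obtain t u where "s @ t \<in> E" "(s @ t) @ u \<in> E'"
    using assms dense_open_denseD by metis
  then show "\<exists>t. s @ t \<in> E \<inter> E'"
    using assms(1) by (intro exI[of _ "t @ u"]) (auto dest: dense_open_appendD)
qed (use assms in \<open>auto dest: dense_open_appendD\<close>)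

lemma dense_open_INT:
  assumes "finite A" "\<And>a. a \<in> A \<Longrightarrow> dense_open (E a)"
  shows "dense_open (\<Inter>a\<in>A. E a)"
  using assms
proof (induction A rule: finite_induct)
  case empty
  then show ?case
    by (simp add: dense_open_def)
qed (simp add: dense_open_Int)

lemma dense_open_decide:
  assumes "\<And>s t. s \<in> U \<Longrightarrow> s @ t \<in> U"
  shows "dense_open {s. s \<in> U \<or> (\<forall>t. s @ t \<notin> U)}"
  unfolding dense_open_def
proof (intro conjI allI impI)
  fix s show "\<exists>t. s @ t \<in> {s. s \<in> U \<or> (\<forall>t. s @ t \<notin> U)}"
    by (cases "\<exists>t. s @ t \<in> U") (auto intro: exI[of _ "[]"])
qed (use assms in auto)

lemma dense_open_shift: "dense_open E \<Longrightarrow> dense_open {t. w @ t \<in> E}"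
  unfolding dense_open_def by (auto simp flip: append_assoc)

lemma dense_open_family_Un:
  "dense_open_family \<D> \<Longrightarrow> dense_open_family \<E> \<Longrightarrow> dense_open_family (\<D> \<union> \<E>)"
  by (auto simp: dense_open_family_def)

lemma dense_open_family_UN:
  fixes \<D> :: "'i::countable \<Rightarrow> 'a list set set"
  shows "(\<And>i. dense_open_family (\<D> i)) \<Longrightarrow> dense_open_family (\<Union>i. \<D> i)"
  by (auto simp: dense_open_family_def)

lemma dense_open_family_range:
  fixes E :: "'i::countable \<Rightarrow> 'a list set"
  shows "(\<And>i. dense_open (E i)) \<Longrightarrow> dense_open_family (range E)"
  by (auto simp: dense_open_family_def)

lemma dense_open_family_insert: "dense_open E \<Longrightarrow> dense_open_family \<D> \<Longrightarrow> dense_open_family (insert E \<D>)"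
  by (auto simp: dense_open_family_def)

lemma generic_mono: "generic \<D>' x \<Longrightarrow> \<D> \<subseteq> \<D>' \<Longrightarrow> generic \<D> x"
  unfolding generic_def by blast

lemma generic_Un_iff: "generic (\<D> \<union> \<E>) x \<longleftrightarrow> generic \<D> x \<and> generic \<E> x"
  unfolding generic_def by blast

lemma forces_append: "forces \<D> s B \<Longrightarrow> forces \<D> (s @ t) B"
  unfolding forces_def by (simp flip: conc_conc)

lemma forces_mono: "forces \<D> s B \<Longrightarrow> \<D> \<subseteq> \<D>' \<Longrightarrow> B \<subseteq> B' \<Longrightarrow> forces \<D>' s B'"
  unfolding forces_def using generic_mono by blast

lemma forces_prefixD: "forces \<D> (prefix n x) B \<Longrightarrow> generic \<D> x \<Longrightarrow> x \<in> B"
  unfolding forces_def by (metis prefix_suffix)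

lemma dense_open_family_enumeration:
  assumes "dense_open_family \<D>"
  shows "\<exists>E :: nat \<Rightarrow> 'a list set. (\<forall>k. dense_open (E k)) \<and> \<D> \<subseteq> range E"
proof -
  have range: "range (from_nat_into (insert UNIV \<D>)) = insert UNIV \<D>"
    using assms by (intro range_from_nat_into) (auto simp: dense_open_family_def)
  have "dense_open (UNIV :: 'a list set)"
    by (simp add: dense_open_def)
  then have "dense_open (from_nat_into (insert UNIV \<D>) k)" for k
    using assms rangeI[of "from_nat_into (insert UNIV \<D>)" k] unfolding range dense_open_family_def by auto
  then show ?thesis
    by (intro exI[of _ "from_nat_into (insert UNIV \<D>)"]) (auto simp: range)
qed

lemma generic_exists:
  assumes \<D>: "dense_open_family \<D>"
  obtains z where "generic \<D> (s \<frown> z)"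
proof -
  obtain E :: "nat \<Rightarrow> 'a list set" where E: "\<And>k. dense_open (E k)" "\<D> \<subseteq> range E"
    using dense_open_family_enumeration[OF \<D>] by blast
  from dense_open_denseD[OF E(1)]
  have "\<exists>t. (w @ [undefined]) @ t \<in> E k" for w k .
  then obtain f where f: "\<And>w k. (w @ [undefined]) @ f w k \<in> E k"
    by metis
  define w where "w = rec_nat s (\<lambda>k u. (u @ [undefined]) @ f u k)"
  have w: "w 0 = s" "w (Suc k) = (w k @ [undefined]) @ f (w k) k" for k
    by (simp_all add: w_def)
  have len: "length (w k) \<ge> k" for k
    by (induction k) (simp_all add: w)
  obtain x where x: "\<And>k. prefix (length (w k)) x = w k"
    using chain_limit[of w, OF _ len] w(2) by (metis append_assoc)
  have "\<exists>n. prefix n x \<in> E k" for k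
    using f[of "w k" k] x[of "Suc k"] by (metis w(2))
  then have "generic \<D> x"
    unfolding generic_def using E(2) by blast
  then show ?thesis
    using that[of "suffix (length s) x"] x[of 0] prefix_suffix[of x "length s"] by (simp add: w(1))
qed

lemma generic_shift_iff:
  assumes "dense_open_family \<D>"
  shows "generic ((\<lambda>E. {t. w @ t \<in> E}) ` \<D>) z \<longleftrightarrow> generic \<D> (w \<frown> z)"
proof -
  have "(\<exists>n. w @ prefix n z \<in> E) \<longleftrightarrow> (\<exists>n. prefix n (w \<frown> z) \<in> E)" if "E \<in> \<D>" for E
  proof
    assume "\<exists>n. w @ prefix n z \<in> E"
    then show "\<exists>n. prefix n (w \<frown> z) \<in> E"
      by (metis prefix_add_conc)
  next
    assume "\<exists>n. prefix n (w \<frown> z) \<in> E"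
    then obtain n where "prefix n (w \<frown> z) \<in> E" ..
    then have "prefix (n + length w) (w \<frown> z) \<in> E"
      unfolding subsequence_append using assms that dense_open_appendD by (auto simp: dense_open_family_def)
    then show "\<exists>n. w @ prefix n z \<in> E"
      by (metis add.commute prefix_add_conc)
  qed
  then show ?thesis
    by (simp add: generic_def)
qed

lemma dense_open_family_shift:
  "dense_open_family \<D> \<Longrightarrow> dense_open_family ((\<lambda>E. {t. w @ t \<in> E}) ` \<D>)"
  by (auto simp: dense_open_family_def dense_open_shift)

lemma baire_category:
  fixes C :: "nat \<Rightarrow> 'a word set"
  assumes \<D>: "dense_open_family \<D>" and cover: "\<And>z. generic \<D> z \<Longrightarrow> \<exists>l. z \<in> C l"
    and closed: "\<And>l z. generic \<D> z \<Longrightarrow> z \<notin> C l \<Longrightarrow> \<exists>n. forces \<D> (prefix n z) (- C l)"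
  obtains l t where "forces \<D> t (C l)"
proof (rule ccontr)
  assume "\<not> thesis"
  then have none: "\<not> forces \<D> t (C l)" for l t
    using that by blast
  define E where "E l = {t. forces \<D> t (- C l)}" for l
  have "\<exists>u. t @ u \<in> E l" for l t
  proof -
    obtain z where "generic \<D> (t \<frown> z)" "t \<frown> z \<notin> C l"
      using none[of t l] unfolding forces_def by blast
    then obtain n where "forces \<D> (prefix n (t \<frown> z)) (- C l)"
      using closed by blast
    then have "forces \<D> (prefix (n + length t) (t \<frown> z)) (- C l)"
      unfolding subsequence_append by (rule forces_append)
    then show ?thesis
      unfolding E_def by (metis add.commute mem_Collect_eq prefix_add_conc)
  qed
  then have "dense_open (E l)" for l
    by (auto simp: dense_open_def E_def forces_append)
  then have "dense_open_family (\<D> \<union> range E)"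
    using \<D> by (intro dense_open_family_Un dense_open_family_range)
  then obtain z where z: "generic (\<D> \<union> range E) z"
    using generic_exists[of _ "[]"] by (metis conc_empty)
  then have "generic \<D> z" "\<exists>n. forces \<D> (prefix n z) (- C l)" for l
    by (auto simp: generic_Un_iff) (auto simp: generic_def E_def)
  then show False
    using cover forces_prefixD by blast
qed

subsection \<open>The Baire property of Borel sets\<close>

definition decided :: "'a list set set \<Rightarrow> 'a word set \<Rightarrow> bool" where
  "decided \<D> B \<longleftrightarrow> (\<forall>x. generic \<D> x \<longrightarrow> (\<exists>n. forces \<D> (prefix n x) B \<or> forces \<D> (prefix n x) (- B)))"

definition baire_property :: "'a word set \<Rightarrow> bool" where
  "baire_property B \<longleftrightarrow> (\<exists>\<D>. dense_open_family \<D> \<and> decided \<D> B)"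

definition prefix_continuous :: "('a word \<Rightarrow> 'b::topological_space) \<Rightarrow> bool" where
  "prefix_continuous f \<longleftrightarrow> (\<forall>x W. open W \<longrightarrow> f x \<in> W \<longrightarrow> (\<exists>n. \<forall>z. f (prefix n x \<frown> z) \<in> W))"

definition generically_continuous :: "'a list set set \<Rightarrow> ('a word \<Rightarrow> 'b::metric_space) \<Rightarrow> bool" where
  "generically_continuous \<D> f \<longleftrightarrow> (\<forall>x e. generic \<D> x \<longrightarrow> e > 0 \<longrightarrow>
     (\<exists>n. forces \<D> (prefix n x) {y. dist (f x) (f y) < e}))"

lemma decided_mono:
  assumes "decided \<D> B" "\<D> \<subseteq> \<D>'"
  shows "decided \<D>' B"
  unfolding decided_def
proof (intro allI impI)
  fix x assume "generic \<D>' x"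
  then obtain n where "forces \<D> (prefix n x) B \<or> forces \<D> (prefix n x) (- B)"
    using assms generic_mono unfolding decided_def by blast
  then show "\<exists>n. forces \<D>' (prefix n x) B \<or> forces \<D>' (prefix n x) (- B)"
    using forces_mono[OF _ assms(2) order_refl] by blast
qed

lemma baire_property_common_family:
  fixes B :: "'i::countable \<Rightarrow> 'a word set"
  assumes "\<And>i. baire_property (B i)"
  obtains \<D> where "dense_open_family \<D>" "\<And>i. decided \<D> (B i)"
proof -
  obtain \<D> where \<D>: "\<And>i. dense_open_family (\<D> i)" "\<And>i. decided (\<D> i) (B i)"
    using assms unfolding baire_property_def by metis
  show ?thesis
  proof (rule that)
    show "dense_open_family (\<Union>i. \<D> i)"
      using \<D>(1) by (rule dense_open_family_UN)
    show "decided (\<Union>i. \<D> i) (B i)" for i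
      using \<D>(2)[of i] by (rule decided_mono) blast
  qed
qed

lemma baire_property_of_cover:
  assumes \<D>: "dense_open_family \<D>" and U: "\<And>s t. s \<in> U \<Longrightarrow> s @ t \<in> U"
    and inside: "\<And>s. s \<in> U \<Longrightarrow> forces \<D> s B"
    and cover: "\<And>x. generic \<D> x \<Longrightarrow> x \<in> B \<Longrightarrow> \<exists>n. prefix n x \<in> U"
  shows "baire_property B"
proof -
  define E where "E = {s. s \<in> U \<or> (\<forall>t. s @ t \<notin> U)}"
  have "forces \<D> s (- B)" if none: "\<forall>t. s @ t \<notin> U" for s
    unfolding forces_def
  proof (intro allI impI ComplI)
    fix z assume "generic \<D> (s \<frown> z)" "s \<frown> z \<in> B"
    then obtain n where "prefix n (s \<frown> z) \<in> U"
      using cover by blast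
    then have "prefix (n + length s) (s \<frown> z) \<in> U"
      unfolding subsequence_append by (rule U)
    then show False
      using none by (metis add.commute prefix_add_conc)
  qed
  then have decides: "forces \<D> s B \<or> forces \<D> s (- B)" if "s \<in> E" for s
    using that inside unfolding E_def by blast
  have "decided (insert E \<D>) B"
    unfolding decided_def
  proof (intro allI impI)
    fix x assume "generic (insert E \<D>) x"
    then obtain n where "prefix n x \<in> E"
      unfolding generic_def by blast
    then show "\<exists>n. forces (insert E \<D>) (prefix n x) B \<or> forces (insert E \<D>) (prefix n x) (- B)"
      using decides forces_mono[OF _ subset_insertI order_refl] by blast
  qed
  moreover have "dense_open_family (insert E \<D>)"
    unfolding E_def by (intro dense_open_family_insert dense_open_decide U \<D>)
  ultimately show ?thesis
    unfolding baire_property_def by blast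
qed

lemma baire_property_vimage_open:
  assumes "prefix_continuous f" "open W"
  shows "baire_property (f -` W)"
proof (rule baire_property_of_cover)
  show "dense_open_family {}"
    by (simp add: dense_open_family_def)
  show "s @ t \<in> {s. \<forall>z. f (s \<frown> z) \<in> W}" if "s \<in> {s. \<forall>z. f (s \<frown> z) \<in> W}" for s t
    using that by (simp flip: conc_conc)
qed (use assms in \<open>auto simp: prefix_continuous_def forces_def\<close>)

lemma baire_property_Compl: "baire_property B \<Longrightarrow> baire_property (- B)"
  unfolding baire_property_def decided_def double_complement by meson

lemma baire_property_UN:
  fixes B :: "'i::countable \<Rightarrow> 'a word set"
  assumes "\<And>i. baire_property (B i)"
  shows "baire_property (\<Union>i. B i)"
proof -
  obtain \<D> where \<D>: "dense_open_family \<D>" "\<And>i. decided \<D> (B i)"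
    using baire_property_common_family[of B] assms by metis
  show ?thesis
  proof (rule baire_property_of_cover[OF \<D>(1), where U = "{s. \<exists>i. forces \<D> s (B i)}"])
    fix x assume x: "generic \<D> x" "x \<in> (\<Union>i. B i)"
    then obtain i where "x \<in> B i"
      by blast
    then show "\<exists>n. prefix n x \<in> {s. \<exists>i. forces \<D> s (B i)}"
      using \<D>(2)[of i] x(1) forces_prefixD[OF _ x(1)] unfolding decided_def by blast
  qed (auto intro: forces_append forces_mono)
qed

lemma baire_property_vimage_borel:
  assumes f: "prefix_continuous f" and "W \<in> sets borel"
  shows "baire_property (f -` W)"
proof -
  have "W \<in> sigma_sets UNIV {S. open S}"
    using assms(2) unfolding borel_def by simp
  then show ?thesis
  proof (induction rule: sigma_sets.induct)
    case (Basic W)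
    then show ?case
      using f by (simp add: baire_property_vimage_open)
  next
    case Empty
    show ?case
      using baire_property_vimage_open[OF f open_empty] .
  next
    case (Compl W)
    then show ?case
      by (simp add: Compl_eq_Diff_UNIV[symmetric] vimage_Compl baire_property_Compl)
  next
    case (Union W)
    then show ?case
      by (simp add: vimage_UN baire_property_UN)
  qed
qed

lemma baire_property_vimage_measurable:
  assumes f: "prefix_continuous f" "\<And>x. f x \<in> A" and g: "g \<in> restrict_space borel A \<rightarrow>\<^sub>M borel" and "open V"
  shows "baire_property ((\<lambda>x. g (f x)) -` V)"
proof -
  have "g -` V \<inter> space (restrict_space borel A) \<in> sets (restrict_space borel A)"
    using \<open>open V\<close> by (intro measurable_sets[OF g]) simp
  then obtain W where "W \<in> sets borel" "g -` V \<inter> A = A \<inter> W"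
    by (auto simp: sets_restrict_space space_restrict_space)
  moreover from this have "(\<lambda>x. g (f x)) -` V = f -` W"
    using f(2) by auto
  ultimately show ?thesis
    using baire_property_vimage_borel[OF f(1)] by simp
qed

lemma generically_continuous_if_baire_property:
  fixes f :: "'i::countable \<Rightarrow> 'a word \<Rightarrow> 'b::{metric_space, second_countable_topology}"
  assumes "\<And>i V. open V \<Longrightarrow> baire_property (f i -` V)"
  obtains \<D> where "dense_open_family \<D>" "\<And>i. generically_continuous \<D> (f i)"
proof -
  obtain \<B> :: "'b set set" where \<B>: "countable \<B>" "topological_basis \<B>"
    using ex_countable_basis by blast
  define V where "V = from_nat_into \<B>"
  have "\<B> \<noteq> {}"
    using topological_basisE[OF \<B>(2) open_UNIV UNIV_I] by blast
  then have range_V: "range V = \<B>"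
    unfolding V_def using \<B>(1) by simp
  then have "open (V r)" for r
    using \<B>(2) topological_basis_open by blast
  then have "baire_property (case ir of (i, r) \<Rightarrow> f i -` V r)" for ir
    using assms by (simp split: prod.split)
  from baire_property_common_family[OF this]
  obtain \<D> where \<D>: "dense_open_family \<D>" "\<And>i r. decided \<D> (f i -` V r)"
    by (metis case_prod_conv)
  have "generically_continuous \<D> (f i)" for i
    unfolding generically_continuous_def
  proof (intro allI impI)
    fix x and e :: real assume x: "generic \<D> x" and "e > 0"
    obtain r where r: "f i x \<in> V r" "V r \<subseteq> ball (f i x) e"
      using topological_basisE[OF \<B>(2), of "ball (f i x) e" "f i x"] \<open>e > 0\<close> range_V
      by (metis centre_in_ball open_ball rangeE)
    obtain n where "forces \<D> (prefix n x) (f i -` V r)"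
      using \<D>(2)[of i r] r(1) x forces_prefixD[OF _ x] unfolding decided_def by blast
    moreover have "f i -` V r \<subseteq> {y. dist (f i x) (f i y) < e}"
      using r(2) by auto
    ultimately show "\<exists>n. forces \<D> (prefix n x) {y. dist (f i x) (f i y) < e}"
      using forces_mono[OF _ order_refl] by blast
  qed
  then show ?thesis
    using that \<D>(1) by blast
qed

lemma generically_continuous_mono:
  assumes "generically_continuous \<D> f" "\<D> \<subseteq> \<D>'"
  shows "generically_continuous \<D>' f"
  using assms forces_mono[OF _ assms(2) order_refl] generic_mono[OF _ assms(2)]
  unfolding generically_continuous_def by blast

lemma forces_prefix_mono:
  assumes "forces \<D> (prefix m x) B" "m \<le> n"
  shows "forces \<D> (prefix n x) B"
proof -
  obtain k where "n = m + k"
    using assms(2) le_Suc_ex by blast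
  then show ?thesis
    using assms(1) by (simp only: subsequence_append forces_append)
qed

lemma generically_continuous_diff:
  fixes f g :: "'a word \<Rightarrow> 'b::invariant_metric_group"
  assumes "generically_continuous \<D> f" "generically_continuous \<D> g"
  shows "generically_continuous \<D> (\<lambda>x. f x - g x)"
  unfolding generically_continuous_def
proof (intro allI impI)
  fix x and e :: real assume "generic \<D> x" "e > 0"
  have sum_less: "dist (f x - g x) (f y - g y) < e"
    if "dist (f x) (f y) < e / 2" "dist (g x) (g y) < e / 2" for y
    using dist_diff_le[of "f x" "g x" "f y" "g y"] that by simp
  obtain m n where "forces \<D> (prefix m x) {y. dist (f x) (f y) < e / 2}"
    "forces \<D> (prefix n x) {y. dist (g x) (g y) < e / 2}"
    using assms \<open>generic \<D> x\<close> \<open>e > 0\<close> unfolding generically_continuous_def by (metis half_gt_zero)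
  then have "forces \<D> (prefix (max m n) x) {y. dist (f x) (f y) < e / 2}"
    "forces \<D> (prefix (max m n) x) {y. dist (g x) (g y) < e / 2}"
    by (auto elim: forces_prefix_mono)
  then have "forces \<D> (prefix (max m n) x) {y. dist (f x - g x) (f y - g y) < e}"
    using sum_less by (simp add: forces_def)
  then show "\<exists>n. forces \<D> (prefix n x) {y. dist (f x - g x) (f y - g y) < e}" ..
qed

lemma generically_continuous_shift:
  assumes "dense_open_family \<D>" "generically_continuous \<D> f"
  shows "generically_continuous ((\<lambda>E. {t. w @ t \<in> E}) ` \<D>) (\<lambda>z. f (w \<frown> z))"
  unfolding generically_continuous_def
proof (intro allI impI)
  fix z and e :: real assume "generic ((\<lambda>E. {t. w @ t \<in> E}) ` \<D>) z" "e > 0"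
  then obtain n where "forces \<D> (prefix n (w \<frown> z)) {y. dist (f (w \<frown> z)) (f y) < e}"
    using assms unfolding generic_shift_iff[OF assms(1)] generically_continuous_def by blast
  then have "forces \<D> (w @ prefix n z) {y. dist (f (w \<frown> z)) (f y) < e}"
    unfolding prefix_add_conc[symmetric] by (rule forces_prefix_mono) simp
  then show "\<exists>n. forces ((\<lambda>E. {t. w @ t \<in> E}) ` \<D>) (prefix n z) {z'. dist (f (w \<frown> z)) (f (w \<frown> z')) < e}"
    unfolding forces_def generic_shift_iff[OF assms(1)] by auto
qed

lemma uniformly_Cauchy_on_cylinder:
  fixes f :: "nat \<Rightarrow> 'a word \<Rightarrow> 'b::invariant_metric_group"
  assumes \<D>: "dense_open_family \<D>" and cont: "\<And>i. generically_continuous \<D> (f i)"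
    and cauchy: "\<And>z. Cauchy (\<lambda>i. f i z)" and "e > 0"
  obtains t l where "forces \<D> t {z. \<forall>i\<ge>l. \<forall>i'\<ge>l. dist (f i z) (f i' z) \<le> e}"
proof -
  define C where "C l = {z. \<forall>i\<ge>l. \<forall>i'\<ge>l. dist (f i z) (f i' z) \<le> e}" for l
  obtain l t where "forces \<D> t (C l)"
  proof (rule baire_category[OF \<D>])
    show "\<exists>l. z \<in> C l" for z
      using cauchy[of z] \<open>e > 0\<close> unfolding C_def Cauchy_def mem_Collect_eq by (meson less_imp_le)
  next
    fix l z assume "generic \<D> z" "z \<notin> C l"
    then obtain i i' where i: "i \<ge> l" "i' \<ge> l" "dist (f i z) (f i' z) > e"
      by (auto simp: C_def not_le)
    define near where "near = {y. dist (f i z - f i' z) (f i y - f i' y) < dist (f i z) (f i' z) - e}"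
    have "generically_continuous \<D> (\<lambda>z. f i z - f i' z)"
      by (intro generically_continuous_diff cont)
    then obtain n where n: "forces \<D> (prefix n z) near"
      using \<open>generic \<D> z\<close> i(3) unfolding generically_continuous_def near_def by (meson diff_gt_0_iff_gt)
    have "y \<notin> C l" if "y \<in> near" for y
    proof -
      have "dist (f i z) (f i' z) \<le> dist (f i z - f i' z) (f i y - f i' y) + dist (f i y) (f i' y)"
        using dist_triangle[of "f i z - f i' z" 0 "f i y - f i' y"] by (simp add: dist_eq_gnorm)
      then have "dist (f i y) (f i' y) > e"
        using that by (simp add: near_def)
      then show ?thesis
        using i(1,2) by (auto simp: C_def not_le)
    qed
    then show "\<exists>n. forces \<D> (prefix n z) (- C l)"
      using forces_mono[OF n order_refl] by blast
  qed
  then show ?thesis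
    unfolding C_def by (rule that)
qed

subsection \<open>Generically continuous maps with convergent tail differences\<close>

locale generic_map =
  fixes \<D> :: "'a list set set" and \<Phi> :: "'a word \<Rightarrow> nat \<Rightarrow> 'b::invariant_metric_group"
  assumes family: "dense_open_family \<D>"
    and continuous: "generically_continuous \<D> (\<lambda>x. \<Phi> x i)"
    and tail: "length w = length w' \<Longrightarrow> convergent (\<lambda>i. \<Phi> (w \<frown> z) i - \<Phi> (w' \<frown> z) i)"
begin

definition determined :: "'a list \<Rightarrow> nat \<Rightarrow> real \<Rightarrow> bool" where
  "determined w i e \<longleftrightarrow> (\<forall>z z'. generic \<D> (w \<frown> z) \<longrightarrow> generic \<D> (w \<frown> z') \<longrightarrow>
     dist (\<Phi> (w \<frown> z) i) (\<Phi> (w \<frown> z') i) \<le> e)"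

definition stable :: "'a list \<Rightarrow> 'a list \<Rightarrow> nat \<Rightarrow> real \<Rightarrow> bool" where
  "stable w w' l e \<longleftrightarrow> (\<forall>z. generic \<D> (w \<frown> z) \<longrightarrow> generic \<D> (w' \<frown> z) \<longrightarrow>
     (\<forall>i\<ge>l. \<forall>i'\<ge>l. dist (\<Phi> (w \<frown> z) i - \<Phi> (w' \<frown> z) i) (\<Phi> (w \<frown> z) i' - \<Phi> (w' \<frown> z) i') \<le> e))"

lemma determined_append: "determined w i e \<Longrightarrow> determined (w @ t) i e"
  unfolding determined_def by (simp flip: conc_conc)

lemma stable_append: "stable w w' l e \<Longrightarrow> stable (w @ t) (w' @ t) l e"
  unfolding stable_def by (simp flip: conc_conc)

lemma stable_mono: "stable w w' l e \<Longrightarrow> l \<le> l' \<Longrightarrow> stable w w' l' e"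
  unfolding stable_def by (meson order_trans)

lemma dense_open_determined:
  assumes "e > 0"
  shows "dense_open {s. determined (w @ s) i e}"
  unfolding dense_open_def
proof (intro conjI allI impI)
  fix s
  obtain z where z: "generic \<D> ((w @ s) \<frown> z)"
    using generic_exists[OF family] .
  define x where "x = (w @ s) \<frown> z"
  obtain n where "forces \<D> (prefix n x) {y. dist (\<Phi> x i) (\<Phi> y i) < e / 2}"
    using continuous z assms unfolding generically_continuous_def x_def by (meson half_gt_zero)
  then have "forces \<D> ((w @ s) @ prefix n z) {y. dist (\<Phi> x i) (\<Phi> y i) < e / 2}"
    unfolding prefix_add_conc[symmetric] x_def by (rule forces_prefix_mono) simp
  then have near: "dist (\<Phi> x i) (\<Phi> ((w @ s @ prefix n z) \<frown> u) i) < e / 2"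
    if "generic \<D> ((w @ s @ prefix n z) \<frown> u)" for u
    using that by (simp add: forces_def)
  have "determined (w @ s @ prefix n z) i e"
    unfolding determined_def using dist_triangle_half_r[OF near near] less_imp_le by blast
  then show "\<exists>t. s @ t \<in> {s. determined (w @ s) i e}"
    by blast
next
  fix s t assume "s \<in> {s. determined (w @ s) i e}"
  then show "s @ t \<in> {s. determined (w @ s) i e}"
    using determined_append[of "w @ s"] by simp
qed

lemma stabilizes:
  assumes len: "length w = length w'" and "e > 0"
  obtains t l where "stable (w @ t) (w' @ t) l e"
proof -
  define \<E> where "\<E> = (\<lambda>E. {t. w @ t \<in> E}) ` \<D> \<union> (\<lambda>E. {t. w' @ t \<in> E}) ` \<D>"
  have generic_iff: "generic \<E> z \<longleftrightarrow> generic \<D> (w \<frown> z) \<and> generic \<D> (w' \<frown> z)" for z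
    unfolding \<E>_def generic_Un_iff generic_shift_iff[OF family] ..
  have "dense_open_family \<E>"
    unfolding \<E>_def by (intro dense_open_family_Un dense_open_family_shift family)
  moreover have "generically_continuous \<E> (\<lambda>z. \<Phi> (w \<frown> z) i - \<Phi> (w' \<frown> z) i)" for i
    unfolding \<E>_def
    by (intro generically_continuous_diff
        generically_continuous_mono[OF generically_continuous_shift[OF family continuous]]) auto
  moreover have "Cauchy (\<lambda>i. \<Phi> (w \<frown> z) i - \<Phi> (w' \<frown> z) i)" for z
    by (rule convergent_Cauchy[OF tail[OF len]])
  ultimately obtain t l where "forces \<E> t {z. \<forall>i\<ge>l. \<forall>i'\<ge>l.
      dist (\<Phi> (w \<frown> z) i - \<Phi> (w' \<frown> z) i) (\<Phi> (w \<frown> z) i' - \<Phi> (w' \<frown> z) i') \<le> e}"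
    by (rule uniformly_Cauchy_on_cylinder[OF _ _ _ \<open>e > 0\<close>])
  then have "stable (w @ t) (w' @ t) l e"
    by (auto simp: stable_def forces_def generic_iff)
  then show ?thesis
    by (rule that)
qed

lemma dense_open_stable:
  assumes "length w = length w'" "e > 0"
  shows "dense_open {s. \<exists>l. stable (w @ s) (w' @ s) l e}"
  unfolding dense_open_def
proof (intro conjI allI impI)
  fix s
  have "length (w @ s) = length (w' @ s)"
    using assms(1) by simp
  then obtain t l where "stable ((w @ s) @ t) ((w' @ s) @ t) l e"
    using stabilizes assms(2) by blast
  then show "\<exists>t. s @ t \<in> {s. \<exists>l. stable (w @ s) (w' @ s) l e}"
    by auto
next
  fix s t assume "s \<in> {s. \<exists>l. stable (w @ s) (w' @ s) l e}"
  then show "s @ t \<in> {s. \<exists>l. stable (w @ s) (w' @ s) l e}"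
    using stable_append[of "w @ s" "w' @ s"] by auto
qed

lemma common_extension:
  assumes V: "finite V" "\<And>v. v \<in> V \<Longrightarrow> length v = L" and "e > 0" and E: "dense_open E"
  obtains s l where "l > l\<^sub>0" "\<And>v. v \<in> V \<Longrightarrow> v @ s \<in> E" "\<And>v i. v \<in> V \<Longrightarrow> i \<le> l \<Longrightarrow> determined (v @ s) i e"
    "\<And>v v'. v \<in> V \<Longrightarrow> v' \<in> V \<Longrightarrow> stable (v @ s) (v' @ s) l e"
proof -
  have "dense_open (\<Inter>(v, v')\<in>V \<times> V. {s. \<exists>l. stable (v @ s) (v' @ s) l e})"
    using V \<open>e > 0\<close> by (intro dense_open_INT) (auto intro!: dense_open_stable)
  from dense_open_denseD[OF this, of "[]"]
  obtain t where "\<forall>v v'. \<exists>l. v \<in> V \<longrightarrow> v' \<in> V \<longrightarrow> stable (v @ t) (v' @ t) l e"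
    by auto
  then obtain bound where bound: "\<And>v v'. v \<in> V \<Longrightarrow> v' \<in> V \<Longrightarrow> stable (v @ t) (v' @ t) (bound v v') e"
    by metis
  define l where "l = Suc l\<^sub>0 + (\<Sum>(v, v')\<in>V \<times> V. bound v v')"
  have "bound v v' \<le> l" if "v \<in> V" "v' \<in> V" for v v'
    using member_le_sum[of "(v, v')" "V \<times> V" "\<lambda>(v, v'). bound v v'"] that V(1) by (simp add: l_def)
  then have stable: "stable (v @ t) (v' @ t) l e" if "v \<in> V" "v' \<in> V" for v v'
    using stable_mono[OF bound] that by blast
  have "dense_open ((\<Inter>v\<in>V. {s. v @ s \<in> E}) \<inter> (\<Inter>(v, i)\<in>V \<times> {..l}. {s. determined (v @ s) i e}))"
    using V(1) \<open>e > 0\<close> E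
    by (intro dense_open_Int dense_open_INT) (auto intro: dense_open_shift dense_open_determined)
  then obtain u where "t @ u \<in> (\<Inter>v\<in>V. {s. v @ s \<in> E}) \<inter> (\<Inter>(v, i)\<in>V \<times> {..l}. {s. determined (v @ s) i e})"
    using dense_open_denseD by blast
  moreover have "stable (v @ t @ u) (v' @ t @ u) l e" if "v \<in> V" "v' \<in> V" for v v'
    using stable_append[OF stable[OF that], of u] by simp
  ultimately show ?thesis
    using that[of l "t @ u"] by (auto simp: l_def)
qed

end

subsection \<open>Padded sequences\<close>

primrec padded :: "(nat \<Rightarrow> 'a list) \<Rightarrow> 'a word \<Rightarrow> nat \<Rightarrow> 'a list" where
  "padded s y 0 = s 0"
| "padded s y (Suc n) = padded s y n @ y n # s (Suc n)"

primrec pos :: "(nat \<Rightarrow> 'a list) \<Rightarrow> nat \<Rightarrow> nat" where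
  "pos s 0 = length (s 0)"
| "pos s (Suc n) = pos s n + Suc (length (s (Suc n)))"

definition pad :: "(nat \<Rightarrow> 'a list) \<Rightarrow> 'a word \<Rightarrow> 'a word" where
  "pad s y = (SOME x. \<forall>n. prefix (pos s n) x = padded s y n)"

lemma strict_mono_pos: "strict_mono (pos s)"
  by (simp add: strict_mono_Suc_iff)

lemma length_padded [simp]: "length (padded s y n) = pos s n"
  by (induction n) simp_all

lemma prefix_pad: "prefix (pos s n) (pad s y) = padded s y n"
proof -
  have "n \<le> length (padded s y n)" for n
    by (simp add: strict_mono_imp_increasing[OF strict_mono_pos])
  then obtain x where "\<And>n. prefix (length (padded s y n)) x = padded s y n"
    using chain_limit[of "padded s y"] by auto
  then have "\<exists>x. \<forall>n. prefix (pos s n) x = padded s y n"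
    by auto
  then show ?thesis
    unfolding pad_def by (rule someI2_ex) blast
qed

lemma pad_nth: "i < pos s n \<Longrightarrow> pad s y i = padded s y n ! i"
  unfolding prefix_pad[symmetric] by simp

lemma padded_cong: "(\<And>m. m < n \<Longrightarrow> y m = y' m) \<Longrightarrow> padded s y n = padded s y' n"
  by (induction n) simp_all

lemma pad_pos [simp]: "pad s y (pos s n) = y n"
  using pad_nth[of "pos s n" s "Suc n" y] by (simp add: nth_append)

lemma padded_nth_off_pos:
  assumes "i \<notin> range (pos s)" "i < pos s n"
  shows "padded s y n ! i = padded s y' n ! i"
  using assms(2)
proof (induction n)
  case (Suc n)
  then show ?case
    using assms(1) by (cases i "pos s n" rule: linorder_cases) (auto simp: nth_append nth_Cons split: nat.split)
qed simp

lemma pad_off_pos: "i \<notin> range (pos s) \<Longrightarrow> pad s y i = pad s y' i"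
proof -
  assume "i \<notin> range (pos s)"
  moreover have "i < pos s (Suc i)"
    using strict_mono_imp_increasing[OF strict_mono_pos] Suc_le_eq by blast
  ultimately show ?thesis
    using padded_nth_off_pos pad_nth by metis
qed

lemma pad_eq_conc: "pad s y = padded s y n \<frown> suffix (pos s n) (pad s y)"
  using prefix_suffix[of "pad s y" "pos s n"] by (simp only: prefix_pad)

lemma suffix_pad_cong:
  assumes "\<And>m. m \<ge> n \<Longrightarrow> y m = y' m"
  shows "suffix (pos s n) (pad s y) = suffix (pos s n) (pad s y')"
proof
  fix i
  show "suffix (pos s n) (pad s y) i = suffix (pos s n) (pad s y') i"
  proof (cases "pos s n + i \<in> range (pos s)")
    case True
    then obtain m where m: "pos s n + i = pos s m"
      by blast
    then have "n \<le> m"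
      using strict_mono_less_eq[OF strict_mono_pos, of s n m] by simp
    then show ?thesis
      using assms by (simp add: m)
  qed (simp add: pad_off_pos[of _ s y y'])
qed

lemma convergent_pad_sums_iff:
  fixes y y' :: "'a::ab_group_add word" and g :: "'a \<Rightarrow> 'b::topological_space"
  shows "convergent (\<lambda>k. g (\<Sum>i<k. pad s y i - pad s y' i)) \<longleftrightarrow> convergent (\<lambda>n. g (\<Sum>m<n. y m - y' m))"
  using convergent_sparse_sums_iff[OF strict_mono_pos, of s "\<lambda>i. pad s y i - pad s y' i" g]
  by (simp add: pad_off_pos[of _ s y y'])

lemma padded_filler_cong: "(\<And>m. m \<le> n \<Longrightarrow> s m = s' m) \<Longrightarrow> padded s y n = padded s' y n"
  by (induction n) simp_all

lemma padded_last_filler: "padded (s(n := t)) y n = padded (s(n := [])) y n @ t"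
proof (cases n)
  case (Suc m)
  have "padded (s(n := t)) y m = padded (s(n := [])) y m"
    by (rule padded_filler_cong) (simp add: Suc)
  then show ?thesis
    by (simp add: Suc)
qed simp

lemma finite_padded_image:
  assumes "\<And>n. finite (F n)"
  shows "finite ((\<lambda>y. padded s y n) ` Pi UNIV F)"
proof (induction n)
  case 0
  show ?case
    by (rule finite_subset[of _ "{s 0}"]) auto
next
  case (Suc n)
  have "(\<lambda>y. padded s y (Suc n)) ` Pi UNIV F
      \<subseteq> (\<lambda>(w, a). w @ a # s (Suc n)) ` ((\<lambda>y. padded s y n) ` Pi UNIV F \<times> F n)"
    by force
  then show ?case
    by (rule finite_subset) (intro finite_imageI finite_cartesian_product Suc.IH assms)
qed

lemma fillers_exist:
  fixes F :: "nat \<Rightarrow> 'a set" and good :: "nat \<Rightarrow> 'a list set \<Rightarrow> nat \<Rightarrow> bool"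
  assumes F: "\<And>n. finite (F n)"
    and extend: "\<And>n V L l\<^sub>0. finite V \<Longrightarrow> (\<And>v. v \<in> V \<Longrightarrow> length v = L) \<Longrightarrow>
      \<exists>s l. l\<^sub>0 < l \<and> good n ((\<lambda>v. v @ s) ` V) l"
  obtains s l where "strict_mono l" "\<And>n. good n ((\<lambda>y. padded s y n) ` Pi UNIV F) (l n)"
proof -
  let ?words = "\<lambda>s n. (\<lambda>y. padded s y n) ` Pi UNIV F"
  define chosen where "chosen f n r \<longleftrightarrow>
    good n (?words ((fst \<circ> f)(n := fst r)) n) (snd r) \<and> (\<forall>m<n. snd (f m) < snd r)"
    for f :: "nat \<Rightarrow> 'a list \<times> nat" and n and r
  have "\<exists>f. \<forall>n. chosen f n (f n)"
  proof (rule dependent_wellorder_choice)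
    fix r :: "'a list \<times> nat" and f g :: "nat \<Rightarrow> 'a list \<times> nat" and n :: nat
    assume eq: "\<And>m. m < n \<Longrightarrow> f m = g m"
    have "?words ((fst \<circ> f)(n := fst r)) n = ?words ((fst \<circ> g)(n := fst r)) n"
      by (intro image_cong refl padded_filler_cong) (simp add: eq)
    then show "chosen f n r = chosen g n r"
      by (simp add: chosen_def eq)
  next
    fix n and f :: "nat \<Rightarrow> 'a list \<times> nat"
    define V where "V = ?words ((fst \<circ> f)(n := [])) n"
    have "finite V" "\<And>v. v \<in> V \<Longrightarrow> length v = pos ((fst \<circ> f)(n := [])) n"
      unfolding V_def using F by (auto intro: finite_padded_image)
    from extend[OF this] obtain t l where l: "(\<Sum>m<n. snd (f m)) < l" and good: "good n ((\<lambda>v. v @ t) ` V) l"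
      by blast
    have "snd (f m) < l" if "m < n" for m
      using member_le_sum[of m "{..<n}" "\<lambda>m. snd (f m)"] that l by simp
    moreover have "(\<lambda>v. v @ t) ` V = ?words ((fst \<circ> f)(n := t)) n"
      unfolding V_def image_image padded_last_filler[of _ n t] ..
    ultimately show "\<exists>r. chosen f n r"
      using good by (intro exI[of _ "(t, l)"]) (simp add: chosen_def)
  qed
  then obtain f where f: "\<And>n. chosen f n (f n)"
    by blast
  show ?thesis
  proof (rule that[of "snd \<circ> f" "fst \<circ> f"])
    show "strict_mono (snd \<circ> f)"
      using f by (auto simp: chosen_def strict_mono_def)
    show "good n (?words (fst \<circ> f) n) ((snd \<circ> f) n)" for n
      using f[of n] fun_upd_triv[of "fst \<circ> f" n] by (simp add: chosen_def)
  qed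
qed

subsection \<open>Block reductions\<close>

lemma interval_between:
  fixes l :: "nat \<Rightarrow> nat"
  assumes "strict_mono l" "l m \<le> i"
  obtains n where "m \<le> n" "l n \<le> i" "i \<le> l (Suc n)"
proof -
  define k where "k = (LEAST n. i < l n)"
  have "\<exists>n. i < l n"
    using strict_mono_imp_increasing[OF assms(1)] by (meson Suc_le_eq)
  then have "i < l k"
    unfolding k_def by (rule LeastI_ex)
  then have "m < k"
    using assms by (metis le_less_trans strict_mono_less)
  moreover have "\<not> i < l (k - 1)"
    unfolding k_def by (rule not_less_Least) (use \<open>m < k\<close> k_def in simp)
  ultimately show ?thesis
    using that[of "k - 1"] \<open>i < l k\<close> by simp
qed

definition null_on_blocks :: "(nat \<Rightarrow> nat) \<Rightarrow> (nat \<Rightarrow> nat \<Rightarrow> real) \<Rightarrow> bool" where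
  "null_on_blocks l f \<longleftrightarrow> (\<forall>e>0. \<forall>\<^sub>F n in sequentially. \<forall>i\<in>{l n..l (Suc n)}. f n i < e)"

lemma null_on_blocks_add:
  assumes "null_on_blocks l f" "g \<longlonglongrightarrow> 0" "\<And>n i. i \<in> {l n..l (Suc n)} \<Longrightarrow> h n i \<le> f n i + g n"
  shows "null_on_blocks l h"
  unfolding null_on_blocks_def
proof (intro allI impI)
  fix e :: real assume "e > 0"
  then have half: "e / 2 > 0"
    by simp
  from assms(1)[unfolded null_on_blocks_def, rule_format, OF half] order_tendstoD(2)[OF assms(2) half]
  show "\<forall>\<^sub>F n in sequentially. \<forall>i\<in>{l n..l (Suc n)}. h n i < e"
  proof eventually_elim
    case (elim n)
    then show ?case
      using assms(3)[of _ n] by fastforce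
  qed
qed

lemma null_on_blocks_if_Cauchy:
  fixes R :: "nat \<Rightarrow> 'a::metric_space"
  assumes l: "strict_mono l" and "Cauchy R"
  shows "null_on_blocks l (\<lambda>n i. dist (R i) (R (l n)))"
  unfolding null_on_blocks_def
proof (intro allI impI)
  fix e :: real assume "e > 0"
  then obtain N where N: "\<And>i j. i \<ge> N \<Longrightarrow> j \<ge> N \<Longrightarrow> dist (R i) (R j) < e"
    using \<open>Cauchy R\<close> unfolding Cauchy_def by meson
  have "dist (R i) (R (l n)) < e" if "n \<ge> N" "i \<in> {l n..l (Suc n)}" for n i
    using that strict_mono_imp_increasing[OF l, of n] by (intro N) auto
  then show "\<forall>\<^sub>F n in sequentially. \<forall>i\<in>{l n..l (Suc n)}. dist (R i) (R (l n)) < e"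
    unfolding eventually_sequentially by blast
qed

lemma tendsto_if_null_on_blocks:
  fixes R :: "nat \<Rightarrow> 'a::metric_space"
  assumes l: "strict_mono l" and null: "null_on_blocks l (\<lambda>n i. dist (R i) (R (l n)))"
    and lim: "(\<lambda>n. R (l n)) \<longlonglongrightarrow> L"
  shows "R \<longlonglongrightarrow> L"
proof (rule tendstoI)
  fix e :: real assume "e > 0"
  then have half: "e / 2 > 0"
    by simp
  have "\<forall>\<^sub>F n in sequentially. \<forall>i\<in>{l n..l (Suc n)}. dist (R i) (R (l n)) < e / 2"
    using null half by (simp only: null_on_blocks_def)
  from eventually_conj[OF this tendstoD[OF lim half]]
  obtain N where N: "\<And>n i. n \<ge> N \<Longrightarrow> i \<in> {l n..l (Suc n)} \<Longrightarrow> dist (R i) (R (l n)) < e / 2"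
    "\<And>n. n \<ge> N \<Longrightarrow> dist (R (l n)) L < e / 2"
    unfolding eventually_sequentially by blast
  have "dist (R i) L < e" if "i \<ge> l N" for i
  proof -
    obtain n where "N \<le> n" "l n \<le> i" "i \<le> l (Suc n)"
      by (rule interval_between[OF l \<open>l N \<le> i\<close>])
    then show ?thesis
      using N(1)[of n i] N(2)[of n] dist_triangle[of "R i" L "R (l n)"] by simp
  qed
  then show "\<forall>\<^sub>F i in sequentially. dist (R i) L < e"
    unfolding eventually_sequentially by blast
qed

lemma convergent_iff_null_on_blocks:
  fixes R :: "nat \<Rightarrow> 'a::metric_space"
  assumes l: "strict_mono l"
  shows "convergent R \<longleftrightarrow> convergent (\<lambda>n. R (l n)) \<and> null_on_blocks l (\<lambda>n i. dist (R i) (R (l n)))"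
proof (intro iffI conjI)
  assume R: "convergent R"
  then show "convergent (\<lambda>n. R (l n))"
    using convergent_subseq_convergent[OF R l] by (simp add: o_def)
  show "null_on_blocks l (\<lambda>n i. dist (R i) (R (l n)))"
    using l convergent_Cauchy[OF R] by (rule null_on_blocks_if_Cauchy)
next
  assume R: "convergent (\<lambda>n. R (l n)) \<and> null_on_blocks l (\<lambda>n i. dist (R i) (R (l n)))"
  then obtain L where "(\<lambda>n. R (l n)) \<longlonglongrightarrow> L"
    unfolding convergent_def by blast
  with R have "R \<longlonglongrightarrow> L"
    using tendsto_if_null_on_blocks[OF l, of R L] by blast
  then show "convergent R"
    by (rule convergentI)
qed

lemma convergent_diff_cong:
  fixes u v :: "nat \<Rightarrow> 'a::topological_group_add"
  assumes "convergent (\<lambda>n. u n - v n)"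
  shows "convergent u \<longleftrightarrow> convergent v"
proof -
  obtain L where L: "(\<lambda>n. u n - v n) \<longlonglongrightarrow> L"
    using assms unfolding convergent_def by blast
  show ?thesis
    unfolding convergent_def
    using tendsto_add[OF L] tendsto_add[OF tendsto_minus[OF L]] by (fastforce simp: algebra_simps)
qed

lemma half_power_tendsto_0: "(\<lambda>n. c * (1 / 2 :: real) ^ n) \<longlonglongrightarrow> 0"
  by (intro tendsto_mult_right_zero LIMSEQ_realpow_zero) auto

lemma summable_half_powers: "summable (\<lambda>n. c * (1 / 2 :: real) ^ n)"
  by (intro summable_mult summable_geometric) simp

text \<open>
  The index \<open>i\<close> of the outputs \<open>\<Theta> y i\<close> is cut into blocks at the places \<open>l n\<close>: up to errors
  \<open>2\<^sup>-\<^sup>n\<close>, the outputs before \<open>l n\<close> do not depend on the entries from \<open>n\<close> onwards, while the entries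
  before \<open>n\<close> only shift the outputs after \<open>l n\<close> by a constant.
\<close>

locale block_reduction = \<omega>: additive \<omega>
  for \<omega> :: "'a::ab_group_add \<Rightarrow> 'c::{invariant_metric_group, complete_space}" +
  fixes F :: "nat \<Rightarrow> 'a set" and l :: "nat \<Rightarrow> nat"
    and \<Theta> :: "'a word \<Rightarrow> nat \<Rightarrow> 'b::{invariant_metric_group, complete_space}"
  assumes F_zero: "0 \<in> F n" and F_mono: "m \<le> n \<Longrightarrow> F m \<subseteq> F n" and F_UNIV: "(\<Union>n. F n) = UNIV"
    and l_mono: "strict_mono l"
    and head: "y \<in> Pi UNIV F \<Longrightarrow> y' \<in> Pi UNIV F \<Longrightarrow> (\<And>m. m < n \<Longrightarrow> y m = y' m) \<Longrightarrow> i \<le> l n \<Longrightarrow>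
      dist (\<Theta> y i) (\<Theta> y' i) \<le> (1 / 2) ^ n"
    and tail: "y \<in> Pi UNIV F \<Longrightarrow> y' \<in> Pi UNIV F \<Longrightarrow> (\<And>m. m \<ge> n \<Longrightarrow> y m = y' m) \<Longrightarrow> l n \<le> i \<Longrightarrow> l n \<le> i' \<Longrightarrow>
      dist (\<Theta> y i - \<Theta> y' i) (\<Theta> y i' - \<Theta> y' i') \<le> (1 / 2) ^ n"
    and reduction: "y \<in> Pi UNIV F \<Longrightarrow> y' \<in> Pi UNIV F \<Longrightarrow>
      convergent (\<lambda>i. \<Theta> y i - \<Theta> y' i) \<longleftrightarrow> convergent (\<lambda>n. \<omega> (\<Sum>m<n. y m - y' m))"
begin

text \<open>
  Up to summable errors, the entry \<open>y n\<close> contributes \<open>response n (y n) i\<close> to the outputs with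
  indices \<open>i\<close> in the block from \<open>l n\<close> to \<open>l (Suc n)\<close>, and \<open>contribution n (y n)\<close> to all later ones.
\<close>

definition response :: "nat \<Rightarrow> 'a \<Rightarrow> nat \<Rightarrow> 'b" where
  "response n g i = \<Theta> ((\<lambda>_. 0)(n := g)) i - \<Theta> (\<lambda>_. 0) i"

definition contribution :: "nat \<Rightarrow> 'a \<Rightarrow> 'b" where
  "contribution n g = response n g (l (Suc n))"

lemma response_0 [simp]: "response n 0 i = 0"
proof -
  have "(\<lambda>_. 0)(n := 0) = (\<lambda>_. 0 :: 'a)"
    by auto
  then show ?thesis
    by (simp add: response_def)
qed

lemma contribution_0 [simp]: "contribution n 0 = 0"
  by (simp add: contribution_def)

lemma l_le: "m \<le> n \<Longrightarrow> l m \<le> l n"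
  using l_mono by (simp add: strict_mono_less_eq)

lemma eventually_in_F: "\<forall>\<^sub>F n in sequentially. g \<in> F n"
  using F_UNIV F_mono unfolding eventually_sequentially by (metis UNIV_I UN_iff subsetD)

lemma zero_in_Pi: "(\<lambda>_. 0) \<in> Pi UNIV F"
  using F_zero by simp

lemma dist_increment_response_le:
  assumes y: "y \<in> Pi UNIV F" and i: "i \<in> {l n..l (Suc n)}"
  shows "dist ((\<Theta> y i - \<Theta> y (l n)) - (\<Theta> (\<lambda>_. 0) i - \<Theta> (\<lambda>_. 0) (l n))) (response n (y n) i) \<le> 3 * (1 / 2) ^ n"
proof -
  define z where "z = (\<lambda>_ :: nat. 0 :: 'a)"
  define y\<^sub>1 where "y\<^sub>1 m = (if m \<le> n then y m else 0)" for m
  define y\<^sub>2 where "y\<^sub>2 = z(n := y n)"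
  have F: "y\<^sub>1 \<in> Pi UNIV F" "y\<^sub>2 \<in> Pi UNIV F" "z \<in> Pi UNIV F"
    using y F_zero by (auto simp: y\<^sub>1_def y\<^sub>2_def z_def Pi_iff)
  have cut: "dist (\<Theta> y k) (\<Theta> y\<^sub>1 k) \<le> (1 / 2) ^ Suc n" if "k \<le> l (Suc n)" for k
    using that by (intro head y F) (auto simp: y\<^sub>1_def)
  have shift: "dist (\<Theta> y\<^sub>1 i - \<Theta> y\<^sub>2 i) (\<Theta> y\<^sub>1 (l n) - \<Theta> y\<^sub>2 (l n)) \<le> (1 / 2) ^ n"
    using i by (intro tail F) (auto simp: y\<^sub>1_def y\<^sub>2_def z_def)
  have start: "dist (\<Theta> y\<^sub>2 (l n)) (\<Theta> z (l n)) \<le> (1 / 2) ^ n"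
    by (intro head F) (auto simp: y\<^sub>2_def)
  have "dist ((\<Theta> y i - \<Theta> y (l n)) - (\<Theta> z i - \<Theta> z (l n))) (response n (y n) i)
      = gnorm (((\<Theta> y i - \<Theta> y\<^sub>1 i) - (\<Theta> y (l n) - \<Theta> y\<^sub>1 (l n)))
        + (((\<Theta> y\<^sub>1 i - \<Theta> y\<^sub>2 i) - (\<Theta> y\<^sub>1 (l n) - \<Theta> y\<^sub>2 (l n))) - (\<Theta> y\<^sub>2 (l n) - \<Theta> z (l n))))"
    by (simp add: dist_eq_gnorm response_def y\<^sub>2_def z_def algebra_simps)
  also have "\<dots> \<le> (dist (\<Theta> y i) (\<Theta> y\<^sub>1 i) + dist (\<Theta> y (l n)) (\<Theta> y\<^sub>1 (l n)))
      + (dist (\<Theta> y\<^sub>1 i - \<Theta> y\<^sub>2 i) (\<Theta> y\<^sub>1 (l n) - \<Theta> y\<^sub>2 (l n)) + dist (\<Theta> y\<^sub>2 (l n)) (\<Theta> z (l n)))"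
    unfolding dist_eq_gnorm by (intro order_trans[OF gnorm_triangle_ineq add_mono] gnorm_triangle_ineq4)
  also have "\<dots> \<le> ((1 / 2) ^ Suc n + (1 / 2) ^ Suc n) + ((1 / 2) ^ n + (1 / 2) ^ n)"
    using i l_le[of n "Suc n"] by (intro add_mono cut shift start) auto
  finally show ?thesis
    by (simp add: z_def)
qed

lemma dist_quotient_increment_le:
  assumes y: "y \<in> Pi UNIV F" and y': "y' \<in> Pi UNIV F" and i: "i \<in> {l n..l (Suc n)}"
  shows "dist ((\<Theta> y i - \<Theta> y' i) - (\<Theta> y (l n) - \<Theta> y' (l n))) (response n (y n) i - response n (y' n) i)
    \<le> 6 * (1 / 2) ^ n"
proof -
  let ?inc = "\<lambda>y. (\<Theta> y i - \<Theta> y (l n)) - (\<Theta> (\<lambda>_. 0) i - \<Theta> (\<lambda>_. 0) (l n))"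
  have "(\<Theta> y i - \<Theta> y' i) - (\<Theta> y (l n) - \<Theta> y' (l n)) = ?inc y - ?inc y'"
    by simp
  then have "dist ((\<Theta> y i - \<Theta> y' i) - (\<Theta> y (l n) - \<Theta> y' (l n))) (response n (y n) i - response n (y' n) i)
      \<le> dist (?inc y) (response n (y n) i) + dist (?inc y') (response n (y' n) i)"
    by (simp only: dist_diff_le)
  also have "\<dots> \<le> 3 * (1 / 2) ^ n + 3 * (1 / 2) ^ n"
    by (intro add_mono dist_increment_response_le y y' i)
  finally show ?thesis
    by simp
qed

lemma convergent_outputs_iff:
  assumes y: "y \<in> Pi UNIV F" and y': "y' \<in> Pi UNIV F"
  shows "convergent (\<lambda>i. \<Theta> y i - \<Theta> y' i) \<longleftrightarrow>
    convergent (\<lambda>n. \<Sum>m<n. contribution m (y m) - contribution m (y' m)) \<and>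
    null_on_blocks l (\<lambda>n i. gnorm (response n (y n) i - response n (y' n) i))"
proof -
  define R where "R i = \<Theta> y i - \<Theta> y' i" for i
  define c where "c n = contribution n (y n) - contribution n (y' n)" for n
  define \<rho> where "\<rho> n i = response n (y n) i - response n (y' n) i" for n i
  have close: "dist (R i - R (l n)) (\<rho> n i) \<le> 6 * (1 / 2) ^ n" if "i \<in> {l n..l (Suc n)}" for n i
    unfolding R_def \<rho>_def using y y' that by (rule dist_quotient_increment_le)
  have "summable (\<lambda>n. gnorm ((R (l (Suc n)) - R (l n)) - c n))"
    using close[of "l (Suc _)"] l_le
    by (intro summable_comparison_test'[OF summable_half_powers[of 6]])
      (simp add: dist_eq_gnorm c_def \<rho>_def contribution_def)
  then have "convergent (\<lambda>n. \<Sum>m<n. (R (l (Suc m)) - R (l m)) - c m)"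
    by (rule convergent_sum_if_summable_gnorm)
  moreover have "(\<Sum>m<n. (R (l (Suc m)) - R (l m)) - c m) = (R (l n) - (\<Sum>m<n. c m)) - R (l 0)" for n
    by (simp add: sum_subtractf[of "\<lambda>m. R (l (Suc m)) - R (l m)" c] sum_lessThan_telescope[of "\<lambda>m. R (l m)"])
  ultimately have "convergent (\<lambda>n. (R (l n) - (\<Sum>m<n. c m)) - R (l 0))"
    by simp
  then have "convergent (\<lambda>n. R (l n) - (\<Sum>m<n. c m))"
    using convergent_diff_cong[of "\<lambda>n. R (l n) - (\<Sum>m<n. c m)" "\<lambda>n. (R (l n) - (\<Sum>m<n. c m)) - R (l 0)"]
    by (simp add: convergent_const)
  then have sums: "convergent (\<lambda>n. R (l n)) \<longleftrightarrow> convergent (\<lambda>n. \<Sum>m<n. c m)"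
    by (rule convergent_diff_cong)
  have bounds: "dist (R i) (R (l n)) \<le> gnorm (\<rho> n i) + 6 * (1 / 2) ^ n"
    "gnorm (\<rho> n i) \<le> dist (R i) (R (l n)) + 6 * (1 / 2) ^ n" if "i \<in> {l n..l (Suc n)}" for n i
    using close[OF that] dist_triangle[of "R i - R (l n)" 0 "\<rho> n i"] dist_triangle[of "\<rho> n i" 0 "R i - R (l n)"]
      dist_commute[of "\<rho> n i" "R i - R (l n)"] by (simp_all add: dist_eq_gnorm[of "R i"] gnorm_def)
  have "null_on_blocks l (\<lambda>n i. dist (R i) (R (l n))) \<longleftrightarrow> null_on_blocks l (\<lambda>n i. gnorm (\<rho> n i))"
    by (intro iffI; erule null_on_blocks_add[OF _ half_power_tendsto_0]; erule bounds)
  then show ?thesis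
    unfolding R_def[symmetric] c_def[symmetric] \<rho>_def[symmetric]
      convergent_iff_null_on_blocks[OF l_mono, of R] sums by blast
qed

lemma reduction_iff:
  assumes "y \<in> Pi UNIV F" "y' \<in> Pi UNIV F"
  shows "convergent (\<lambda>n. \<omega> (\<Sum>m<n. y m - y' m)) \<longleftrightarrow>
    convergent (\<lambda>n. \<Sum>m<n. contribution m (y m) - contribution m (y' m)) \<and>
    null_on_blocks l (\<lambda>n i. gnorm (response n (y n) i - response n (y' n) i))"
  using reduction[OF assms] convergent_outputs_iff[OF assms] by simp

end

subsection \<open>Sparse sequences\<close>

definition plant :: "(nat \<Rightarrow> nat) \<Rightarrow> (nat \<Rightarrow> 'a::zero) \<Rightarrow> nat \<Rightarrow> 'a" where
  "plant r v m = (if m \<in> range r then v (inv_into UNIV r m) else 0)"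

lemma plant_apply [simp]: "strict_mono r \<Longrightarrow> plant r v (r k) = v k"
  by (simp add: plant_def strict_mono_imp_inj_on)

lemma plant_outside: "m \<notin> range r \<Longrightarrow> plant r v m = 0"
  by (simp add: plant_def)

lemma convergent_plant_sums_iff:
  fixes v :: "nat \<Rightarrow> 'a::comm_monoid_add" and g :: "'a \<Rightarrow> 'b::topological_space"
  assumes "strict_mono r"
  shows "convergent (\<lambda>n. g (\<Sum>m<n. plant r v m)) \<longleftrightarrow> convergent (\<lambda>n. g (\<Sum>k<n. v k))"
  using convergent_sparse_sums_iff[OF assms, of "plant r v" g] by (simp add: assms plant_outside)

lemma plant_tendsto:
  fixes g :: "'a::zero \<Rightarrow> 'b::topological_space"
  assumes r: "strict_mono r" and lim: "(\<lambda>k. g (v k)) \<longlonglongrightarrow> g 0"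
  shows "(\<lambda>m. g (plant r v m)) \<longlonglongrightarrow> g 0"
proof (rule topological_tendstoI)
  fix W assume W: "open W" "g 0 \<in> W"
  then obtain K where K: "\<And>k. k \<ge> K \<Longrightarrow> g (v k) \<in> W"
    using topological_tendstoD[OF lim] unfolding eventually_sequentially by blast
  have "g (plant r v m) \<in> W" if "m \<ge> r K" for m
    using that K W(2) r by (cases "m \<in> range r") (auto simp: strict_mono_less_eq plant_outside)
  then show "\<forall>\<^sub>F m in sequentially. g (plant r v m) \<in> W"
    unfolding eventually_sequentially by blast
qed

context block_reduction
begin

lemma plant_in_Pi:
  assumes "strict_mono r" "\<And>k. v k \<in> F (r k)"
  shows "plant r v \<in> Pi UNIV F"
proof
  fix m
  show "plant r v m \<in> F m"
    using assms F_zero by (cases "m \<in> range r") (auto simp: plant_outside)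
qed

lemma response_small:
  assumes "e > 0"
  obtains d where "d > 0"
    "\<forall>\<^sub>F n in sequentially. \<forall>h\<in>F n. gnorm (\<omega> h) < d \<longrightarrow> (\<forall>i\<in>{l n..l (Suc n)}. gnorm (response n h i) < e)"
proof (rule ccontr)
  assume "\<not> thesis"
  then have "\<not> (\<forall>\<^sub>F n in sequentially. \<forall>h\<in>F n. gnorm (\<omega> h) < (1 / 2) ^ k \<longrightarrow>
      (\<forall>i\<in>{l n..l (Suc n)}. gnorm (response n h i) < e))" for k :: nat
    using that[of "(1 / 2) ^ k"] by auto
  moreover define large where "large k n \<longleftrightarrow> (\<exists>h\<in>F n. gnorm (\<omega> h) < (1 / 2) ^ k \<and>
      (\<exists>i\<in>{l n..l (Suc n)}. e \<le> gnorm (response n h i)))" for k n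
  ultimately have "\<exists>n\<ge>N. large k n" for N k
    unfolding eventually_sequentially by (meson not_le)
  then obtain r where r: "strict_mono r" and "\<And>k. large k (r k)"
    using sparse_selection[of large] by blast
  then obtain h where h: "\<And>k. h k \<in> F (r k)" "\<And>k. gnorm (\<omega> (h k)) < (1 / 2) ^ k"
    "\<And>k. \<exists>i\<in>{l (r k)..l (Suc (r k))}. e \<le> gnorm (response (r k) (h k) i)"
    unfolding large_def by metis
  have y: "plant r h \<in> Pi UNIV F"
    using r h(1) by (rule plant_in_Pi)
  have "summable (\<lambda>k. gnorm (\<omega> (h k)))"
    using h(2) by (intro summable_comparison_test'[OF summable_half_powers[of 1]]) (simp add: less_imp_le)
  then have "convergent (\<lambda>n. \<omega> (\<Sum>k<n. h k))"
    unfolding \<omega>.sum by (rule convergent_sum_if_summable_gnorm)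
  then have "convergent (\<lambda>n. \<omega> (\<Sum>m<n. plant r h m - (\<lambda>_. 0) m))"
    by (simp add: convergent_plant_sums_iff[OF r])
  then have "null_on_blocks l (\<lambda>n i. gnorm (response n (plant r h n) i - response n 0 i))"
    using reduction_iff[OF y zero_in_Pi] by blast
  then obtain N where N: "\<forall>n\<ge>N. \<forall>i\<in>{l n..l (Suc n)}. gnorm (response n (plant r h n) i) < e"
    using assms unfolding null_on_blocks_def eventually_sequentially by auto
  obtain i where i: "i \<in> {l (r N)..l (Suc (r N))}" "e \<le> gnorm (response (r N) (h N) i)"
    using h(3) by blast
  then have "gnorm (response (r N) (plant r h (r N)) i) < e"
    using N strict_mono_imp_increasing[OF r, of N] by blast
  then show False
    using i(2) by (simp add: r)
qed

end

subsection \<open>Asymptotic additivity\<close>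

lemma separated_blocks_union:
  fixes b :: "nat \<Rightarrow> nat"
  assumes b: "strict_mono b" and A: "\<And>k. A k \<subseteq> {b k..}" "\<And>k m. m \<in> A k \<Longrightarrow> Suc m \<notin> A k \<and> Suc m < b (Suc k)"
  obtains U K where "\<And>m. m \<in> U \<Longrightarrow> Suc m \<notin> U" "\<And>m. m \<in> U \<Longrightarrow> m \<in> A (K m)"
    "\<And>k. U \<inter> {b k..<b (Suc k)} = A k" "\<And>k m. m \<in> A k \<Longrightarrow> K m = k" "filterlim K at_top sequentially"
proof -
  define K where "K m = (LEAST k. m < b (Suc k))" for m
  have "m < b (Suc m)" for m
    using strict_mono_imp_increasing[OF b, of "Suc m"] by simp
  then have K_upper: "m < b (Suc (K m))" for m
    unfolding K_def by (rule LeastI)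
  have K_ge: "k \<le> K m" if "b k \<le> m" for k m
    using K_upper[of m] that b by (metis le_less_trans less_Suc_eq_le strict_mono_less)
  have K_eq: "K m = k" if "b k \<le> m" "m < b (Suc k)" for m k
    using K_ge[OF that(1)] Least_le[of "\<lambda>k. m < b (Suc k)" k] that(2) by (simp add: K_def)
  have A_bounds: "b k \<le> m" "Suc m < b (Suc k)" "m < b (Suc k)" if "m \<in> A k" for m k
    using A(1)[of k] A(2)[OF that] that by auto
  have A_K: "K m = k" "K (Suc m) = k" if "m \<in> A k" for m k
    using A_bounds[OF that] K_eq by simp_all
  show ?thesis
  proof (rule that[of "\<Union>k. A k" K])
    show "Suc m \<notin> (\<Union>k. A k)" if "m \<in> (\<Union>k. A k)" for m
      using that by (metis A(2) A_K UN_E)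
    show "m \<in> A (K m)" if "m \<in> (\<Union>k. A k)" for m
      using that by (metis A_K(1) UN_E)
    show "(\<Union>k. A k) \<inter> {b k..<b (Suc k)} = A k" for k
      using A_bounds by auto (metis A_K(1) K_eq)
    show "filterlim K at_top sequentially"
      using K_ge by (auto simp: filterlim_at_top eventually_sequentially)
  qed (rule A_K)
qed

lemma sum_postponed:
  fixes u w :: "nat \<Rightarrow> 'a::ab_group_add"
  assumes U: "\<And>m. m \<in> U \<Longrightarrow> Suc m \<notin> U"
  shows "(\<Sum>m<n. if m \<in> U then u m else if m \<in> Suc ` U then - w m else 0) =
    (\<Sum>m<n. if m \<in> U then u m - w (Suc m) else 0) + (if n \<in> Suc ` U then w n else 0)"
proof (induction n)
  case (Suc n)
  have "n \<notin> Suc ` U" if "n \<in> U"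
    using U that by blast
  then show ?case
    using Suc by (auto simp: algebra_simps)
qed simp

context block_reduction
begin

definition defect :: "nat \<Rightarrow> 'a \<Rightarrow> 'a \<Rightarrow> 'b" where
  "defect n g h = contribution n (g + h) - contribution n g - contribution (Suc n) h"

lemma response_null_on_blocks:
  assumes "\<And>n. h n \<in> F n" and lim: "(\<lambda>n. \<omega> (h n)) \<longlonglongrightarrow> 0"
  shows "null_on_blocks l (\<lambda>n i. gnorm (response n (h n) i))"
  unfolding null_on_blocks_def
proof (intro allI impI)
  fix e :: real assume "e > 0"
  then obtain d where d: "d > 0" and small: "\<forall>\<^sub>F n in sequentially. \<forall>h\<in>F n. gnorm (\<omega> h) < d \<longrightarrow>
      (\<forall>i\<in>{l n..l (Suc n)}. gnorm (response n h i) < e)"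
    by (rule response_small)
  have "\<forall>\<^sub>F n in sequentially. gnorm (\<omega> (h n)) < d"
    using tendstoD[OF lim d] by (simp add: gnorm_def)
  with small show "\<forall>\<^sub>F n in sequentially. \<forall>i\<in>{l n..l (Suc n)}. gnorm (response n (h n) i) < e"
    by eventually_elim (use assms(1) in blast)
qed

lemma contribution_tendsto_0:
  assumes "\<And>n. h n \<in> F n" and "(\<lambda>n. \<omega> (h n)) \<longlonglongrightarrow> 0"
  shows "(\<lambda>n. contribution n (h n)) \<longlonglongrightarrow> 0"
proof (rule tendstoI)
  fix e :: real assume "e > 0"
  with response_null_on_blocks[OF assms]
  have "\<forall>\<^sub>F n in sequentially. \<forall>i\<in>{l n..l (Suc n)}. gnorm (response n (h n) i) < e"
    unfolding null_on_blocks_def by blast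
  then show "\<forall>\<^sub>F n in sequentially. dist (contribution n (h n)) 0 < e"
    by eventually_elim (simp add: contribution_def gnorm_def l_le)
qed

text \<open>
  Moving \<open>h m\<close> from the entry \<open>g m + h m\<close> at place \<open>m\<close> to the next place changes the outputs by
  \<open>defect m (g m) (h m)\<close>. Doing so at all \<open>m \<in> U\<close> does not leave the equivalence class.
\<close>

lemma convergent_defect_sums:
  assumes U: "\<And>m. m \<in> U \<Longrightarrow> Suc m \<notin> U"
    and F: "\<And>m. m \<in> U \<Longrightarrow> g m \<in> F m \<and> h m \<in> F m \<and> g m + h m \<in> F m"
    and lim: "(\<lambda>m. if m \<in> U then \<omega> (h m) else 0) \<longlonglongrightarrow> 0"
  shows "convergent (\<lambda>n. \<Sum>m<n. if m \<in> U then defect m (g m) (h m) else 0)"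
proof -
  define moved where "moved m = (if m \<in> Suc ` U then h (m - 1) else 0)" for m
  define y where "y m = (if m \<in> U then g m + h m else 0)" for m
  define y' where "y' m = (if m \<in> U then g m else moved m)" for m
  have moved_Suc: "m \<in> U \<Longrightarrow> moved (Suc m) = h m" for m
    by (simp add: moved_def)
  have moved_F: "moved m \<in> F m" for m
    using F F_zero F_mono[of "m - 1" m] by (auto simp: moved_def)
  have "(\<lambda>m. \<omega> (moved (Suc m))) \<longlonglongrightarrow> 0"
    using lim by (rule Lim_transform_eventually) (auto simp: moved_def \<omega>.zero inj_image_mem_iff)
  then have moved_lim: "(\<lambda>n. \<omega> (moved n)) \<longlonglongrightarrow> 0"
    by (rule LIMSEQ_imp_Suc)
  have F': "y \<in> Pi UNIV F" "y' \<in> Pi UNIV F"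
    using F F_zero moved_F by (auto simp: y_def y'_def)
  have "y m - y' m = (if m \<in> U then h m else if m \<in> Suc ` U then - moved m else 0)" for m
    by (simp add: y_def y'_def moved_def)
  then have "(\<Sum>m<n. y m - y' m) = moved n" for n
    using sum_postponed[OF U, of h moved n] moved_Suc by (simp add: moved_def cong: if_cong)
  then have "convergent (\<lambda>n. \<omega> (\<Sum>m<n. y m - y' m))"
    using moved_lim by (auto intro: convergentI)
  then have "convergent (\<lambda>n. \<Sum>m<n. contribution m (y m) - contribution m (y' m))"
    using reduction_iff[OF F'] by blast
  moreover have "contribution m (y m) - contribution m (y' m) =
      (if m \<in> U then contribution m (g m + h m) - contribution m (g m)
       else if m \<in> Suc ` U then - contribution m (moved m) else 0)" for m
    by (simp add: y_def y'_def moved_def)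
  then have "(\<Sum>m<n. contribution m (y m) - contribution m (y' m))
      = (\<Sum>m<n. if m \<in> U then defect m (g m) (h m) else 0) + contribution n (moved n)" for n
    using sum_postponed[OF U, of "\<lambda>m. contribution m (g m + h m) - contribution m (g m)"
        "\<lambda>m. contribution m (moved m)" n]
    by (simp add: moved_def defect_def cong: if_cong)
  moreover have "convergent (\<lambda>n. contribution n (moved n))"
    using contribution_tendsto_0[OF moved_F moved_lim] by (rule convergentI)
  ultimately show ?thesis
    using convergent_diff_cong[of
        "\<lambda>n. (\<Sum>m<n. if m \<in> U then defect m (g m) (h m) else 0) + contribution n (moved n)"
        "\<lambda>n. \<Sum>m<n. if m \<in> U then defect m (g m) (h m) else 0"] by simp
qed

end

locale torus_block_reduction = block_reduction \<omega> F l \<Theta>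
  for \<omega> :: "'a::{ab_group_add, countable} \<Rightarrow> 'c::{invariant_metric_group, complete_space}" and F l
    and \<Theta> :: "'a word \<Rightarrow> nat \<Rightarrow> 'i::countable \<Rightarrow> circle"
begin

lemma large_defect_sum:
  assumes "\<not> (\<lambda>m. defect m g h j) \<longlonglongrightarrow> 0"
  obtains A N' where "N < N'" "A \<subseteq> {N..}" "\<And>m. m \<in> A \<Longrightarrow> Suc m \<notin> A \<and> Suc m < N'"
    "\<And>m. m \<in> A \<Longrightarrow> g \<in> F m \<and> h \<in> F m \<and> g + h \<in> F m" "gnorm (\<Sum>m\<in>A. defect m g h j) \<ge> 1 / 2"
proof -
  have "\<forall>\<^sub>F m in sequentially. g \<in> F m \<and> h \<in> F m \<and> g + h \<in> F m"
    by (intro eventually_conj eventually_in_F)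
  then obtain M where M: "\<And>m. m \<ge> M \<Longrightarrow> g \<in> F m \<and> h \<in> F m \<and> g + h \<in> F m"
    unfolding eventually_sequentially by blast
  obtain A where A: "finite A" "A \<subseteq> {max N M..}" "\<And>m. m \<in> A \<Longrightarrow> Suc m \<notin> A"
    "gnorm (\<Sum>m\<in>A. defect m g h j) \<ge> 1 / 2"
    using circle_large_sums[OF assms] by blast
  obtain N\<^sub>0 where "Suc ` A \<subseteq> {..<N\<^sub>0}"
    using A(1) finite_nat_iff_bounded by blast
  then have "Suc m < Suc (max N N\<^sub>0)" if "m \<in> A" for m
    using that by fastforce
  then show ?thesis
    using that[of "Suc (max N N\<^sub>0)" A] A M by fastforce
qed

lemma separated_large_defects:
  fixes g h :: "nat \<Rightarrow> 'a"
  assumes large: "\<And>k. \<not> (\<lambda>m. defect m (g k) (h k) j) \<longlonglongrightarrow> 0"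
  obtains b U K where "strict_mono b" "filterlim K at_top sequentially" "\<And>m. m \<in> U \<Longrightarrow> Suc m \<notin> U"
    "\<And>m. m \<in> U \<Longrightarrow> g (K m) \<in> F m \<and> h (K m) \<in> F m \<and> g (K m) + h (K m) \<in> F m"
    "\<And>k. gnorm (\<Sum>m\<in>U \<inter> {b k..<b (Suc k)}. defect m (g (K m)) (h (K m)) j) \<ge> 1 / 2"
proof -
  define block where "block k N N' A \<longleftrightarrow> A \<subseteq> {N..} \<and> (\<forall>m\<in>A. Suc m \<notin> A \<and> Suc m < N') \<and>
    (\<forall>m\<in>A. g k \<in> F m \<and> h k \<in> F m \<and> g k + h k \<in> F m) \<and> gnorm (\<Sum>m\<in>A. defect m (g k) (h k) j) \<ge> 1 / 2"
    for k N N' A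
  have "\<exists>N'>N. \<exists>A. block k N N' A" for k N
    using large_defect_sum[OF large[of k], of N] unfolding block_def by metis
  then obtain b where b: "strict_mono b" "\<And>k. \<exists>A. block k (b k) (b (Suc k)) A"
    using block_selection[of "\<lambda>k N N'. \<exists>A. block k N N' A"] by blast
  then obtain A where A: "\<And>k. block k (b k) (b (Suc k)) (A k)"
    by metis
  have separated: "A k \<subseteq> {b k..}" "m \<in> A k \<Longrightarrow> Suc m \<notin> A k \<and> Suc m < b (Suc k)" for k m
    using A[of k] by (auto simp: block_def)
  obtain U K where U: "\<And>m. m \<in> U \<Longrightarrow> Suc m \<notin> U" and U_A: "\<And>m. m \<in> U \<Longrightarrow> m \<in> A (K m)"
    and U_block: "\<And>k. U \<inter> {b k..<b (Suc k)} = A k" and K_A: "\<And>k m. m \<in> A k \<Longrightarrow> K m = k"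
    and K_lim: "filterlim K at_top sequentially"
    by (rule separated_blocks_union[OF b(1) separated]; (assumption | rule that))
  show ?thesis
  proof (rule that[OF b(1) K_lim U])
    show "g (K m) \<in> F m \<and> h (K m) \<in> F m \<and> g (K m) + h (K m) \<in> F m" if "m \<in> U" for m
      using A[of "K m"] U_A[OF that] by (simp add: block_def)
    have "(\<Sum>m\<in>A k. defect m (g (K m)) (h (K m)) j) = (\<Sum>m\<in>A k. defect m (g k) (h k) j)" for k
      by (simp add: K_A)
    then show "gnorm (\<Sum>m\<in>U \<inter> {b k..<b (Suc k)}. defect m (g (K m)) (h (K m)) j) \<ge> 1 / 2" for k
      using A[of k] by (simp add: U_block block_def)
  qed
qed

lemma defect_tendsto_0:
  obtains d where "d > 0" "\<And>g h. gnorm (\<omega> h) < d \<Longrightarrow> (\<lambda>m. defect m g h j) \<longlonglongrightarrow> 0"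
proof (rule ccontr)
  assume "\<not> thesis"
  then have "\<exists>g h. gnorm (\<omega> h) < (1 / 2) ^ k \<and> \<not> (\<lambda>m. defect m g h j) \<longlonglongrightarrow> 0" for k :: nat
    using that[of "(1 / 2) ^ k"] by auto
  then obtain g h where h: "\<And>k. gnorm (\<omega> (h k)) < (1 / 2) ^ k"
    and large: "\<And>k. \<not> (\<lambda>m. defect m (g k) (h k) j) \<longlonglongrightarrow> 0"
    by metis
  obtain b U K where b: "strict_mono b" and K: "filterlim K at_top sequentially"
    and U: "\<And>m. m \<in> U \<Longrightarrow> Suc m \<notin> U"
    and F: "\<And>m. m \<in> U \<Longrightarrow> g (K m) \<in> F m \<and> h (K m) \<in> F m \<and> g (K m) + h (K m) \<in> F m"
    and large_block: "\<And>k. gnorm (\<Sum>m\<in>U \<inter> {b k..<b (Suc k)}. defect m (g (K m)) (h (K m)) j) \<ge> 1 / 2"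
    by (rule separated_large_defects[of g h j, OF large]) (rule that)
  define f where "f m = (if m \<in> U then defect m (g (K m)) (h (K m)) else 0)" for m
  have "(\<lambda>m. if m \<in> U then \<omega> (h (K m)) else 0) \<longlonglongrightarrow> 0"
    unfolding tendsto_0_iff_gnorm
  proof (rule Lim_null_comparison[OF always_eventually])
    show "(\<lambda>m. (1 / 2 :: real) ^ K m) \<longlonglongrightarrow> 0"
      using filterlim_compose[OF half_power_tendsto_0[of 1] K] by simp
  qed (use h in \<open>simp add: less_imp_le\<close>)
  from convergent_defect_sums[OF U F this] have "convergent (\<lambda>n. \<Sum>m<n. f m j)"
    unfolding f_def convergent_fun_iff sum_fun_apply by blast
  then obtain N where "\<forall>m\<ge>N. \<forall>n\<ge>m. gnorm (\<Sum>m=m..<n. f m j) < 1 / 2"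
    unfolding convergent_sum_iff by (meson half_gt_zero zero_less_one)
  then have "gnorm (\<Sum>m=b N..<b (Suc N). f m j) < 1 / 2"
    using strict_mono_imp_increasing[OF b] b by (simp add: strict_mono_less_eq)
  also have "(\<Sum>m=b N..<b (Suc N). f m j) = (\<Sum>m\<in>U \<inter> {b N..<b (Suc N)}. defect m (g (K m)) (h (K m)) j)"
    by (intro sum.mono_neutral_cong_right) (auto simp: f_def)
  finally show False
    using large_block[of N] by simp
qed

lemma contribution_asymptotically_additive:
  assumes divisors: "\<And>h d. d > 0 \<Longrightarrow> \<exists>(n :: nat) h'. (\<Sum>i<n. h') = h \<and> gnorm (\<omega> h') < d"
  shows "(\<lambda>m. contribution m (g + h) - contribution m g - contribution m h) \<longlonglongrightarrow> 0"
  unfolding tendsto_fun_iff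
proof
  fix j
  define additive_at where "additive_at g h \<longleftrightarrow>
    (\<lambda>m. contribution m (g + h) j - contribution m g j - contribution m h j) \<longlonglongrightarrow> 0" for g h
  obtain d where "d > 0" and d: "\<And>g h. gnorm (\<omega> h) < d \<Longrightarrow> (\<lambda>m. defect m g h j) \<longlonglongrightarrow> 0"
    by (rule defect_tendsto_0[of j]) blast
  have small: "additive_at g h" if "gnorm (\<omega> h) < d" for g h
    using tendsto_diff[OF d[OF that, of g] d[OF that, of 0]]
    by (simp add: additive_at_def defect_def algebra_simps)
  obtain n :: nat and h' where h': "(\<Sum>i<n. h') = h" "gnorm (\<omega> h') < d"
    using divisors[OF \<open>d > 0\<close>] by blast
  have "additive_at g (\<Sum>i<n. h')" for n :: nat
  proof (induction n)
    case 0
    show ?case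
      by (simp add: additive_at_def)
  next
    case (Suc n)
    let ?s = "\<Sum>i<n. h'"
    have "(\<lambda>m. (contribution m ((g + ?s) + h') j - contribution m (g + ?s) j - contribution m h' j)
        + (contribution m (g + ?s) j - contribution m g j - contribution m ?s j)
        - (contribution m (?s + h') j - contribution m ?s j - contribution m h' j)) \<longlonglongrightarrow> 0 + 0 - 0"
      using small[OF h'(2)] Suc.IH unfolding additive_at_def by (intro tendsto_diff tendsto_add)
    then show ?case
      by (simp add: additive_at_def algebra_simps)
  qed
  then have "additive_at g h"
    using h'(1) by blast
  then show "(\<lambda>m. (contribution m (g + h) - contribution m g - contribution m h) j) \<longlonglongrightarrow> 0 j"
    by (simp add: additive_at_def)
qed

end

subsection \<open>Limits of contributions\<close>

context block_reduction
begin

lemma limit_in_closed: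
  assumes r: "strict_mono r" and H: "(\<lambda>m. contribution (r m) g) \<longlonglongrightarrow> H g"
    and A: "closed A" "\<And>n. g \<in> F n \<Longrightarrow> contribution n g \<in> A"
  shows "H g \<in> A"
proof (rule Lim_in_closed_set[OF A(1) _ _ H])
  show "\<forall>\<^sub>F m in sequentially. contribution (r m) g \<in> A"
    using eventually_subseq[OF r eventually_in_F[of g]] by eventually_elim (rule A(2))
qed simp

lemma limit_continuous_at_0:
  assumes r: "strict_mono r" and H: "\<And>g. (\<lambda>m. contribution (r m) g) \<longlonglongrightarrow> H g" and "e > 0"
  obtains d where "d > 0" "\<And>h. gnorm (\<omega> h) < d \<Longrightarrow> gnorm (H h) \<le> e"
proof -
  obtain d where "d > 0" and d: "\<forall>\<^sub>F n in sequentially. \<forall>h\<in>F n. gnorm (\<omega> h) < d \<longrightarrow>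
      (\<forall>i\<in>{l n..l (Suc n)}. gnorm (response n h i) < e)"
    using \<open>e > 0\<close> by (rule response_small)
  have "gnorm (H h) \<le> e" if h: "gnorm (\<omega> h) < d" for h
  proof (rule tendsto_upperbound)
    show "(\<lambda>m. gnorm (contribution (r m) h)) \<longlonglongrightarrow> gnorm (H h)"
      unfolding gnorm_def by (intro tendsto_intros H)
    show "\<forall>\<^sub>F m in sequentially. gnorm (contribution (r m) h) \<le> e"
      using eventually_subseq[OF r d] eventually_subseq[OF r eventually_in_F[of h]]
      by eventually_elim (use h l_le in \<open>auto simp: contribution_def less_imp_le\<close>)
  qed simp
  then show ?thesis
    using that \<open>d > 0\<close> by blast
qed

lemma limit_nonzero:
  assumes r: "strict_mono r" and H: "\<And>g. (\<lambda>m. contribution (r m) g) \<longlonglongrightarrow> H g"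
    and v: "(\<lambda>k. \<omega> (v k)) \<longlonglongrightarrow> 0" "\<not> convergent (\<lambda>n. \<omega> (\<Sum>k<n. v k))"
  obtains g where "H g \<noteq> 0"
proof (rule ccontr)
  assume "\<not> thesis"
  then have "(\<lambda>m. contribution (r m) g) \<longlonglongrightarrow> 0" for g
    using that H by metis
  then have small: "\<forall>\<^sub>F m in sequentially. gnorm (contribution (r m) g) < (1 / 2) ^ k" for g and k :: nat
    unfolding tendsto_0_iff_gnorm by (intro order_tendstoD(2)) auto
  have "\<exists>n\<ge>N. v k \<in> F n \<and> gnorm (contribution n (v k)) < (1 / 2) ^ k" for k N
  proof -
    have "\<forall>\<^sub>F m in sequentially. N \<le> r m \<and> v k \<in> F (r m) \<and> gnorm (contribution (r m) (v k)) < (1 / 2) ^ k"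
      by (intro eventually_conj small eventually_subseq[OF r] eventually_in_F eventually_ge_at_top)
    then show ?thesis
      using eventually_happens by force
  qed
  then obtain q where q: "strict_mono q"
    and "\<And>k. v k \<in> F (q k) \<and> gnorm (contribution (q k) (v k)) < (1 / 2) ^ k"
    by (rule sparse_selection[of "\<lambda>k n. v k \<in> F n \<and> gnorm (contribution n (v k)) < (1 / 2) ^ k"]) (rule that)
  then have qv: "\<And>k. v k \<in> F (q k)" "\<And>k. gnorm (contribution (q k) (v k)) < (1 / 2) ^ k"
    by auto
  define y where "y = plant q v"
  have y: "y \<in> Pi UNIV F"
    unfolding y_def using q qv(1) by (rule plant_in_Pi)
  have "summable (\<lambda>k. gnorm (contribution (q k) (v k)))"
    using qv(2) by (intro summable_comparison_test'[OF summable_half_powers[of 1]]) (simp add: less_imp_le)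
  then have "convergent (\<lambda>n. \<Sum>k<n. contribution (q k) (v k))"
    by (rule convergent_sum_if_summable_gnorm)
  then have "convergent (\<lambda>n. \<Sum>m<n. contribution m (y m))"
    using convergent_sparse_sums_iff[OF q, of "\<lambda>m. contribution m (y m)" "\<lambda>x. x"] q
    by (simp add: y_def plant_outside)
  moreover have "null_on_blocks l (\<lambda>n i. gnorm (response n (y n) i))"
  proof (rule response_null_on_blocks)
    show "(\<lambda>m. \<omega> (y m)) \<longlonglongrightarrow> 0"
      using plant_tendsto[OF q, of \<omega> v] v(1) by (simp add: y_def \<omega>.zero)
  qed (use y in auto)
  ultimately have "convergent (\<lambda>n. \<omega> (\<Sum>m<n. y m))"
    using reduction_iff[OF y zero_in_Pi] by simp
  then show False
    using v(2) convergent_plant_sums_iff[OF q] unfolding y_def by blast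
qed

end

context torus_block_reduction
begin

lemma limit_additive:
  assumes "\<And>h d. d > 0 \<Longrightarrow> \<exists>(n :: nat) h'. (\<Sum>i<n. h') = h \<and> gnorm (\<omega> h') < d"
    and r: "strict_mono r" and H: "\<And>g. (\<lambda>m. contribution (r m) g) \<longlonglongrightarrow> H g"
  shows "Modules.additive H"
proof
  fix g h
  have "(\<lambda>m. contribution (r m) (g + h) - contribution (r m) g - contribution (r m) h) \<longlonglongrightarrow> 0"
    using LIMSEQ_subseq_LIMSEQ[OF contribution_asymptotically_additive[OF assms(1)] r] by (simp add: o_def)
  moreover have "(\<lambda>m. contribution (r m) (g + h) - contribution (r m) g - contribution (r m) h)
      \<longlonglongrightarrow> H (g + h) - H g - H h"
    by (intro tendsto_diff H)
  ultimately have "H (g + h) - H g - H h = 0"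
    using LIMSEQ_unique by blast
  then show "H (g + h) = H g + H h"
    by (simp add: algebra_simps)
qed

theorem limit_homomorphism:
  assumes divisors: "\<And>h d. d > 0 \<Longrightarrow> \<exists>(n :: nat) h'. (\<Sum>i<n. h') = h \<and> gnorm (\<omega> h') < d"
    and v: "(\<lambda>k. \<omega> (v k)) \<longlonglongrightarrow> 0" "\<not> convergent (\<lambda>n. \<omega> (\<Sum>k<n. v k))"
    and A: "closed A" "\<And>n g. g \<in> F n \<Longrightarrow> contribution n g \<in> A"
  obtains H where "Modules.additive H" "range H \<subseteq> A" "\<exists>g. H g \<noteq> 0"
    "\<And>e. e > 0 \<Longrightarrow> \<exists>d>0. \<forall>h. gnorm (\<omega> h) < d \<longrightarrow> gnorm (H h) \<le> e"
proof -
  have "compact (UNIV :: ('a \<Rightarrow> 'i \<Rightarrow> circle) set)"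
    by (intro compact_UNIV_fun compact_UNIV_circle)
  then obtain r H where r: "strict_mono r" and "(\<lambda>m. contribution (r m)) \<longlonglongrightarrow> H"
    using frequently_imp_subseq_limit[of UNIV contribution "\<lambda>_. True"] by auto
  then have H: "(\<lambda>m. contribution (r m) g) \<longlonglongrightarrow> H g" for g
    by (simp add: tendsto_fun_iff[of "\<lambda>m. contribution (r m)"])
  show ?thesis
  proof (rule that)
    show "Modules.additive H"
      using divisors r H by (rule limit_additive)
    show "range H \<subseteq> A"
    proof (intro image_subsetI)
      show "H g \<in> A" for g
        using r H A(1) by (rule limit_in_closed) (rule A(2))
    qed
    show "\<exists>g. H g \<noteq> 0"
      by (rule limit_nonzero[OF r H v]) (rule exI)
    show "\<exists>d>0. \<forall>h. gnorm (\<omega> h) < d \<longrightarrow> gnorm (H h) \<le> e" if "e > 0" for e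
      by (rule limit_continuous_at_0[OF r H that]) blast
  qed
qed

end

subsection \<open>Existence of block reductions\<close>

context generic_map
begin

lemma block_fillers:
  fixes F :: "nat \<Rightarrow> 'a set"
  assumes F: "\<And>n. finite (F n)"
  obtains s l where "strict_mono l" "\<And>y. y \<in> Pi UNIV F \<Longrightarrow> generic \<D> (pad s y)"
    "\<And>n y i. y \<in> Pi UNIV F \<Longrightarrow> i \<le> l n \<Longrightarrow> determined (padded s y n) i ((1 / 2) ^ n)"
    "\<And>n y y'. y \<in> Pi UNIV F \<Longrightarrow> y' \<in> Pi UNIV F \<Longrightarrow> stable (padded s y n) (padded s y' n) (l n) ((1 / 2) ^ n)"
proof -
  obtain E :: "nat \<Rightarrow> 'a list set" where E: "\<And>k. dense_open (E k)" "\<D> \<subseteq> range E"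
    using dense_open_family_enumeration[OF family] by blast
  define good where "good n W l \<longleftrightarrow> (\<forall>w\<in>W. w \<in> E n \<and> (\<forall>i\<le>l. determined w i ((1 / 2) ^ n)) \<and>
    (\<forall>w'\<in>W. stable w w' l ((1 / 2) ^ n)))" for n W l
  obtain s l where l: "strict_mono l" and good: "\<And>n. good n ((\<lambda>y. padded s y n) ` Pi UNIV F) (l n)"
  proof (rule fillers_exist[of F good, OF F])
    fix V :: "'a list set" and n L l\<^sub>0 :: nat
    assume "finite V" "\<And>v. v \<in> V \<Longrightarrow> length v = L"
    then obtain s l where "l\<^sub>0 < l" "\<And>v. v \<in> V \<Longrightarrow> v @ s \<in> E n"
      "\<And>v i. v \<in> V \<Longrightarrow> i \<le> l \<Longrightarrow> determined (v @ s) i ((1 / 2) ^ n)"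
      "\<And>v v'. v \<in> V \<Longrightarrow> v' \<in> V \<Longrightarrow> stable (v @ s) (v' @ s) l ((1 / 2) ^ n)"
      by (rule common_extension[of V L "(1 / 2) ^ n" "E n" l\<^sub>0]) (use E(1) in auto)
    then show "\<exists>s l. l\<^sub>0 < l \<and> good n ((\<lambda>v. v @ s) ` V) l"
      by (intro exI[of _ s] exI[of _ l]) (simp add: good_def)
  qed blast
  show ?thesis
  proof (rule that[OF l])
    fix y assume y: "y \<in> Pi UNIV F"
    have "prefix (pos s n) (pad s y) \<in> E n" for n
      using good[of n] y by (simp add: prefix_pad good_def)
    then show "generic \<D> (pad s y)"
      using E(2) unfolding generic_def by blast
  qed (use good in \<open>auto simp: good_def\<close>)
qed

end

lemma generic_mapI:
  fixes \<omega> :: "'a::ab_group_add \<Rightarrow> 'c::topological_space" and \<Phi> :: "'a word \<Rightarrow> nat \<Rightarrow> 'b::invariant_metric_group"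
  assumes "dense_open_family \<D>" "\<And>i. generically_continuous \<D> (\<lambda>x. \<Phi> x i)"
    and reduction: "\<And>x y. convergent (\<lambda>i. \<Phi> x i - \<Phi> y i) \<longleftrightarrow> convergent (\<lambda>k. \<omega> (\<Sum>i<k. x i - y i))"
  shows "generic_map \<D> \<Phi>"
proof
  fix w w' :: "'a list" and z
  assume "length w = length w'"
  then have "(\<Sum>i<k. (w \<frown> z) i - (w' \<frown> z) i) = (\<Sum>i<length w. (w \<frown> z) i - (w' \<frown> z) i)" if "k \<ge> length w" for k
    using that by (intro sum.mono_neutral_right) auto
  then have "(\<lambda>k. \<omega> (\<Sum>i<k. (w \<frown> z) i - (w' \<frown> z) i)) \<longlonglongrightarrow> \<omega> (\<Sum>i<length w. (w \<frown> z) i - (w' \<frown> z) i)"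
    by (intro tendsto_eventually eventually_sequentiallyI[of "length w"] arg_cong[where f = \<omega>])
  then show "convergent (\<lambda>i. \<Phi> (w \<frown> z) i - \<Phi> (w' \<frown> z) i)"
    unfolding reduction by (rule convergentI)
qed fact+

theorem block_reduction_exists:
  fixes \<omega> :: "'a::{ab_group_add, countable} \<Rightarrow> 'c::{invariant_metric_group, complete_space}"
    and \<Phi> :: "'a word \<Rightarrow> nat \<Rightarrow> 'b::{invariant_metric_group, complete_space}"
  assumes "Modules.additive \<omega>" "dense_open_family \<D>" "\<And>i. generically_continuous \<D> (\<lambda>x. \<Phi> x i)"
    and reduction: "\<And>x y. convergent (\<lambda>i. \<Phi> x i - \<Phi> y i) \<longleftrightarrow> convergent (\<lambda>k. \<omega> (\<Sum>i<k. x i - y i))"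
  obtains F l s where "block_reduction \<omega> F l (\<lambda>y. \<Phi> (pad s y))"
proof -
  interpret generic_map \<D> \<Phi>
    using assms(2,3) reduction by (rule generic_mapI)
  define F :: "nat \<Rightarrow> 'a set" where "F n = insert 0 (from_nat ` {..n})" for n
  have F: "finite (F n)" for n
    by (simp add: F_def)
  obtain s l where l: "strict_mono l" and generic: "\<And>y. y \<in> Pi UNIV F \<Longrightarrow> generic \<D> (pad s y)"
    and determined: "\<And>n y i. y \<in> Pi UNIV F \<Longrightarrow> i \<le> l n \<Longrightarrow> determined (padded s y n) i ((1 / 2) ^ n)"
    and stable: "\<And>n y y'. y \<in> Pi UNIV F \<Longrightarrow> y' \<in> Pi UNIV F \<Longrightarrow>
      stable (padded s y n) (padded s y' n) (l n) ((1 / 2) ^ n)"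
    by (rule block_fillers[OF F]) (rule that)
  have "block_reduction \<omega> F l (\<lambda>y. \<Phi> (pad s y))"
  proof (intro block_reduction.intro block_reduction_axioms.intro)
    have "t \<in> F (to_nat t)" for t
      by (auto simp: F_def intro!: image_eqI[of _ _ "to_nat t"])
    then show "(\<Union>n. F n) = UNIV"
      by blast
  next
    fix y y' n i
    assume y: "y \<in> Pi UNIV F" "y' \<in> Pi UNIV F" and eq: "\<And>m. m < n \<Longrightarrow> y m = y' m" and "i \<le> l n"
    have "padded s y' n = padded s y n"
      by (rule padded_cong) (simp add: eq)
    then show "dist (\<Phi> (pad s y) i) (\<Phi> (pad s y') i) \<le> (1 / 2) ^ n"
      using determined[OF y(1) \<open>i \<le> l n\<close>] generic[OF y(1)] generic[OF y(2)]
      unfolding determined_def by (metis pad_eq_conc)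
  next
    fix y y' n i i'
    assume y: "y \<in> Pi UNIV F" "y' \<in> Pi UNIV F" and eq: "\<And>m. n \<le> m \<Longrightarrow> y m = y' m" and "l n \<le> i" "l n \<le> i'"
    have "suffix (pos s n) (pad s y') = suffix (pos s n) (pad s y)"
      by (rule suffix_pad_cong) (simp add: eq)
    then show "dist (\<Phi> (pad s y) i - \<Phi> (pad s y') i) (\<Phi> (pad s y) i' - \<Phi> (pad s y') i') \<le> (1 / 2) ^ n"
      using stable[OF y] generic[OF y(1)] generic[OF y(2)] \<open>l n \<le> i\<close> \<open>l n \<le> i'\<close>
      unfolding stable_def by (metis pad_eq_conc)
  next
    fix y y' :: "'a word"
    show "convergent (\<lambda>i. \<Phi> (pad s y) i - \<Phi> (pad s y') i) \<longleftrightarrow> convergent (\<lambda>n. \<omega> (\<Sum>m<n. y m - y' m))"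
      unfolding reduction by (rule convergent_pad_sums_iff)
  qed (use l assms(1) in \<open>auto simp: F_def\<close>)
  then show ?thesis
    by (rule that)
qed

subsection \<open>Divisibility of partial products\<close>

text \<open>The supernatural number \<open>Q 0 \<cdot> Q 1 \<cdots>\<close> divides \<open>c \<cdot> P 0 \<cdot> P 1 \<cdots>\<close>.\<close>

definition prods_dvd :: "nat \<Rightarrow> (nat \<Rightarrow> nat) \<Rightarrow> (nat \<Rightarrow> nat) \<Rightarrow> bool" where
  "prods_dvd c Q P \<longleftrightarrow> (\<forall>j. \<exists>k. (\<Prod>i<j. Q i) dvd c * (\<Prod>i<k. P i))"

lemma prod_lessThan_split:
  fixes P :: "nat \<Rightarrow> 'a::comm_monoid_mult"
  assumes "l \<le> k"
  shows "(\<Prod>i<k. P i) = (\<Prod>i<l. P i) * (\<Prod>i=l..<k. P i)"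
  using prod.atLeastLessThan_concat[of 0 l k P] assms by (simp add: atLeast0LessThan)

lemma multiplicity_prod_primes:
  fixes P :: "'i \<Rightarrow> nat"
  assumes "finite A" "\<And>i. i \<in> A \<Longrightarrow> prime (P i)" "prime p"
  shows "multiplicity p (\<Prod>i\<in>A. P i) = card {i \<in> A. P i = p}"
proof -
  have "multiplicity p (\<Prod>i\<in>A. P i) = (\<Sum>i\<in>A. multiplicity p (P i))"
    using assms by (intro prime_elem_multiplicity_prod_distrib) (auto simp: image_iff dest: prime_gt_0_nat)
  also have "\<dots> = (\<Sum>i\<in>A. if P i = p then 1 else 0)"
    using assms by (intro sum.cong) (auto simp: prime_multiplicity_other)
  also have "\<dots> = card {i \<in> A. P i = p}"
    using assms(1) by (simp add: sum.If_cases Int_def)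
  finally show ?thesis .
qed

lemma prods_dvd_if_prime_seq_le:
  assumes Q_pos: "\<And>n. Q n > 0" and "Q \<preceq> P"
  obtains c where "c > 0" "prods_dvd c Q P"
proof -
  obtain A f where A: "finite (- A)" and f: "inj_on f A" "\<And>n. n \<in> A \<Longrightarrow> Q n = P (f n)"
    using assms(2) unfolding prime_seq_le_def by blast
  have "\<exists>k. (\<Prod>i<j. Q i) dvd (\<Prod>i\<in>-A. Q i) * (\<Prod>i<k. P i)" for j
  proof -
    obtain k where k: "f ` ({..<j} \<inter> A) \<subseteq> {..<k}"
      by (metis finite_Int finite_imageI finite_lessThan finite_nat_iff_bounded)
    have "(\<Prod>i<j. Q i) = (\<Prod>i\<in>{..<j} \<inter> -A. Q i) * (\<Prod>i\<in>{..<j} \<inter> A. Q i)"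
      by (subst prod.union_disjoint[symmetric]) (auto intro!: prod.cong)
    also have "(\<Prod>i\<in>{..<j} \<inter> A. Q i) = (\<Prod>i\<in>{..<j} \<inter> A. P (f i))"
      using f(2) by (intro prod.cong) auto
    also have "\<dots> = (\<Prod>i\<in>f ` ({..<j} \<inter> A). P i)"
      using f(1) by (subst prod.reindex) (auto intro: inj_on_subset)
    finally have "(\<Prod>i<j. Q i) = (\<Prod>i\<in>{..<j} \<inter> -A. Q i) * (\<Prod>i\<in>f ` ({..<j} \<inter> A). P i)" .
    also have "\<dots> dvd (\<Prod>i\<in>-A. Q i) * (\<Prod>i<k. P i)"
      using A k by (intro mult_dvd_mono prod_dvd_prod_subset) auto
    finally show ?thesis by blast
  qed
  moreover have "(\<Prod>i\<in>-A. Q i) > 0"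
    using Q_pos by (simp add: prod_pos)
  ultimately show ?thesis
    using that unfolding prods_dvd_def by blast
qed

lemma card_occurrences_le:
  assumes P_prime: "\<And>n. prime (P n)" and Q_prime: "\<And>n. prime (Q n)" and "c > 0" and dvd: "prods_dvd c Q P"
    and "prime p" and fin: "finite {n. P n = p}"
  shows "finite {n. Q n = p} \<and> card {n. Q n = p} \<le> multiplicity p c + card {n. P n = p}"
proof (rule finite_if_finite_subsets_card_bdd)
  fix G assume G: "G \<subseteq> {n. Q n = p}" "finite G"
  then obtain j where "G \<subseteq> {..<j}"
    using finite_nat_iff_bounded by blast
  obtain k where k: "(\<Prod>i<j. Q i) dvd c * (\<Prod>i<k. P i)"
    using dvd unfolding prods_dvd_def by blast
  have nonzero: "c \<noteq> 0" "(\<Prod>i<k. P i) \<noteq> 0"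
    using P_prime \<open>c > 0\<close> by (simp_all add: prime_gt_0_nat)
  have "card G \<le> card {i \<in> {..<j}. Q i = p}"
    using G \<open>G \<subseteq> {..<j}\<close> by (intro card_mono) auto
  also have "\<dots> = multiplicity p (\<Prod>i<j. Q i)"
    using Q_prime \<open>prime p\<close> by (simp add: multiplicity_prod_primes)
  also have "\<dots> \<le> multiplicity p (c * (\<Prod>i<k. P i))"
    using k nonzero by (intro dvd_imp_multiplicity_le) auto
  also have "\<dots> = multiplicity p c + card {i \<in> {..<k}. P i = p}"
    using \<open>prime p\<close> nonzero P_prime
    by (simp add: prime_elem_multiplicity_mult_distrib multiplicity_prod_primes)
  also have "\<dots> \<le> multiplicity p c + card {n. P n = p}"
    using fin by (intro add_left_mono card_mono) auto
  finally show "card G \<le> multiplicity p c + card {n. P n = p}" .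
qed

lemma inj_into_if_card_le:
  fixes D :: "'a::countable set"
  assumes "finite B \<Longrightarrow> finite D \<and> card D \<le> card B"
  shows "\<exists>f. inj_on f D \<and> f ` D \<subseteq> B"
proof (cases "finite B")
  case True
  with assms show ?thesis
    by (metis card_le_inj)
next
  case False
  then obtain f :: "nat \<Rightarrow> 'b" where "inj f" "range f \<subseteq> B"
    using infinite_countable_subset by blast
  then have "inj_on (f \<circ> to_nat) D" "(f \<circ> to_nat) ` D \<subseteq> B"
    by (auto intro!: comp_inj_on intro: inj_on_subset)
  then show ?thesis by blast
qed

lemma inj_matching_if_inj_on_fibres:
  assumes "\<And>a. a \<in> A \<Longrightarrow> \<exists>f. inj_on f {a' \<in> A. q a' = q a} \<and> f ` {a' \<in> A. q a' = q a} \<subseteq> {b. p b = q a}"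
  shows "\<exists>f. inj_on f A \<and> (\<forall>a\<in>A. q a = p (f a))"
proof -
  have "\<forall>v\<in>q ` A. \<exists>f. inj_on f {a' \<in> A. q a' = v} \<and> f ` {a' \<in> A. q a' = v} \<subseteq> {b. p b = v}"
    using assms by blast
  from bchoice[OF this] obtain f
    where f: "\<forall>v\<in>q ` A. inj_on (f v) {a' \<in> A. q a' = v} \<and> f v ` {a' \<in> A. q a' = v} \<subseteq> {b. p b = v}" ..
  then have match: "p (f (q a) a) = q a" if "a \<in> A" for a
    using that by blast
  have "inj_on (\<lambda>a. f (q a) a) A"
  proof (rule inj_onI)
    fix a a' assume a: "a \<in> A" "a' \<in> A" "f (q a) a = f (q a') a'"
    then have "q a = q a'"
      using match by metis
    then show "a = a'"
      using f a by (auto elim: inj_onD)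
  qed
  then show ?thesis
    using match by (intro exI[of _ "\<lambda>a. f (q a) a"]) simp
qed

lemma prime_seq_le_if_prods_dvd:
  assumes P_prime: "\<And>n. prime (P n)" and Q_prime: "\<And>n. prime (Q n)" and "c > 0" and dvd: "prods_dvd c Q P"
  shows "Q \<preceq> P"
proof -
  have bound: "finite {n. Q n = p} \<and> card {n. Q n = p} \<le> multiplicity p c + card {n. P n = p}"
    if "prime p" "finite {n. P n = p}" for p
    using P_prime Q_prime \<open>c > 0\<close> dvd that by (rule card_occurrences_le)
  define A where "A = {n. infinite {m. P m = Q n} \<or> \<not> Q n dvd c}"
  have "- A \<subseteq> (\<Union>p\<in>{p. p dvd c \<and> prime p \<and> finite {n. P n = p}}. {n. Q n = p})"
    using Q_prime by (auto simp: A_def)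
  moreover have "finite {p. p dvd c \<and> prime p \<and> finite {n. P n = p}}"
    by (rule finite_subset[OF _ finite_divisors_nat[OF \<open>c > 0\<close>]]) auto
  then have "finite (\<Union>p\<in>{p. p dvd c \<and> prime p \<and> finite {n. P n = p}}. {n. Q n = p})"
    using bound by blast
  ultimately have "finite (- A)"
    by (rule finite_subset)
  moreover have "\<exists>f. inj_on f A \<and> (\<forall>n\<in>A. Q n = P (f n))"
  proof (intro inj_matching_if_inj_on_fibres inj_into_if_card_le)
    fix n assume "n \<in> A" and fin: "finite {m. P m = Q n}"
    then have "multiplicity (Q n) c = 0"
      by (simp add: A_def not_dvd_imp_multiplicity_0)
    then have "finite {m. Q m = Q n}" "card {m. Q m = Q n} \<le> card {m. P m = Q n}"
      using bound[OF Q_prime fin] by auto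
    then show "finite {m \<in> A. Q m = Q n} \<and> card {m \<in> A. Q m = Q n} \<le> card {m. P m = Q n}"
      by (auto intro: order_trans[OF card_mono])
  qed
  ultimately show ?thesis
    unfolding prime_seq_le_def by blast
qed

subsection \<open>Solenoids and their one-parameter subgroups\<close>

lemma solenoid_norm: "g \<in> carrier (solenoid P) \<Longrightarrow> norm (g l) = 1"
  by (simp add: mem_solenoid_iff)

lemma solenoid_nonzero: "g \<in> carrier (solenoid P) \<Longrightarrow> g l \<noteq> 0"
  using solenoid_norm[of g P l] by auto

lemma solenoid_divide:
  "g \<in> carrier (solenoid P) \<Longrightarrow> h \<in> carrier (solenoid P) \<Longrightarrow> (\<lambda>l. g l / h l) \<in> carrier (solenoid P)"
  by (simp add: mem_solenoid_iff norm_divide power_divide)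

lemma inv_solenoid:
  assumes "g \<in> carrier (solenoid P)"
  shows "inv\<^bsub>solenoid P\<^esub> g = (\<lambda>l. inverse (g l))"
proof -
  interpret comm_group "solenoid P" by (rule comm_group_solenoid)
  have "(\<lambda>l. inverse (g l)) \<in> carrier (solenoid P)"
    using assms by (simp add: mem_solenoid_iff norm_inverse power_inverse)
  moreover have "(\<lambda>l. inverse (g l)) \<otimes>\<^bsub>solenoid P\<^esub> g = \<one>\<^bsub>solenoid P\<^esub>"
    using solenoid_nonzero[OF assms] by (simp add: mult_solenoid one_solenoid)
  ultimately show ?thesis
    using assms inv_equality by blast
qed

lemma solenoid_hom_divide:
  assumes h: "h \<in> hom (solenoid P) (solenoid Q)" and g: "g \<in> carrier (solenoid P)" "g' \<in> carrier (solenoid P)"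
  shows "h (\<lambda>l. g l / g' l) j = h g j / h g' j"
proof -
  have "(\<lambda>l. g l / g' l) \<otimes>\<^bsub>solenoid P\<^esub> g' = g"
    using solenoid_nonzero[OF g(2)] by (simp add: mult_solenoid)
  then have "h (\<lambda>l. g l / g' l) j * h g' j = h g j"
    using hom_mult[OF h solenoid_divide[OF g] g(2)] by (simp add: mult_solenoid fun_eq_iff)
  moreover have "h g' j \<noteq> 0"
    using solenoid_nonzero[OF hom_in_carrier[OF h g(2)]] .
  ultimately show ?thesis
    by (simp add: field_simps)
qed

lemma closed_solenoid: "closed (carrier (solenoid P))"
proof -
  have "closed {g :: nat \<Rightarrow> complex. norm (g l) = 1}" "closed {g :: nat \<Rightarrow> complex. g (Suc l) ^ P l = g l}" for l
    by (intro closed_Collect_eq continuous_intros continuous_on_product_coordinates)+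
  then have "closed ((\<Inter>l. {g :: nat \<Rightarrow> complex. norm (g l) = 1}) \<inter> (\<Inter>l. {g. g (Suc l) ^ P l = g l}))"
    by (intro closed_Int closed_INT ballI)
  also have "(\<Inter>l. {g :: nat \<Rightarrow> complex. norm (g l) = 1}) \<inter> (\<Inter>l. {g. g (Suc l) ^ P l = g l})
      = carrier (solenoid P)"
    by (auto simp: mem_solenoid_iff)
  finally show ?thesis .
qed

lemma coset_rel_solenoid_iff:
  assumes "x \<in> seqs (solenoid P)" "y \<in> seqs (solenoid P)"
  shows "(x, y) \<in> coset_rel (solenoid P) \<longleftrightarrow> convergent (\<lambda>n l. x n l / y n l)"
proof -
  have "x n \<otimes>\<^bsub>solenoid P\<^esub> inv\<^bsub>solenoid P\<^esub> y n = (\<lambda>l. x n l / y n l)" for n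
    using assms by (simp add: seqs_def mult_solenoid inv_solenoid divide_inverse)
  moreover have "L \<in> carrier (solenoid P)" if "(\<lambda>n l. x n l / y n l) \<longlonglongrightarrow> L" for L
    using closed_solenoid _ that
    by (rule closed_sequentially) (use assms in \<open>auto simp: seqs_def solenoid_divide\<close>)
  ultimately show ?thesis
    using assms unfolding coset_rel_def convergent_def by auto
qed

lemma solenoid_power_prod:
  assumes "g \<in> carrier (solenoid P)" and "l \<le> k"
  shows "g k ^ (\<Prod>i=l..<k. P i) = g l"
  using assms(2)
proof (induction k rule: dec_induct)
  case (step k)
  have "g (Suc k) ^ (\<Prod>i=l..<Suc k. P i) = (g (Suc k) ^ P k) ^ (\<Prod>i=l..<k. P i)"
    using step by (simp add: power_mult[symmetric] mult.commute)
  then show ?case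
    using step assms(1) by (simp add: mem_solenoid_iff)
qed simp

definition one_param :: "(nat \<Rightarrow> nat) \<Rightarrow> real \<Rightarrow> nat \<Rightarrow> complex" where
  "one_param P t l = cis (2 * pi * t / real (\<Prod>i<l. P i))"

lemma one_param_add: "one_param P (s + t) l = one_param P s l * one_param P t l"
  by (simp add: one_param_def cis_mult add_divide_distrib distrib_left)

lemma one_param_diff: "one_param P (s - t) l = one_param P s l / one_param P t l"
  by (simp add: one_param_def cis_divide diff_divide_distrib right_diff_distrib)

lemma one_param_0 [simp]: "one_param P 0 = (\<lambda>_. 1)"
  by (simp add: one_param_def fun_eq_iff)

lemma norm_one_param [simp]: "norm (one_param P t l) = 1"
  by (simp add: one_param_def)

lemma one_param_in_solenoid:
  assumes "\<And>n. P n > 0"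
  shows "one_param P t \<in> carrier (solenoid P)"
proof -
  have "real (P l) * (2 * pi * t / real (\<Prod>i<Suc l. P i)) = 2 * pi * t / real (\<Prod>i<l. P i)" for l
    using assms[of l] by simp
  then have "one_param P t (Suc l) ^ P l = one_param P t l" for l
    by (simp only: one_param_def Complex.DeMoivre)
  then show ?thesis
    by (simp add: mem_solenoid_iff)
qed

lemma continuous_on_one_param: "continuous_on A f \<Longrightarrow> continuous_on A (\<lambda>x. one_param P (f x))"
  unfolding one_param_def divide_inverse
  by (intro continuous_on_coordinatewise_then_product continuous_intros)

lemma one_param_tendsto: "(f \<longlongrightarrow> t) F \<Longrightarrow> ((\<lambda>x. one_param P (f x)) \<longlongrightarrow> one_param P t) F"
  by (rule continuous_on_tendsto_compose[OF continuous_on_one_param[OF continuous_on_id[of UNIV]]]) auto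

lemma one_param_period:
  assumes "\<And>n. P n > 0" and "l \<le> k"
  shows "one_param P (of_int a * real (\<Prod>i<k. P i)) l = 1"
proof -
  have "2 * pi * (of_int a * real (A * B)) / real A = 2 * pi * of_int (a * int B)" if "A > 0" for A B
    using that by simp
  moreover have "(\<Prod>i<l. P i) > 0"
    using assms(1) by (simp add: prod_pos)
  ultimately have "2 * pi * (of_int a * real (\<Prod>i<k. P i)) / real (\<Prod>i<l. P i)
      = 2 * pi * of_int (a * int (\<Prod>i=l..<k. P i))"
    unfolding prod_lessThan_split[OF assms(2)] by blast
  then show ?thesis
    unfolding one_param_def by (metis cis_multiple_2pi Ints_of_int)
qed

lemma solenoid_eq_one_param_upto:
  assumes P_pos: "\<And>n. P n > 0" and g: "g \<in> carrier (solenoid P)"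
  obtains t where "\<And>l. l \<le> n \<Longrightarrow> one_param P t l = g l"
proof -
  obtain b where b: "g n = cis b"
    using rcis_cmod_Arg[of "g n"] solenoid_norm[OF g, of n] by (metis rcis_def mult_1 of_real_1)
  define t where "t = b * real (\<Prod>i<n. P i) / (2 * pi)"
  have "real (\<Prod>i<n. P i) > 0"
    using P_pos by (simp add: prod_pos)
  then have "2 * pi * t / real (\<Prod>i<n. P i) = b"
    unfolding t_def by (simp only: field_simps) simp
  then have "one_param P t n = g n"
    by (simp only: one_param_def b)
  then have "one_param P t l = g l" if "l \<le> n" for l
    using solenoid_power_prod[OF one_param_in_solenoid that] solenoid_power_prod[OF g that] P_pos by metis
  then show ?thesis
    by (rule that)
qed

lemma solenoid_subset_closure_one_param:
  assumes "\<And>n. P n > 0"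
  shows "carrier (solenoid P) \<subseteq> closure (one_param P ` \<rat>)"
proof -
  have range: "range (one_param P) \<subseteq> closure (one_param P ` \<rat>)"
    using image_closure_subset[of \<rat> "one_param P", OF _ closed_closure closure_subset]
    by (simp add: Rats_closure_real continuous_on_one_param)
  have "carrier (solenoid P) \<subseteq> closure (range (one_param P))"
  proof
    fix g assume g: "g \<in> carrier (solenoid P)"
    have "\<exists>t. \<forall>l\<le>n. one_param P t l = g l" for n
      using solenoid_eq_one_param_upto[OF assms g] by metis
    then obtain t where "\<And>n l. l \<le> n \<Longrightarrow> one_param P (t n) l = g l"
      by metis
    then have "(\<lambda>n. one_param P (t n) l) \<longlonglongrightarrow> g l" for l
      by (intro tendsto_eventually eventually_sequentiallyI[of l])
    then have "(\<lambda>n. one_param P (t n)) \<longlonglongrightarrow> g"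
      by (simp add: tendsto_fun_iff)
    then show "g \<in> closure (range (one_param P))"
      unfolding closure_sequential by (intro exI[of _ "\<lambda>n. one_param P (t n)"]) simp
  qed
  then show ?thesis
    using closure_minimal[OF range closed_closure] by (rule order_trans)
qed

lemma cis_tendsto_1_iff:
  assumes "\<And>x. \<bar>f x\<bar> \<le> 1 / 4"
  shows "((\<lambda>x. cis (2 * pi * f x)) \<longlongrightarrow> 1) F \<longleftrightarrow> (f \<longlongrightarrow> 0) F"
proof
  assume "((\<lambda>x. cis (2 * pi * f x)) \<longlongrightarrow> 1) F"
  moreover have "isCont Arg 1"
    by (intro continuous_at_Arg) simp
  ultimately have "((\<lambda>x. Arg (cis (2 * pi * f x))) \<longlongrightarrow> Arg 1) F"
    by (rule isCont_tendsto_compose[rotated])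
  moreover have "Arg (cis (2 * pi * f x)) = 2 * pi * f x" for x
  proof (rule Arg_cis)
    have "\<bar>2 * pi * f x\<bar> \<le> 2 * pi * (1 / 4)"
      using assms[of x] by (simp add: abs_mult)
    then have "- pi < 2 * pi * f x" "2 * pi * f x \<le> pi"
      using pi_gt_zero by linarith+
    then show "2 * pi * f x \<in> {-pi<..pi}"
      by simp
  qed
  ultimately have "((\<lambda>x. 2 * pi * f x) \<longlongrightarrow> 0) F"
    by simp
  then show "(f \<longlongrightarrow> 0) F"
    using tendsto_mult_left_iff[of "2 * pi" f 0 F] by simp
next
  assume "(f \<longlongrightarrow> 0) F"
  then have "((\<lambda>x. cis (2 * pi * f x)) \<longlongrightarrow> cis (2 * pi * 0)) F"
    by (intro tendsto_cis tendsto_mult_left)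
  then show "((\<lambda>x. cis (2 * pi * f x)) \<longlongrightarrow> 1) F"
    by simp
qed

subsection \<open>From divisibility to homomorphisms\<close>

lemma prods_dvd_exponents:
  assumes Q_pos: "\<And>n. Q n > 0" and dvd: "prods_dvd c Q P"
  obtains k e where "k 0 = 0" "e 0 = c" "\<And>j. k j \<le> k (Suc j)"
    "\<And>j. e (Suc j) * Q j = (\<Prod>i=k j..<k (Suc j). P i) * e j"
proof -
  define k where "k j = (LEAST k. (\<Prod>i<j. Q i) dvd c * (\<Prod>i<k. P i))" for j
  define e where "e j = c * (\<Prod>i<k j. P i) div (\<Prod>i<j. Q i)" for j
  have k: "(\<Prod>i<j. Q i) dvd c * (\<Prod>i<k j. P i)" for j
    unfolding k_def by (rule LeastI_ex) (use dvd in \<open>simp add: prods_dvd_def\<close>)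
  have e: "e j * (\<Prod>i<j. Q i) = c * (\<Prod>i<k j. P i)" for j
    unfolding e_def using k by simp
  have k_mono: "k j \<le> k (Suc j)" for j
    unfolding k_def[of j] using k[of "Suc j"] by (intro Least_le) (simp add: dvd_mult_left)
  have "e (Suc j) * Q j = (\<Prod>i=k j..<k (Suc j). P i) * e j" for j
  proof -
    have "(e (Suc j) * Q j) * (\<Prod>i<j. Q i) = ((\<Prod>i=k j..<k (Suc j). P i) * e j) * (\<Prod>i<j. Q i)"
      using e[of "Suc j"] e[of j] prod_lessThan_split[OF k_mono[of j], of P] by (simp add: ac_simps)
    moreover have "(\<Prod>i<j. Q i) > 0"
      using Q_pos by (simp add: prod_pos)
    ultimately show ?thesis
      using mult_cancel2 by (metis less_irrefl)
  qed
  moreover have "k 0 = 0"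
    unfolding k_def by (rule Least_eq_0) simp
  moreover from this have "e 0 = c"
    by (simp add: e_def)
  ultimately show ?thesis
    using that k_mono by blast
qed

lemma solenoid_hom_if_prods_dvd:
  assumes "\<And>n. Q n > 0" and "prods_dvd c Q P"
  obtains h where "h \<in> hom (solenoid P) (solenoid Q)" "continuous_on (carrier (solenoid P)) h"
    "\<And>g. h g 0 = g 0 ^ c"
proof -
  obtain k e where k: "k 0 = 0" "\<And>j. k j \<le> k (Suc j)"
    and e: "e 0 = c" "\<And>j. e (Suc j) * Q j = (\<Prod>i=k j..<k (Suc j). P i) * e j"
    by (rule prods_dvd_exponents[OF assms]) (rule that)
  define h :: "(nat \<Rightarrow> complex) \<Rightarrow> nat \<Rightarrow> complex" where "h g j = g (k j) ^ e j" for g j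
  have "h g \<in> carrier (solenoid Q)" if g: "g \<in> carrier (solenoid P)" for g
  proof -
    have "h g (Suc j) ^ Q j = h g j" for j
      unfolding h_def power_mult[symmetric] e
      unfolding power_mult solenoid_power_prod[OF g k(2)] ..
    then show ?thesis
      using g by (simp add: mem_solenoid_iff h_def norm_power)
  qed
  then have "h \<in> hom (solenoid P) (solenoid Q)"
    by (auto intro!: homI simp: mult_solenoid h_def fun_eq_iff power_mult_distrib)
  moreover have "continuous_on (carrier (solenoid P)) h"
    unfolding h_def
    by (intro continuous_on_coordinatewise_then_product continuous_on_power
        continuous_on_subset[OF continuous_on_product_coordinates]) simp
  ultimately show ?thesis
    using that[of h] by (simp add: h_def k e)
qed

lemma nontrivial_if_power_at_0:
  assumes "\<And>n. P n > 0" and "c > 0" and h: "\<And>g. h g 0 = g 0 ^ c"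
  shows "\<exists>g\<in>carrier (solenoid P). h g \<noteq> \<one>\<^bsub>solenoid Q\<^esub>"
proof (rule bexI)
  show "one_param P (1 / (2 * real c)) \<in> carrier (solenoid P)"
    using assms(1) by (rule one_param_in_solenoid)
  have "h (one_param P (1 / (2 * real c))) 0 = - 1"
    using \<open>c > 0\<close> by (simp add: h one_param_def Complex.DeMoivre)
  then show "h (one_param P (1 / (2 * real c))) \<noteq> \<one>\<^bsub>solenoid Q\<^esub>"
    by (auto simp: one_solenoid)
qed

subsection \<open>From homomorphisms to reductions\<close>

lemma convergent_if_power_convergent_slowly_varying:
  fixes z :: "nat \<Rightarrow> complex"
  assumes unit: "\<And>n. norm (z n) = 1" and "M > 0" and power: "convergent (\<lambda>n. z n ^ M)"
    and slow: "(\<lambda>n. z (Suc n) / z n) \<longlonglongrightarrow> 1"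
  shows "convergent z"
proof -
  obtain w where w: "(\<lambda>n. z n ^ M) \<longlonglongrightarrow> w"
    using power unfolding convergent_def by blast
  show ?thesis
  proof (rule convergent_if_slowly_varying[of "sphere 0 1" z "{v. v ^ M = w}"])
    show "uniform_discrete {v. v ^ M = w}"
      using finite_nth_roots[OF \<open>M > 0\<close>] uniform_discrete_finite_iff by blast
    show "L \<in> {v. v ^ M = w}" if "strict_mono r" "(\<lambda>n. z (r n)) \<longlonglongrightarrow> L" for r L
    proof -
      have "(\<lambda>n. z (r n) ^ M) \<longlonglongrightarrow> w"
        using LIMSEQ_subseq_LIMSEQ[OF w that(1)] by (simp add: o_def)
      then show ?thesis
        using tendsto_power[OF that(2), of M] LIMSEQ_unique by blast
    qed
    have "dist (z (Suc n)) (z n) = norm (z (Suc n) / z n - 1)" for n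
    proof -
      have "z (Suc n) - z n = (z (Suc n) / z n - 1) * z n"
        using unit[of n] by (auto simp: field_simps)
      then show ?thesis
        using unit[of n] by (simp add: dist_norm norm_mult)
    qed
    then show "(\<lambda>n. dist (z (Suc n)) (z n)) \<longlonglongrightarrow> 0"
      using slow by (simp add: LIM_zero tendsto_norm_zero)
  qed (use unit in auto)
qed

lemma solenoid_convergent_iff:
  assumes P_pos: "\<And>n. P n > 0" and "c > 0" and u: "\<And>n. u n \<in> carrier (solenoid P)"
  shows "convergent u \<longleftrightarrow> convergent (\<lambda>n. u n 0 ^ c) \<and> (\<forall>l. (\<lambda>n. u (Suc n) l / u n l) \<longlonglongrightarrow> 1)"
proof (intro iffI conjI allI)
  assume "convergent u"
  then obtain L where L: "u \<longlonglongrightarrow> L"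
    unfolding convergent_def by blast
  then have lim: "(\<lambda>n. u n l) \<longlonglongrightarrow> L l" for l
    by (simp add: tendsto_fun_iff)
  show "convergent (\<lambda>n. u n 0 ^ c)"
    using tendsto_power[OF lim] by (rule convergentI)
  have "L \<in> carrier (solenoid P)"
    using closed_solenoid u L by (rule closed_sequentially)
  then have nonzero: "L l \<noteq> 0" for l
    by (rule solenoid_nonzero)
  show "(\<lambda>n. u (Suc n) l / u n l) \<longlonglongrightarrow> 1" for l
    using tendsto_divide[OF LIMSEQ_Suc[OF lim] lim nonzero, of l l] nonzero[of l] by simp
next
  assume u_lim: "convergent (\<lambda>n. u n 0 ^ c) \<and> (\<forall>l. (\<lambda>n. u (Suc n) l / u n l) \<longlonglongrightarrow> 1)"
  have "convergent (\<lambda>n. u n l)" for l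
  proof (rule convergent_if_power_convergent_slowly_varying)
    have "u n l ^ ((\<Prod>i<l. P i) * c) = u n 0 ^ c" for n
      using solenoid_power_prod[OF u, of 0 l n] by (simp add: power_mult atLeast0LessThan)
    then show "convergent (\<lambda>n. u n l ^ ((\<Prod>i<l. P i) * c))"
      using u_lim by simp
    show "(\<Prod>i<l. P i) * c > 0"
      using P_pos \<open>c > 0\<close> by (simp add: prod_pos)
  qed (use u u_lim solenoid_norm in auto)
  then show "convergent u"
    unfolding convergent_fun_iff by blast
qed

lemma seqs_solenoid_norm: "x \<in> seqs (solenoid P) \<Longrightarrow> norm (x n l) = 1"
  by (auto simp: seqs_def intro: solenoid_norm)

lemma seqs_solenoid_nonzero: "x \<in> seqs (solenoid P) \<Longrightarrow> x n l \<noteq> 0"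
  by (auto simp: seqs_def dest: solenoid_nonzero)

text \<open>
  The weights \<open>2 ^ l\<close> make \<open>jump x - jump y\<close> tend to zero as soon as each coordinate of the
  quotients of consecutive terms does; the factor \<open>8\<close> keeps all differences of jumps so small that
  they can be recovered from their images in the circle.
\<close>

definition jump :: "(nat \<Rightarrow> nat \<Rightarrow> complex) \<Rightarrow> nat \<Rightarrow> complex" where
  "jump x m = (case prod_decode m of (n, l) \<Rightarrow> x (Suc n) l / x n l / (8 * 2 ^ l))"

lemma norm_jump_le:
  assumes "x \<in> seqs (solenoid P)"
  shows "norm (jump x m) \<le> 1 / 8"
proof -
  obtain n l where "prod_decode m = (n, l)"
    by fastforce
  then have "norm (jump x m) = 1 / (8 * 2 ^ l)"
    using assms by (simp add: jump_def norm_divide norm_mult norm_power seqs_solenoid_norm)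
  also have "\<dots> \<le> 1 / 8"
    by (simp add: field_simps)
  finally show ?thesis .
qed

lemma jump_diff_tendsto_0_iff:
  assumes x: "x \<in> seqs (solenoid P)" and y: "y \<in> seqs (solenoid P)"
  shows "(\<lambda>m. jump x m - jump y m) \<longlonglongrightarrow> 0 \<longleftrightarrow>
    (\<forall>l. (\<lambda>n. (x (Suc n) l / y (Suc n) l) / (x n l / y n l)) \<longlonglongrightarrow> 1)"
proof -
  define a where "a n l = (x (Suc n) l / x n l - y (Suc n) l / y n l) / (8 * 2 ^ l)" for n l
  define q where "q n l = (x (Suc n) l / y (Suc n) l) / (x n l / y n l)" for n l
  have unit: "norm (x n l) = 1" "norm (y n l) = 1" for n l
    using x y by (auto simp: seqs_solenoid_norm)
  have nonzero: "x n l \<noteq> 0" "y n l \<noteq> 0" for n l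
    using x y by (auto dest: seqs_solenoid_nonzero)
  have "x (Suc n) l / x n l - y (Suc n) l / y n l = (y (Suc n) l / y n l) * (q n l - 1)" for n l
    using nonzero by (simp add: q_def field_simps)
  then have norm_a: "norm (a n l) = norm (q n l - 1) / (8 * 2 ^ l)" for n l
    using unit by (simp add: a_def norm_mult norm_divide norm_power)
  have "norm (q n l) = 1" for n l
    by (simp add: q_def norm_divide norm_mult unit)
  then have "norm (q n l - 1) \<le> 2" for n l
    using norm_triangle_ineq4[of "q n l" 1] by simp
  then have bound: "norm (a n l) \<le> 1 / 4 * (1 / 2) ^ l" for n l
    unfolding norm_a by (simp add: divide_right_mono field_simps)
  have "jump x m - jump y m = (case prod_decode m of (n, l) \<Rightarrow> a n l)" for m
    by (simp add: jump_def a_def diff_divide_distrib split: prod.split)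
  then have "(\<lambda>m. jump x m - jump y m) \<longlonglongrightarrow> 0 \<longleftrightarrow> (\<forall>l. (\<lambda>n. a n l) \<longlonglongrightarrow> 0)"
    by (simp only: tendsto_prod_decode_iff[of a, OF bound half_power_tendsto_0])
  moreover have "(\<lambda>n. a n l) \<longlonglongrightarrow> 0 \<longleftrightarrow> (\<lambda>n. q n l) \<longlonglongrightarrow> 1" for l
  proof -
    have "(\<lambda>n. a n l) \<longlonglongrightarrow> 0 \<longleftrightarrow> (\<lambda>n. norm (a n l)) \<longlonglongrightarrow> 0"
      by (rule tendsto_norm_zero_iff[symmetric])
    also have "(\<lambda>n. norm (a n l)) = (\<lambda>n. 1 / (8 * 2 ^ l) * norm (q n l - 1))"
      by (simp add: norm_a)
    also have "\<dots> \<longlonglongrightarrow> 0 \<longleftrightarrow> (\<lambda>n. norm (q n l - 1)) \<longlonglongrightarrow> 0"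
      using tendsto_mult_left_iff[of "1 / (8 * 2 ^ l)" _ 0] by simp
    also have "\<dots> \<longleftrightarrow> (\<lambda>n. q n l) \<longlonglongrightarrow> 1"
      unfolding tendsto_norm_zero_iff by (rule LIM_zero_iff)
    finally show ?thesis .
  qed
  ultimately show ?thesis
    by (simp only: q_def)
qed

lemma continuous_on_jump: "continuous_on (seqs (solenoid P)) (\<lambda>x. jump x m)"
proof -
  have "continuous_on A (\<lambda>x :: nat \<Rightarrow> nat \<Rightarrow> complex. x n l)" for A n l
    using continuous_on_product_then_coordinatewise[OF continuous_on_product_coordinates]
    by (rule continuous_on_subset) simp
  then show ?thesis
    unfolding jump_def case_prod_unfold
    by (intro continuous_on_divide continuous_on_const) (auto dest: seqs_solenoid_nonzero)
qed

lemma convergent_interleaved_iff: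
  fixes a :: "nat \<Rightarrow> complex"
  assumes "k > 0" and unit: "\<And>n. norm (a n) = 1" and one: "\<And>n. b 0 n = 1"
  shows "convergent (\<lambda>n. a (n div k) * b (n mod k) (n div k)) \<longleftrightarrow> convergent a \<and> (\<forall>i<k. b i \<longlonglongrightarrow> 1)"
proof -
  have interleaved: "(\<lambda>n. a (n div k) * b (n mod k) (n div k)) \<longlonglongrightarrow> L \<longleftrightarrow> (\<forall>i<k. (\<lambda>n. a n * b i n) \<longlonglongrightarrow> L)" for L
    using tendsto_mod_div_iff[OF \<open>k > 0\<close>, of "\<lambda>i n. a n * b i n"] .
  have "(\<forall>i<k. (\<lambda>n. a n * b i n) \<longlonglongrightarrow> L) \<longleftrightarrow> a \<longlonglongrightarrow> L \<and> (\<forall>i<k. b i \<longlonglongrightarrow> 1)" for L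
  proof
    assume lim: "\<forall>i<k. (\<lambda>n. a n * b i n) \<longlonglongrightarrow> L"
    from lim[rule_format, OF \<open>k > 0\<close>] have a: "a \<longlonglongrightarrow> L"
      by (simp add: one)
    then have "norm L = 1"
      using tendsto_norm[OF a] by (simp add: unit LIMSEQ_const_iff)
    then have "L \<noteq> 0" by auto
    have "a n \<noteq> 0" for n
      using unit[of n] by auto
    then have "b i \<longlonglongrightarrow> 1" if "i < k" for i
      using tendsto_divide[OF lim[rule_format, OF that] a \<open>L \<noteq> 0\<close>] \<open>L \<noteq> 0\<close> by simp
    with a show "a \<longlonglongrightarrow> L \<and> (\<forall>i<k. b i \<longlonglongrightarrow> 1)" by blast
  next
    assume "a \<longlonglongrightarrow> L \<and> (\<forall>i<k. b i \<longlonglongrightarrow> 1)"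
    then show "\<forall>i<k. (\<lambda>n. a n * b i n) \<longlonglongrightarrow> L"
      using tendsto_mult[of a L sequentially "b _" 1] by simp
  qed
  then show ?thesis
    unfolding convergent_def interleaved by blast
qed

definition jump_part :: "nat \<Rightarrow> complex \<Rightarrow> real" where
  "jump_part i z = (if i = 0 then 0 else if i = 1 then Re z else Im z)"

definition reduction_map ::
  "(nat \<Rightarrow> nat) \<Rightarrow> ((nat \<Rightarrow> complex) \<Rightarrow> nat \<Rightarrow> complex) \<Rightarrow> (nat \<Rightarrow> nat \<Rightarrow> complex) \<Rightarrow> nat \<Rightarrow> nat \<Rightarrow> complex" where
  "reduction_map Q h x n j = h (x (n div 3)) j * one_param Q (jump_part (n mod 3) (jump x (n div 3))) j"

lemma reduction_map_in_seqs:
  assumes Q_pos: "\<And>n. Q n > 0" and h: "h \<in> hom (solenoid P) (solenoid Q)" and x: "x \<in> seqs (solenoid P)"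
  shows "reduction_map Q h x \<in> seqs (solenoid Q)"
proof -
  interpret comm_group "solenoid Q" by (rule comm_group_solenoid)
  have "reduction_map Q h x n
      = h (x (n div 3)) \<otimes>\<^bsub>solenoid Q\<^esub> one_param Q (jump_part (n mod 3) (jump x (n div 3)))" for n
    by (simp add: reduction_map_def mult_solenoid fun_eq_iff)
  moreover have "h (x m) \<in> carrier (solenoid Q)" for m
    using x by (intro hom_in_carrier[OF h]) (simp add: seqs_def)
  ultimately show ?thesis
    using one_param_in_solenoid[of Q, OF Q_pos] by (simp add: seqs_def)
qed

lemma continuous_on_reduction_map:
  assumes "continuous_on (carrier (solenoid P)) h"
  shows "continuous_on (seqs (solenoid P)) (reduction_map Q h)"
proof -
  have "continuous_on (seqs (solenoid P)) (\<lambda>x. h (x n))" for n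
    using assms
    by (rule continuous_on_compose2[OF _ continuous_on_subset[OF continuous_on_product_coordinates]]) (auto simp: seqs_def)
  then have h_coord: "continuous_on (seqs (solenoid P)) (\<lambda>x. h (x n) j)" for n j
    by (rule continuous_on_product_then_coordinatewise)
  have "continuous_on (seqs (solenoid P)) (\<lambda>x. jump_part i (jump x n))" for i n
    by (cases "i = 0"; cases "i = 1") (auto simp: jump_part_def intro!: continuous_on_Re continuous_on_Im continuous_on_jump)
  from continuous_on_product_then_coordinatewise[OF continuous_on_one_param[OF this]] h_coord
  show ?thesis
    unfolding reduction_map_def[abs_def]
    by (intro continuous_on_coordinatewise_then_product continuous_on_mult)
qed

lemma one_param_jump_parts_tendsto_1_iff:
  assumes small: "\<And>n. norm (d n) \<le> 1 / 4"
  shows "(\<forall>j. \<forall>i<3. (\<lambda>n. one_param Q (jump_part i (d n)) j) \<longlonglongrightarrow> 1) \<longleftrightarrow> d \<longlonglongrightarrow> 0"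
proof -
  have parts: "d \<longlonglongrightarrow> 0 \<longleftrightarrow> (\<forall>i<3. (\<lambda>n. jump_part i (d n)) \<longlonglongrightarrow> 0)"
    by (simp add: tendsto_complex_iff jump_part_def numeral_3_eq_3 less_Suc_eq all_conj_distrib)
  have "\<bar>jump_part i (d n)\<bar> \<le> 1 / 4" for i n
    using abs_Re_le_cmod[of "d n"] abs_Im_le_cmod[of "d n"] small[of n] by (simp add: jump_part_def)
  then have cis_iff: "(\<lambda>n. cis (2 * pi * jump_part i (d n))) \<longlonglongrightarrow> 1 \<longleftrightarrow> (\<lambda>n. jump_part i (d n)) \<longlonglongrightarrow> 0" for i
    by (rule cis_tendsto_1_iff)
  show ?thesis
    unfolding parts
  proof (intro iffI allI impI)
    fix i :: nat assume "\<forall>j. \<forall>i<3. (\<lambda>n. one_param Q (jump_part i (d n)) j) \<longlonglongrightarrow> 1" "i < 3"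
    then have "(\<lambda>n. one_param Q (jump_part i (d n)) 0) \<longlonglongrightarrow> 1"
      by blast
    then show "(\<lambda>n. jump_part i (d n)) \<longlonglongrightarrow> 0"
      by (simp add: one_param_def cis_iff)
  next
    fix i j :: nat assume "\<forall>i<3. (\<lambda>n. jump_part i (d n)) \<longlonglongrightarrow> 0" "i < 3"
    then have "(\<lambda>n. one_param Q (jump_part i (d n))) \<longlonglongrightarrow> one_param Q 0"
      by (intro one_param_tendsto) blast
    then show "(\<lambda>n. one_param Q (jump_part i (d n)) j) \<longlonglongrightarrow> 1"
      by (simp add: tendsto_fun_iff)
  qed
qed

lemma convergent_iff_image_and_jump:
  assumes P_pos: "\<And>n. P n > 0" and "c > 0"
    and h: "continuous_on (carrier (solenoid P)) h" "\<And>g. h g 0 = g 0 ^ c"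
    and x: "x \<in> seqs (solenoid P)" and y: "y \<in> seqs (solenoid P)"
  shows "convergent (\<lambda>n l. x n l / y n l) \<longleftrightarrow>
    convergent (\<lambda>n. h (\<lambda>l. x n l / y n l)) \<and> (\<lambda>m. jump x m - jump y m) \<longlonglongrightarrow> 0"
proof -
  define u where "u n = (\<lambda>l. x n l / y n l)" for n
  have u: "u n \<in> carrier (solenoid P)" for n
    using x y solenoid_divide by (simp add: u_def seqs_def)
  have iff: "convergent u \<longleftrightarrow> convergent (\<lambda>n. u n 0 ^ c) \<and> (\<lambda>m. jump x m - jump y m) \<longlonglongrightarrow> 0"
    unfolding jump_diff_tendsto_0_iff[OF x y] solenoid_convergent_iff[of P, OF P_pos \<open>c > 0\<close> u] u_def ..
  have "convergent (\<lambda>n. h (u n))" if u_conv: "convergent u"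
  proof -
    obtain L where L: "u \<longlonglongrightarrow> L"
      using u_conv unfolding convergent_def by blast
    have "L \<in> carrier (solenoid P)"
      using closed_solenoid u L by (rule closed_sequentially)
    then have "(\<lambda>n. h (u n)) \<longlonglongrightarrow> h L"
      using u by (intro continuous_on_tendsto_compose[OF h(1) L]) auto
    then show ?thesis
      by (rule convergentI)
  qed
  moreover have "convergent (\<lambda>n. u n 0 ^ c)" if "convergent (\<lambda>n. h (u n))"
    using that unfolding h(2)[symmetric] convergent_fun_iff by blast
  ultimately show ?thesis
    using iff unfolding u_def by blast
qed

lemma convergent_reduction_map_iff:
  assumes P_pos: "\<And>n. P n > 0" and "c > 0"
    and h: "h \<in> hom (solenoid P) (solenoid Q)" "continuous_on (carrier (solenoid P)) h" "\<And>g. h g 0 = g 0 ^ c"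
    and x: "x \<in> seqs (solenoid P)" and y: "y \<in> seqs (solenoid P)"
  shows "convergent (\<lambda>n j. reduction_map Q h x n j / reduction_map Q h y n j)
    \<longleftrightarrow> convergent (\<lambda>n l. x n l / y n l)"
proof -
  define u where "u n = (\<lambda>l. x n l / y n l)" for n
  define d where "d m = jump x m - jump y m" for m
  have "u n \<in> carrier (solenoid P)" for n
    using x y solenoid_divide by (simp add: u_def seqs_def)
  then have hu: "norm (h (u n) j) = 1" for n j
    using hom_in_carrier[OF h(1)] solenoid_norm by blast
  have d_le: "norm (d n) \<le> 1 / 4" for n
    using norm_triangle_ineq4[of "jump x n" "jump y n"] norm_jump_le[OF x, of n] norm_jump_le[OF y, of n]
    by (simp add: d_def)
  have "jump_part i (a - b) = jump_part i a - jump_part i b" for i a b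
    by (simp add: jump_part_def)
  then have quotient: "reduction_map Q h x n j / reduction_map Q h y n j
      = h (u (n div 3)) j * one_param Q (jump_part (n mod 3) (d (n div 3))) j" for n j
    using x y solenoid_hom_divide[OF h(1), of "x (n div 3)" "y (n div 3)" j]
    by (simp add: reduction_map_def u_def d_def one_param_diff seqs_def)
  have "convergent (\<lambda>n j. reduction_map Q h x n j / reduction_map Q h y n j)
      \<longleftrightarrow> (\<forall>j. convergent (\<lambda>n. h (u n) j) \<and> (\<forall>i<3. (\<lambda>n. one_param Q (jump_part i (d n)) j) \<longlonglongrightarrow> 1))"
    unfolding convergent_fun_iff quotient
    using convergent_interleaved_iff[of 3 "\<lambda>n. h (u n) _" "\<lambda>i n. one_param Q (jump_part i (d n)) _", OF _ hu]
    by (simp add: jump_part_def)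
  also have "\<dots> \<longleftrightarrow> convergent (\<lambda>n. h (u n)) \<and> d \<longlonglongrightarrow> 0"
    using one_param_jump_parts_tendsto_1_iff[OF d_le, of Q]
    by (simp add: convergent_fun_iff[of "\<lambda>n. h (u n)"] all_conj_distrib)
  also have "\<dots> \<longleftrightarrow> convergent (\<lambda>n l. x n l / y n l)"
    unfolding u_def d_def convergent_iff_image_and_jump[of P, OF P_pos \<open>c > 0\<close> h(2,3) x y] ..
  finally show ?thesis .
qed

abbreviation (input) coset_rel_reducible ::
  "('a::topological_space, 'b) monoid_scheme \<Rightarrow> ('c::topological_space, 'd) monoid_scheme \<Rightarrow> bool" where
  "coset_rel_reducible G H \<equiv> borel_reducible (seqs G) (coset_rel G) (seqs H) (coset_rel H)"

theorem borel_reducible_if_hom: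
  assumes Q_pos: "\<And>n. Q n > 0" and P_pos: "\<And>n. P n > 0" and "c > 0"
    and h: "h \<in> hom (solenoid P) (solenoid Q)" "continuous_on (carrier (solenoid P)) h" "\<And>g. h g 0 = g 0 ^ c"
  shows "coset_rel_reducible (solenoid P) (solenoid Q)"
  unfolding borel_reducible_def
proof (intro bexI ballI)
  note in_seqs = reduction_map_in_seqs[of Q, OF Q_pos h(1)]
  show "reduction_map Q h \<in> restrict_space borel (seqs (solenoid P)) \<rightarrow>\<^sub>M restrict_space borel (seqs (solenoid Q))"
    using in_seqs
    by (intro measurable_restrict_space2 borel_measurable_continuous_on_restrict continuous_on_reduction_map h(2))
      (simp add: space_restrict_space)
  show "(x, y) \<in> coset_rel (solenoid P) \<longleftrightarrow> (reduction_map Q h x, reduction_map Q h y) \<in> coset_rel (solenoid Q)"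
    if x: "x \<in> seqs (solenoid P)" and y: "y \<in> seqs (solenoid P)" for x y
    unfolding coset_rel_solenoid_iff[OF x y] coset_rel_solenoid_iff[OF in_seqs[OF x] in_seqs[OF y]]
    using convergent_reduction_map_iff[of P, OF P_pos \<open>c > 0\<close> h x y] ..
qed

subsection \<open>Characters of the rational one-parameter subgroup\<close>

lemma cis_inj_on_half_circle: "cis x = cis y \<Longrightarrow> \<bar>x\<bar> < pi / 2 \<Longrightarrow> \<bar>y\<bar> < pi / 2 \<Longrightarrow> x = y"
  using sin_inj_pi[of x y] by (metis abs_less_iff cis.simps(2) less_imp_le minus_less_iff)

lemma rat_hom_of_int_mult:
  fixes \<phi> :: "rat \<Rightarrow> 'a::field"
  assumes mult: "\<And>s t. \<phi> (s + t) = \<phi> s * \<phi> t" and nonzero: "\<And>t. \<phi> t \<noteq> 0"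
  shows "\<phi> (of_int m * t) = \<phi> t powi m"
proof -
  have "\<phi> 0 = 1"
    using mult[of 0 0] nonzero[of 0] by simp
  then have nat: "\<phi> (of_nat n * t) = \<phi> t ^ n" for n
    by (induction n) (simp_all add: mult distrib_right)
  have "\<phi> t * \<phi> (- t) = 1" for t
    using mult[of t "- t"] \<open>\<phi> 0 = 1\<close> by simp
  then have minus: "\<phi> (- t) = inverse (\<phi> t)" for t
    by (metis inverse_unique)
  show ?thesis
    by (cases m rule: int_cases2) (simp_all add: nat minus power_int_minus)
qed

lemma rat_hom_eqI:
  fixes \<phi> \<psi> :: "rat \<Rightarrow> 'a::field"
  assumes "\<And>s t. \<phi> (s + t) = \<phi> s * \<phi> t" "\<And>t. \<phi> t \<noteq> 0"
    and "\<And>s t. \<psi> (s + t) = \<psi> s * \<psi> t" "\<And>t. \<psi> t \<noteq> 0"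
    and "K > 0" and eq: "\<And>n. n \<ge> 1 \<Longrightarrow> \<phi> (1 / of_nat (n * K)) = \<psi> (1 / of_nat (n * K))"
  shows "\<phi> t = \<psi> t"
proof -
  obtain p q where "quotient_of t = (p, q)"
    by fastforce
  then have "q > 0" "t = of_int p / of_int q"
    by (rule quotient_of_denom_pos, rule quotient_of_div)
  then have t: "t = of_int (p * int K) * (1 / of_nat (nat q * K))"
    using \<open>K > 0\<close> by simp
  have "\<phi> (1 / of_nat (nat q * K)) = \<psi> (1 / of_nat (nat q * K))"
    using \<open>q > 0\<close> by (intro eq) simp
  then show ?thesis
    unfolding t
    by (simp only: rat_hom_of_int_mult[of \<phi>, OF assms(1,2)] rat_hom_of_int_mult[of \<psi>, OF assms(3,4)])
qed

lemma rat_circle_hom_roots: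
  fixes \<phi> :: "rat \<Rightarrow> complex"
  assumes mult: "\<And>s t. \<phi> (s + t) = \<phi> s * \<phi> t" and unit: "\<And>t. norm (\<phi> t) = 1"
    and small: "\<And>t. \<bar>t\<bar> \<le> 1 / of_nat K \<Longrightarrow> norm (\<phi> t - 1) < 1"
  obtains b where "\<And>n. n \<ge> 1 \<Longrightarrow> \<phi> (1 / of_nat (n * K)) = cis (b / real n)"
proof -
  have "\<phi> t \<noteq> 0" for t
    using unit[of t] by auto
  then have power: "\<phi> (of_nat n * t) = \<phi> t ^ n" for n t
    using rat_hom_of_int_mult[of \<phi> "int n" t, OF mult] by simp
  have step: "\<exists>b. \<phi> (1 / of_nat (n * K)) = cis b \<and> \<bar>real n * b\<bar> < pi / 2" if "n \<ge> 1" for n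
  proof -
    have "norm (\<phi> (1 / of_nat (n * K)) ^ j - 1) < 1" if "j \<le> n" for j
    proof -
      have "\<bar>of_nat j * (1 / of_nat (n * K))\<bar> \<le> (1 / of_nat K :: rat)"
        using that \<open>n \<ge> 1\<close> by (simp add: divide_simps)
      then show ?thesis
        using small unfolding power[symmetric] by blast
    qed
    then show ?thesis
      using unit_circle_small_powers[OF unit _ \<open>n \<ge> 1\<close>] by metis
  qed
  obtain b where b: "\<phi> (1 / of_nat K) = cis b" "\<bar>b\<bar> < pi / 2"
    using step[of 1] by auto
  have "\<phi> (1 / of_nat (n * K)) = cis (b / real n)" if "n \<ge> 1" for n
  proof -
    obtain c where c: "\<phi> (1 / of_nat (n * K)) = cis c" "\<bar>real n * c\<bar> < pi / 2"
      using step[OF \<open>n \<ge> 1\<close>] by blast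
    have "of_nat n * (1 / of_nat (n * K)) = (1 / of_nat K :: rat)"
      using that by (simp add: field_simps)
    then have "cis (real n * c) = cis b"
      using power[of n "1 / of_nat (n * K)"] b(1) c(1) by (simp add: Complex.DeMoivre)
    then have "real n * c = b"
      using c(2) b(2) by (rule cis_inj_on_half_circle)
    then show ?thesis
      using c(1) that by auto
  qed
  then show ?thesis
    by (rule that)
qed

lemma rat_circle_hom:
  fixes \<phi> :: "rat \<Rightarrow> complex"
  assumes mult: "\<And>s t. \<phi> (s + t) = \<phi> s * \<phi> t" and unit: "\<And>t. norm (\<phi> t) = 1"
    and "d > 0" and small: "\<And>t. \<bar>t\<bar> \<le> d \<Longrightarrow> norm (\<phi> t - 1) < 1"
  obtains a where "\<And>t. \<phi> t = cis (2 * pi * (a * of_rat t))"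
proof -
  obtain K where K: "K > 0" "1 / of_nat K < d"
    using \<open>d > 0\<close> by (metis ex_inverse_of_nat_less inverse_eq_divide)
  have "norm (\<phi> t - 1) < 1" if "\<bar>t\<bar> \<le> 1 / of_nat K" for t
    using that K(2) by (intro small) simp
  then obtain b where b: "\<And>n. n \<ge> 1 \<Longrightarrow> \<phi> (1 / of_nat (n * K)) = cis (b / real n)"
    using rat_circle_hom_roots[of \<phi> K, OF mult unit] by metis
  define a where "a = b * real K / (2 * pi)"
  have nonzero: "\<phi> t \<noteq> 0" for t
    using unit[of t] by auto
  have "\<phi> t = cis (2 * pi * (a * of_rat t))" for t
  proof (rule rat_hom_eqI[of \<phi> "\<lambda>t. cis (2 * pi * (a * of_rat t))" K, OF mult nonzero])
    show "\<phi> (1 / of_nat (n * K)) = cis (2 * pi * (a * of_rat (1 / of_nat (n * K))))" if "n \<ge> 1" for n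
      using b[OF that] \<open>K > 0\<close> by (simp add: a_def of_rat_divide of_rat_mult)
  qed (use \<open>K > 0\<close> in \<open>simp_all add: of_rat_add cis_mult algebra_simps\<close>)
  then show ?thesis
    by (rule that)
qed

lemma cis_rat_frequency_unique:
  assumes eq: "\<And>t. cis (2 * pi * (a * of_rat t)) = cis (2 * pi * (b * of_rat t))"
  shows "a = b"
proof (rule ccontr)
  assume "a \<noteq> b"
  have "cis (2 * pi * ((a - b) * s)) = 1" for s
  proof (rule continuous_constant_on_closure[of \<rat> "\<lambda>s. cis (2 * pi * ((a - b) * s))"])
    show "cis (2 * pi * ((a - b) * s)) = 1" if "s \<in> \<rat>" for s
    proof -
      obtain t where "s = of_rat t"
        using \<open>s \<in> \<rat>\<close> by (rule Rats_cases)
      then show ?thesis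
        using eq[of t] by (simp add: left_diff_distrib right_diff_distrib flip: cis_divide)
    qed
  qed (auto intro!: continuous_intros simp: Rats_closure_real)
  moreover have "2 * pi * ((a - b) * (1 / (2 * (a - b)))) = pi"
    using \<open>a \<noteq> b\<close> by (simp add: field_simps)
  ultimately have "cis pi = 1"
    by metis
  then show False
    by simp
qed

text \<open>
  Since the circle has no small subgroups, the last condition amounts to continuity for the
  topology that the solenoid induces on its rational one-parameter subgroup.
\<close>

definition rat_character :: "(nat \<Rightarrow> nat) \<Rightarrow> (rat \<Rightarrow> complex) \<Rightarrow> bool" where
  "rat_character P \<phi> \<longleftrightarrow> (\<forall>s t. \<phi> (s + t) = \<phi> s * \<phi> t) \<and> (\<forall>t. norm (\<phi> t) = 1) \<and>
     (\<exists>d>0. \<forall>t. dist (one_param P (of_rat t)) (\<lambda>_. 1) < d \<longrightarrow> norm (\<phi> t - 1) < 1)"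

lemma dist_one_param_less:
  assumes "d > 0"
  obtains e where "e > 0" "\<And>t. \<bar>t\<bar> < e \<Longrightarrow> dist (one_param P t) (\<lambda>_. 1) < d"
proof -
  have "continuous_on UNIV (one_param P)"
    by (intro continuous_on_one_param continuous_on_id)
  then obtain e where "e > 0" "\<And>t. dist t 0 < e \<Longrightarrow> dist (one_param P t) (one_param P 0) < d"
    using assms unfolding continuous_on_iff by (metis UNIV_I)
  then show ?thesis
    using that by simp
qed

lemma one_param_multiples_small:
  assumes P_pos: "\<And>n. P n > 0" and "d > 0"
  obtains k where "\<And>n. dist (one_param P (real n * real (\<Prod>i<k. P i))) (\<lambda>_. 1) < d"
proof (rule ccontr)
  assume no_bound: "\<not> thesis"
  have "\<exists>n. \<not> dist (one_param P (real n * real (\<Prod>i<k. P i))) (\<lambda>_. 1) < d" for k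
    using no_bound that by blast
  then obtain m where m: "\<And>k. \<not> dist (one_param P (real (m k) * real (\<Prod>i<k. P i))) (\<lambda>_. 1) < d"
    by metis
  have "(\<lambda>k. one_param P (real (m k) * real (\<Prod>i<k. P i)) l) \<longlonglongrightarrow> 1" for l
    using one_param_period[of P, OF P_pos, where a = "int (m _)"]
    by (intro tendsto_eventually eventually_sequentiallyI[of l]) simp
  then have "(\<lambda>k. one_param P (real (m k) * real (\<Prod>i<k. P i))) \<longlonglongrightarrow> (\<lambda>_. 1)"
    by (simp add: tendsto_fun_iff)
  from tendstoD[OF this \<open>d > 0\<close>] show False
    using m by simp
qed

lemma rat_character_frequency:
  assumes P_pos: "\<And>n. P n > 0" and "rat_character P \<phi>"
  obtains a k m where "\<And>t. \<phi> t = cis (2 * pi * (a * of_rat t))" "a * real (\<Prod>i<k. P i) = of_int m"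
proof -
  obtain d where \<phi>: "\<And>s t. \<phi> (s + t) = \<phi> s * \<phi> t" "\<And>t. norm (\<phi> t) = 1"
    and "d > 0" and d: "\<And>t. dist (one_param P (of_rat t)) (\<lambda>_. 1) < d \<Longrightarrow> norm (\<phi> t - 1) < 1"
    using assms(2) unfolding rat_character_def by blast
  obtain e where "e > 0" and e: "\<And>s. \<bar>s\<bar> < e \<Longrightarrow> dist (one_param P s) (\<lambda>_. 1) < d"
    using \<open>d > 0\<close> by (rule dist_one_param_less[of d P]) blast
  obtain r where r: "0 < r" "of_rat r < e"
    using \<open>e > 0\<close> Rats_dense_in_real[of 0 e] by (metis Rats_cases zero_less_of_rat_iff)
  have "norm (\<phi> t - 1) < 1" if "\<bar>t\<bar> \<le> r" for t
  proof -
    have "\<bar>of_rat t :: real\<bar> \<le> of_rat r"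
      using that by (metis of_rat_less_eq abs_of_rat)
    then show ?thesis
      using r(2) e d by simp
  qed
  then obtain a where a: "\<And>t. \<phi> t = cis (2 * pi * (a * of_rat t))"
    using rat_circle_hom[of \<phi> r, OF \<phi> r(1)] by metis
  obtain k where k: "\<And>n. dist (one_param P (real n * real (\<Prod>i<k. P i))) (\<lambda>_. 1) < d"
    using one_param_multiples_small[of P d, OF P_pos \<open>d > 0\<close>] by metis
  define N where "N = (\<Prod>i<k. P i)"
  have "norm (\<phi> (of_nat N) ^ n - 1) < 1" for n
  proof -
    have "norm (\<phi> (of_nat n * of_nat N) - 1) < 1"
      using k[of n] by (intro d) (simp only: N_def of_rat_mult of_rat_of_nat_eq)
    then show ?thesis
      by (simp add: a Complex.DeMoivre of_rat_mult mult_ac)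
  qed
  then have "\<phi> (of_nat N) = 1"
    using unit_circle_no_small_subgroups \<phi>(2) by blast
  then have "cos (2 * pi * (a * real N)) = 1"
    unfolding a by (metis cis.simps(1) of_rat_of_nat_eq one_complex.sel(1))
  then obtain m :: int where "2 * pi * (a * real N) = of_int m * 2 * pi"
    using cos_one_2pi_int by blast
  then show ?thesis
    using that a by (simp add: N_def)
qed

lemma prods_dvd_if_frequencies:
  fixes a :: "nat \<Rightarrow> real"
  assumes P_pos: "\<And>n. P n > 0" and Q_pos: "\<And>n. Q n > 0" and a: "\<And>j. a j = a (Suc j) * real (Q j)"
    and period: "\<And>j. \<exists>k m. a j * real (\<Prod>i<k. P i) = of_int m" and "a j\<^sub>0 \<noteq> 0"
  obtains c where "c > 0" "prods_dvd c Q P"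
proof -
  have a_0: "a 0 = a j * real (\<Prod>i<j. Q i)" for j
  proof (induction j)
    case (Suc j)
    then show ?case
      using a[of j] by (simp add: mult_ac)
  qed simp
  obtain k\<^sub>0 m\<^sub>0 where m\<^sub>0: "a 0 * real (\<Prod>i<k\<^sub>0. P i) = of_int m\<^sub>0"
    using period by blast
  have "real (\<Prod>i<j\<^sub>0. Q i) > 0" "real (\<Prod>i<k\<^sub>0. P i) > 0"
    using P_pos Q_pos by (simp_all add: prod_pos)
  then have "m\<^sub>0 \<noteq> 0"
    using m\<^sub>0 \<open>a j\<^sub>0 \<noteq> 0\<close> a_0[of j\<^sub>0] by (metis less_irrefl mult_eq_0_iff of_int_0)
  have "\<exists>k. (\<Prod>i<j. Q i) dvd nat \<bar>m\<^sub>0\<bar> * (\<Prod>i<k. P i)" for j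
  proof -
    obtain k m where m: "a j * real (\<Prod>i<k. P i) = of_int m"
      using period by blast
    define A N N\<^sub>0 where "A = (\<Prod>i<j. Q i)" and "N = (\<Prod>i<k. P i)" and "N\<^sub>0 = (\<Prod>i<k\<^sub>0. P i)"
    have "of_int m * real A * real N\<^sub>0 = (a j * real A) * real N\<^sub>0 * real N"
      unfolding m[symmetric] N_def by (simp add: mult_ac)
    also have "\<dots> = of_int m\<^sub>0 * real N"
      unfolding A_def a_0[symmetric] N\<^sub>0_def m\<^sub>0 ..
    finally have "real_of_int (int A * (m * int N\<^sub>0)) = of_int (m\<^sub>0 * int N)"
      by (simp add: mult_ac)
    then have "int A dvd \<bar>m\<^sub>0 * int N\<bar>"
      unfolding of_int_eq_iff dvd_abs_iff by (rule dvdI[OF sym])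
    also have "\<bar>m\<^sub>0 * int N\<bar> = int (nat \<bar>m\<^sub>0\<bar> * N)"
      by (simp add: abs_mult)
    finally have "A dvd nat \<bar>m\<^sub>0\<bar> * N"
      by (simp only: int_dvd_int_iff)
    then show ?thesis
      unfolding A_def N_def by blast
  qed
  then show ?thesis
    using that[of "nat \<bar>m\<^sub>0\<bar>"] \<open>m\<^sub>0 \<noteq> 0\<close> by (simp add: prods_dvd_def)
qed

theorem prods_dvd_if_rat_characters:
  assumes P_pos: "\<And>n. P n > 0" and Q_pos: "\<And>n. Q n > 0"
    and S: "\<And>t. S t \<in> carrier (solenoid Q)" "\<And>j. rat_character P (\<lambda>t. S t j)" and "S t\<^sub>0 \<noteq> (\<lambda>_. 1)"
  obtains c where "c > 0" "prods_dvd c Q P"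
proof -
  have "\<exists>a. (\<forall>t. S t j = cis (2 * pi * (a * of_rat t))) \<and> (\<exists>k m. a * real (\<Prod>i<k. P i) = of_int m)" for j
    using rat_character_frequency[of P, OF P_pos S(2)[of j]] by metis
  then obtain a where a: "\<And>j t. S t j = cis (2 * pi * (a j * of_rat t))"
    and period: "\<And>j. \<exists>k m. a j * real (\<Prod>i<k. P i) = of_int m"
    by metis
  have "a j = a (Suc j) * real (Q j)" for j
  proof (rule cis_rat_frequency_unique)
    show "cis (2 * pi * (a j * of_rat t)) = cis (2 * pi * (a (Suc j) * real (Q j) * of_rat t))" for t
      using S(1)[of t] by (simp add: mem_solenoid_iff a Complex.DeMoivre mult_ac)
  qed
  moreover obtain j\<^sub>0 where "a j\<^sub>0 \<noteq> 0"
    using \<open>S t\<^sub>0 \<noteq> (\<lambda>_. 1)\<close> by (metis a cis_zero mult_zero_left mult_zero_right)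
  ultimately show ?thesis
    using prods_dvd_if_frequencies[of P Q a] P_pos Q_pos period that by blast
qed

lemma const_if_const_on_rational_one_param:
  fixes h :: "(nat \<Rightarrow> complex) \<Rightarrow> 'a::t1_space"
  assumes P_pos: "\<And>n. P n > 0" and h: "continuous_on (carrier (solenoid P)) h"
    and const: "\<And>t. h (one_param P (of_rat t)) = a" and "g \<in> carrier (solenoid P)"
  shows "h g = a"
proof (rule continuous_constant_on_closure[of "one_param P ` \<rat>" h])
  have "closure (one_param P ` \<rat>) \<subseteq> carrier (solenoid P)"
    using closed_solenoid one_param_in_solenoid[of P, OF P_pos] by (intro closure_minimal) auto
  with h show "continuous_on (closure (one_param P ` \<rat>)) h"
    by (rule continuous_on_subset)
  show "g \<in> closure (one_param P ` \<rat>)"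
    using solenoid_subset_closure_one_param[of P, OF P_pos] \<open>g \<in> carrier (solenoid P)\<close> by blast
qed (auto simp: const elim!: Rats_cases)

theorem prods_dvd_if_solenoid_hom:
  assumes P_pos: "\<And>n. P n > 0" and Q_pos: "\<And>n. Q n > 0"
    and h: "h \<in> hom (solenoid P) (solenoid Q)" and cont: "continuous_on (carrier (solenoid P)) h"
    and nontrivial: "g \<in> carrier (solenoid P)" "h g \<noteq> \<one>\<^bsub>solenoid Q\<^esub>"
  obtains c where "c > 0" "prods_dvd c Q P"
proof -
  define S where "S t = h (one_param P (of_rat t))" for t
  have in_P: "one_param P t \<in> carrier (solenoid P)" for t
    using P_pos by (rule one_param_in_solenoid)
  then have S: "S t \<in> carrier (solenoid Q)" for t
    unfolding S_def by (rule hom_in_carrier[OF h])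
  have "S (s + t) = S s \<otimes>\<^bsub>solenoid Q\<^esub> S t" for s t
    unfolding S_def hom_mult[OF h in_P in_P, symmetric]
    by (simp add: mult_solenoid of_rat_add one_param_add[abs_def])
  then have add: "S (s + t) j = S s j * S t j" for s t j
    by (simp add: mult_solenoid)
  have "S 0 j = 1" for j
    using add[of 0 0 j] solenoid_nonzero[OF S] by simp
  then have h_1: "h (\<lambda>_. 1) j = 1" for j
    by (simp add: S_def)
  have "\<exists>d>0. \<forall>t. dist (one_param P (of_rat t)) (\<lambda>_. 1) < d \<longrightarrow> norm (S t j - 1) < 1" for j
  proof -
    have "continuous_on (carrier (solenoid P)) (\<lambda>g. h g j)"
      using cont by (rule continuous_on_product_then_coordinatewise)
    moreover have "(\<lambda>_. 1) \<in> carrier (solenoid P)"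
      using in_P[of 0] by simp
    ultimately show ?thesis
      unfolding S_def continuous_on_iff using in_P h_1 by (metis dist_norm zero_less_one)
  qed
  then have "rat_character P (\<lambda>t. S t j)" for j
    unfolding rat_character_def using add solenoid_norm[OF S] by blast
  moreover obtain t\<^sub>0 where "S t\<^sub>0 \<noteq> (\<lambda>_. 1)"
  proof (rule ccontr)
    assume "\<not> thesis"
    with that have "h (one_param P (of_rat t)) = (\<lambda>_. 1)" for t
      unfolding S_def by blast
    from const_if_const_on_rational_one_param[of P h, OF P_pos cont this nontrivial(1)] show False
      using nontrivial(2) by (simp add: one_solenoid)
  qed
  ultimately show ?thesis
    using prods_dvd_if_rat_characters[of P Q S, OF P_pos Q_pos S] that by blast
qed

subsection \<open>The rational one-parameter subgroup in the torus\<close>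

definition coords :: "('a \<Rightarrow> circle) \<Rightarrow> 'a \<Rightarrow> complex" where
  "coords a = (\<lambda>i. of_circle (a i))"

definition of_coords :: "('a \<Rightarrow> complex) \<Rightarrow> 'a \<Rightarrow> circle" where
  "of_coords g = (\<lambda>i. Abs_circle (g i))"

lemma coords_of_coords: "(\<And>i. norm (g i) = 1) \<Longrightarrow> coords (of_coords g) = g"
  by (simp add: coords_def of_coords_def of_circle_Abs_circle)

lemma coords_eq_iff [simp]: "coords a = coords b \<longleftrightarrow> a = b"
  by (simp add: coords_def fun_eq_iff of_circle_inject)

lemma coords_0 [simp]: "coords 0 = (\<lambda>_. 1)"
  by (simp add: coords_def)

lemma coords_add [simp]: "coords (a + b) = (\<lambda>i. coords a i * coords b i)"
  by (simp add: coords_def)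

lemma coords_diff [simp]: "coords (a - b) = (\<lambda>i. coords a i / coords b i)"
  by (simp add: coords_def)

lemma dist_coords [simp]: "dist (coords a) (coords b) = dist a b" for a b :: "'a::countable \<Rightarrow> circle"
  by (simp add: coords_def dist_fun_def dist_circle_def)

lemma convergent_coords_iff: "convergent (\<lambda>n. coords (a n)) \<longleftrightarrow> convergent a"
  for a :: "nat \<Rightarrow> 'a::countable \<Rightarrow> circle"
  by (simp add: convergent_fun_iff coords_def convergent_circle_iff)

lemma continuous_on_coords: "continuous_on A (coords :: ('a::countable \<Rightarrow> circle) \<Rightarrow> 'a \<Rightarrow> complex)"
  unfolding continuous_on_iff by auto

lemma gnorm_small_coordinate:
  fixes i :: "'a::countable"
  assumes "d > 0"
  obtains e where "e > 0" "\<And>a :: 'a \<Rightarrow> circle. gnorm a \<le> e \<Longrightarrow> norm (coords a i - 1) < d"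
proof -
  have "continuous_on UNIV (\<lambda>a :: 'a \<Rightarrow> circle. coords a i)"
    using continuous_on_coords by (rule continuous_on_product_then_coordinatewise)
  then obtain e where "e > 0" "\<And>a :: 'a \<Rightarrow> circle. dist a 0 < e \<Longrightarrow> dist (coords a i) (coords 0 i) < d"
    using \<open>d > 0\<close> unfolding continuous_on_iff by (metis UNIV_I)
  then show ?thesis
    by (intro that[of "e / 2"]) (auto simp: gnorm_def dist_norm)
qed

definition orbit :: "(nat \<Rightarrow> nat) \<Rightarrow> rat \<Rightarrow> nat \<Rightarrow> circle" where
  "orbit P t = of_coords (one_param P (of_rat t))"

lemma coords_orbit [simp]: "coords (orbit P t) = one_param P (of_rat t)"
  by (simp add: orbit_def coords_of_coords)

lemma additive_orbit: "Modules.additive (orbit P)"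
proof
  show "orbit P (s + t) = orbit P s + orbit P t" for s t
    unfolding coords_eq_iff[symmetric] by (simp add: of_rat_add one_param_add fun_eq_iff)
qed

lemma gnorm_orbit: "gnorm (orbit P t) = dist (one_param P (of_rat t)) (\<lambda>_. 1)"
  unfolding gnorm_def dist_coords[symmetric] by simp

lemma orbit_divisors:
  assumes "d > 0"
  shows "\<exists>(n :: nat) t'. (\<Sum>i<n. t') = t \<and> gnorm (orbit P t') < d"
proof -
  obtain e where "e > 0" and e: "\<And>t. \<bar>t\<bar> < e \<Longrightarrow> dist (one_param P t) (\<lambda>_. 1) < d"
    using assms by (rule dist_one_param_less[of d P]) blast
  obtain n where n: "\<bar>of_rat t\<bar> < real n * e"
    using reals_Archimedean3[OF \<open>e > 0\<close>] by blast
  then have "n > 0"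
    by (intro gr0I) simp
  with n have "\<bar>of_rat (t / of_nat n)\<bar> < e"
    by (simp add: of_rat_divide field_simps)
  then show ?thesis
    using \<open>n > 0\<close> e by (intro exI[of _ n] exI[of _ "t / of_nat n"]) (simp add: gnorm_orbit)
qed

lemma orbit_tendsto_0:
  assumes "(\<lambda>k. of_rat (v k) :: real) \<longlonglongrightarrow> 0"
  shows "(\<lambda>k. orbit P (v k)) \<longlonglongrightarrow> 0"
  using one_param_tendsto[OF assms, of P]
  by (simp add: tendsto_0_iff_gnorm gnorm_orbit tendsto_dist_iff[of _ "\<lambda>_. 1"])

lemma harm_double_diff_tendsto: "(\<lambda>n. harm (2 * n) - harm n :: real) \<longlonglongrightarrow> ln 2"
proof -
  have gamma: "(\<lambda>n. harm n - ln (real n)) \<longlonglongrightarrow> euler_mascheroni"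
    by (rule euler_mascheroni_LIMSEQ)
  have double: "filterlim (\<lambda>n::nat. 2 * n) sequentially sequentially"
    by (auto intro!: filterlim_subseq strict_monoI)
  have "(\<lambda>n. (harm (2 * n) - ln (real (2 * n))) - (harm n - ln (real n)) + ln 2)
      \<longlonglongrightarrow> euler_mascheroni - euler_mascheroni + ln 2"
    by (intro tendsto_add tendsto_diff gamma filterlim_compose[OF gamma double] tendsto_const)
  then have "(\<lambda>n. (harm (2 * n) - ln (real (2 * n))) - (harm n - ln (real n)) + ln 2) \<longlonglongrightarrow> ln 2"
    by simp
  then show ?thesis
    by (rule Lim_transform_eventually)
      (use eventually_gt_at_top[of "0::nat"] in eventually_elim, simp add: ln_mult)
qed

lemma harmonic_rotation_not_convergent: "\<not> convergent (\<lambda>n. cis (2 * pi * harm n))"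
proof
  assume "convergent (\<lambda>n. cis (2 * pi * harm n))"
  then obtain z where z: "(\<lambda>n. cis (2 * pi * harm n)) \<longlonglongrightarrow> z"
    by (auto simp: convergent_def)
  have "norm z = 1"
    using tendsto_norm[OF z] by (simp add: LIMSEQ_const_iff)
  then have "z \<noteq> 0" by auto
  have double: "filterlim (\<lambda>n::nat. 2 * n) sequentially sequentially"
    by (auto intro!: filterlim_subseq strict_monoI)
  have "(\<lambda>n. cis (2 * pi * harm (2 * n)) / cis (2 * pi * harm n)) \<longlonglongrightarrow> z / z"
    using \<open>z \<noteq> 0\<close> by (intro tendsto_divide z filterlim_compose[OF z double])
  then have "(\<lambda>n. cis (2 * pi * (harm (2 * n) - harm n))) \<longlonglongrightarrow> 1"
    using \<open>z \<noteq> 0\<close> by (simp add: cis_divide right_diff_distrib)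
  moreover have "(\<lambda>n. cis (2 * pi * (harm (2 * n) - harm n))) \<longlonglongrightarrow> cis (2 * pi * ln 2)"
    by (intro tendsto_cis tendsto_mult_left harm_double_diff_tendsto)
  ultimately have "cis (2 * pi * ln 2) = 1"
    using LIMSEQ_unique by blast
  then have "cos (2 * pi * ln 2) = 1"
    by (metis cis.simps(1) one_complex.sel(1))
  then obtain n :: int where "2 * pi * ln 2 = of_int n * 2 * pi"
    using cos_one_2pi_int by blast
  then have "ln 2 = real_of_int n"
    by simp
  moreover have "0 < ln (2 :: real)" "ln (2 :: real) < 1"
    using ln_2_less_1 by auto
  ultimately show False
    by simp
qed

lemma harmonic_orbit_not_convergent: "\<not> convergent (\<lambda>n. orbit P (\<Sum>k<n. 1 / of_nat (Suc k)))"
proof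
  have "of_rat (\<Sum>k<n. 1 / of_nat (Suc k)) = (\<Sum>k<n. 1 / real (Suc k))" for n
    by (simp only: of_rat_sum of_rat_divide of_rat_1 of_rat_of_nat_eq)
  then have harm: "of_rat (\<Sum>k<n. 1 / of_nat (Suc k)) = (harm n :: real)" for n
    by (simp add: harm_def sum.atLeast1_atMost_eq inverse_eq_divide)
  assume "convergent (\<lambda>n. orbit P (\<Sum>k<n. 1 / of_nat (Suc k)))"
  then have "convergent (\<lambda>n. one_param P (harm n))"
    by (simp only: convergent_coords_iff[symmetric] coords_orbit harm)
  then have "convergent (\<lambda>n. one_param P (harm n) 0)"
    unfolding convergent_fun_iff by blast
  then show False
    using harmonic_rotation_not_convergent by (simp add: one_param_def)
qed

lemma inverse_Suc_orbit_tendsto_0: "(\<lambda>k. orbit P (1 / of_nat (Suc k))) \<longlonglongrightarrow> 0"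
proof (rule orbit_tendsto_0)
  have "real_of_rat (1 / of_nat (Suc k)) = inverse (real (Suc k))" for k
    by (simp only: of_rat_divide of_rat_1 of_rat_of_nat_eq inverse_eq_divide)
  then show "(\<lambda>k. real_of_rat (1 / of_nat (Suc k))) \<longlonglongrightarrow> 0"
    using LIMSEQ_inverse_real_of_nat by simp
qed

subsection \<open>From reductions to divisibility\<close>

lemma prefix_continuousI:
  fixes f :: "'a word \<Rightarrow> nat \<Rightarrow> 'b::topological_space"
  assumes local: "\<And>k. \<exists>n. \<forall>x y. (\<forall>i<n. x i = y i) \<longrightarrow> f x k = f y k"
  shows "prefix_continuous f"
  unfolding prefix_continuous_def
proof (intro allI impI, rule ccontr)
  fix x and W :: "(nat \<Rightarrow> 'b) set" assume W: "open W" "f x \<in> W"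
  assume "\<nexists>n. \<forall>z. f (prefix n x \<frown> z) \<in> W"
  then obtain z where z: "\<And>n. f (prefix n x \<frown> z n) \<notin> W"
    by metis
  have "(\<lambda>n. f (prefix n x \<frown> z n) k) \<longlonglongrightarrow> f x k" for k
  proof -
    obtain m where m: "\<forall>x y. (\<forall>i<m. x i = y i) \<longrightarrow> f x k = f y k"
      using local by blast
    have "f (prefix n x \<frown> z n) k = f x k" if "n \<ge> m" for n
      using that by (intro m[rule_format]) (simp add: conc_def)
    then show ?thesis
      by (intro tendsto_eventually eventually_sequentiallyI)
  qed
  then have "(\<lambda>n. f (prefix n x \<frown> z n)) \<longlonglongrightarrow> f x"
    by (simp add: tendsto_fun_iff)
  then have "\<forall>\<^sub>F n in sequentially. f (prefix n x \<frown> z n) \<in> W"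
    using W by (rule topological_tendstoD)
  then show False
    using z by simp
qed

definition orbit_sums :: "(nat \<Rightarrow> nat) \<Rightarrow> rat word \<Rightarrow> nat \<Rightarrow> nat \<Rightarrow> complex" where
  "orbit_sums P x k = one_param P (of_rat (\<Sum>i<Suc k. x i))"

lemma orbit_sums_in_seqs: "(\<And>n. P n > 0) \<Longrightarrow> orbit_sums P x \<in> seqs (solenoid P)"
  by (simp add: orbit_sums_def seqs_def one_param_in_solenoid)

lemma prefix_continuous_orbit_sums: "prefix_continuous (orbit_sums P)"
proof (rule prefix_continuousI)
  show "\<exists>n. \<forall>x y. (\<forall>i<n. x i = y i) \<longrightarrow> orbit_sums P x k = orbit_sums P y k" for k
    by (intro exI[of _ "Suc k"]) (simp add: orbit_sums_def cong: sum.cong_simp)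
qed

lemma coset_rel_orbit_sums_iff:
  assumes "\<And>n. P n > 0"
  shows "(orbit_sums P x, orbit_sums P y) \<in> coset_rel (solenoid P)
    \<longleftrightarrow> convergent (\<lambda>k. orbit P (\<Sum>i<k. x i - y i))"
proof -
  have "(\<lambda>k l. orbit_sums P x k l / orbit_sums P y k l) = (\<lambda>k. coords (orbit P (\<Sum>i<Suc k. x i - y i)))"
    unfolding coords_orbit orbit_sums_def sum_subtractf of_rat_diff one_param_diff[symmetric] ..
  then have "(orbit_sums P x, orbit_sums P y) \<in> coset_rel (solenoid P)
    \<longleftrightarrow> convergent (\<lambda>k. coords (orbit P (\<Sum>i<Suc k. x i - y i)))"
    using coset_rel_solenoid_iff[of "orbit_sums P x" P "orbit_sums P y"] orbit_sums_in_seqs[of P, OF assms]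
    by simp
  also have "\<dots> \<longleftrightarrow> convergent (\<lambda>k. orbit P (\<Sum>i<Suc k. x i - y i))"
    by (rule convergent_coords_iff)
  also have "\<dots> \<longleftrightarrow> convergent (\<lambda>k. orbit P (\<Sum>i<k. x i - y i))"
    by (rule convergent_Suc_iff)
  finally show ?thesis .
qed

lemma generic_reduction_if_borel_reducible:
  assumes P_pos: "\<And>n. P n > 0"
    and "coset_rel_reducible (solenoid P) (solenoid Q)"
  obtains \<D> and \<Phi> :: "rat word \<Rightarrow> nat \<Rightarrow> nat \<Rightarrow> circle"
  where "dense_open_family \<D>" "\<And>i. generically_continuous \<D> (\<lambda>x. \<Phi> x i)"
    "\<And>x i. coords (\<Phi> x i) \<in> carrier (solenoid Q)"
    "\<And>x y. convergent (\<lambda>i. \<Phi> x i - \<Phi> y i) \<longleftrightarrow> convergent (\<lambda>k. orbit P (\<Sum>i<k. x i - y i))"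
proof -
  obtain \<theta> where meas: "\<theta> \<in> restrict_space borel (seqs (solenoid P)) \<rightarrow>\<^sub>M restrict_space borel (seqs (solenoid Q))"
    and \<theta>: "\<And>x y. x \<in> seqs (solenoid P) \<Longrightarrow> y \<in> seqs (solenoid P) \<Longrightarrow>
      (x, y) \<in> coset_rel (solenoid P) \<longleftrightarrow> (\<theta> x, \<theta> y) \<in> coset_rel (solenoid Q)"
    using assms(2) unfolding borel_reducible_def by blast
  have in_P: "orbit_sums P x \<in> seqs (solenoid P)" for x
    using P_pos by (rule orbit_sums_in_seqs)
  then have in_Q: "\<theta> (orbit_sums P x) \<in> seqs (solenoid Q)" for x
    using measurable_space[OF meas, of "orbit_sums P x"] by (simp add: space_restrict_space)
  have "\<theta> \<in> restrict_space borel (seqs (solenoid P)) \<rightarrow>\<^sub>M borel"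
    using meas by (simp add: measurable_restrict_space2_iff)
  then have "(\<lambda>z. \<theta> z i) \<in> restrict_space borel (seqs (solenoid P)) \<rightarrow>\<^sub>M borel" for i
    by (rule borel_measurable_continuous_on[OF continuous_on_product_coordinates])
  from baire_property_vimage_measurable[OF prefix_continuous_orbit_sums in_P this]
  have "baire_property ((\<lambda>x. \<theta> (orbit_sums P x) i) -` V)" if "open V" for i V
    using that .
  then obtain \<D> where \<D>: "dense_open_family \<D>" "\<And>i. generically_continuous \<D> (\<lambda>x. \<theta> (orbit_sums P x) i)"
    using generically_continuous_if_baire_property[of "\<lambda>i x. \<theta> (orbit_sums P x) i"] by metis
  define \<Phi> where "\<Phi> x i = of_coords (\<theta> (orbit_sums P x) i)" for x i
  have in_solenoid: "\<theta> (orbit_sums P x) i \<in> carrier (solenoid Q)" for x i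
    using in_Q by (simp add: seqs_def)
  then have coords_\<Phi>: "coords (\<Phi> x i) = \<theta> (orbit_sums P x) i" for x i
    unfolding \<Phi>_def by (intro coords_of_coords solenoid_norm)
  show thesis
  proof (rule that[OF \<D>(1)])
    show "generically_continuous \<D> (\<lambda>x. \<Phi> x i)" for i
      using \<D>(2)[of i] by (simp add: generically_continuous_def coords_\<Phi> flip: dist_coords)
    show "coords (\<Phi> x i) \<in> carrier (solenoid Q)" for x i
      by (simp add: coords_\<Phi> in_solenoid)
    have "convergent (\<lambda>i. \<Phi> x i - \<Phi> y i)
        \<longleftrightarrow> (\<theta> (orbit_sums P x), \<theta> (orbit_sums P y)) \<in> coset_rel (solenoid Q)" for x y
      by (simp add: coset_rel_solenoid_iff[OF in_Q in_Q] coords_\<Phi> flip: convergent_coords_iff)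
    then show "convergent (\<lambda>i. \<Phi> x i - \<Phi> y i) \<longleftrightarrow> convergent (\<lambda>k. orbit P (\<Sum>i<k. x i - y i))" for x y
      using \<theta>[OF in_P in_P] coset_rel_orbit_sums_iff[of P, OF P_pos] by simp
  qed
qed

lemma rat_character_if_continuous_hom:
  fixes H :: "rat \<Rightarrow> nat \<Rightarrow> circle"
  assumes "Modules.additive H"
    and cont: "\<And>e. e > 0 \<Longrightarrow> \<exists>d>0. \<forall>t. gnorm (orbit P t) < d \<longrightarrow> gnorm (H t) \<le> e"
  shows "rat_character P (\<lambda>t. coords (H t) j)"
  unfolding rat_character_def
proof (intro conjI allI)
  show "coords (H (s + t)) j = coords (H s) j * coords (H t) j" for s t
    by (simp add: additive.add[OF assms(1)])
  show "norm (coords (H t) j) = 1" for t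
    by (simp add: coords_def)
  obtain e where "e > 0" "\<And>a :: nat \<Rightarrow> circle. gnorm a \<le> e \<Longrightarrow> norm (coords a j - 1) < 1"
    by (rule gnorm_small_coordinate[of 1 j, OF zero_less_one]) (rule that)
  with cont[OF \<open>e > 0\<close>]
  show "\<exists>d>0. \<forall>t. dist (one_param P (of_rat t)) (\<lambda>_. 1) < d \<longrightarrow> norm (coords (H t) j - 1) < 1"
    unfolding gnorm_orbit by blast
qed

theorem prods_dvd_if_borel_reducible:
  assumes P_pos: "\<And>n. P n > 0" and Q_pos: "\<And>n. Q n > 0"
    and red: "coset_rel_reducible (solenoid P) (solenoid Q)"
  obtains c where "c > 0" "prods_dvd c Q P"
proof -
  obtain \<D> and \<Phi> :: "rat word \<Rightarrow> nat \<Rightarrow> nat \<Rightarrow> circle"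
    where \<D>: "dense_open_family \<D>" "\<And>i. generically_continuous \<D> (\<lambda>x. \<Phi> x i)"
      and in_Q: "\<And>x i. coords (\<Phi> x i) \<in> carrier (solenoid Q)"
      and \<Phi>: "\<And>x y. convergent (\<lambda>i. \<Phi> x i - \<Phi> y i) \<longleftrightarrow> convergent (\<lambda>k. orbit P (\<Sum>i<k. x i - y i))"
    by (rule generic_reduction_if_borel_reducible[of P Q, OF P_pos red]) (rule that)
  obtain F l s where "block_reduction (orbit P) F l (\<lambda>y. \<Phi> (pad s y))"
    by (rule block_reduction_exists[of "orbit P", OF additive_orbit \<D> \<Phi>]) (rule that)
  then interpret torus_block_reduction "orbit P" F l "\<lambda>y. \<Phi> (pad s y)"
    by (rule torus_block_reduction.intro)
  have contribution_in: "coords (contribution n g) \<in> carrier (solenoid Q)" for n g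
    using solenoid_divide[OF in_Q in_Q] by (simp add: contribution_def response_def)
  have "closed (coords -` carrier (solenoid Q))"
    by (rule closed_vimage[OF closed_solenoid continuous_on_coords])
  then obtain H where H: "Modules.additive H" "range H \<subseteq> coords -` carrier (solenoid Q)" "\<exists>t. H t \<noteq> 0"
    and cont: "\<And>e. e > 0 \<Longrightarrow> \<exists>d>0. \<forall>t. gnorm (orbit P t) < d \<longrightarrow> gnorm (H t) \<le> e"
    using limit_homomorphism[OF orbit_divisors inverse_Suc_orbit_tendsto_0 harmonic_orbit_not_convergent,
        of "coords -` carrier (solenoid Q)"] contribution_in by auto
  obtain t where "H t \<noteq> 0"
    using H(3) by blast
  then have "coords (H t) \<noteq> (\<lambda>_. 1)"
    unfolding coords_0[symmetric] coords_eq_iff .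
  moreover have "coords (H t) \<in> carrier (solenoid Q)" for t
    using H(2) by auto
  ultimately show ?thesis
    using prods_dvd_if_rat_characters[of P Q "\<lambda>t. coords (H t)",
        OF P_pos Q_pos _ rat_character_if_continuous_hom[OF H(1) cont]] that by metis
qed

theorem theorem1p4:
  fixes P Q :: "nat \<Rightarrow> nat"
  assumes "\<And>n. prime (P n)" and "\<And>n. prime (Q n)"
  shows "(borel_reducible (seqs (solenoid P)) (coset_rel (solenoid P))
            (seqs (solenoid Q)) (coset_rel (solenoid Q)) \<longleftrightarrow> Q \<preceq> P) \<and>
         (Q \<preceq> P \<longleftrightarrow>
           (\<exists>h \<in> hom (solenoid P) (solenoid Q).
              continuous_on (carrier (solenoid P)) h \<and>
              (\<exists>g \<in> carrier (solenoid P). h g \<noteq> \<one>\<^bsub>solenoid Q\<^esub>)))"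
    (is "(?reducible \<longleftrightarrow> _) \<and> (_ \<longleftrightarrow> ?nontrivial_hom)")
proof -
  have P_pos: "P n > 0" and Q_pos: "Q n > 0" for n
    using assms by (simp_all add: prime_gt_0_nat)
  have "Q \<preceq> P \<longleftrightarrow> (\<exists>c>0. prods_dvd c Q P)"
    using prods_dvd_if_prime_seq_le[of Q P, OF Q_pos] prime_seq_le_if_prods_dvd[of P Q, OF assms] by metis
  moreover have "?reducible \<and> ?nontrivial_hom" if "c > 0" "prods_dvd c Q P" for c
  proof -
    obtain h where h: "h \<in> hom (solenoid P) (solenoid Q)" "continuous_on (carrier (solenoid P)) h"
      "\<And>g. h g 0 = g 0 ^ c"
      by (rule solenoid_hom_if_prods_dvd[of Q c P, OF Q_pos \<open>prods_dvd c Q P\<close>]) (rule that)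
    show ?thesis
      using borel_reducible_if_hom[of Q P, OF Q_pos P_pos \<open>c > 0\<close> h]
        nontrivial_if_power_at_0[of P c h, OF P_pos \<open>c > 0\<close> h(3)] h(1,2) by blast
  qed
  moreover have "\<exists>c>0. prods_dvd c Q P" if "?reducible \<or> ?nontrivial_hom"
    using that prods_dvd_if_borel_reducible[of P Q, OF P_pos Q_pos]
      prods_dvd_if_solenoid_hom[of P Q, OF P_pos Q_pos] by metis
  ultimately show ?thesis
    by blast
qed

end
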